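(* Let $B$ be an elliptic or doubly parabolic finite Blaschke product of degree $d\ge2$. Let $\lambda_i$, $i\ge 0$, be positive real numbers with $\lambda_0>\lambda_1>\dots$ and $\lim_{n\to\infty}\lambda_n=0$. Then there is $w\in\mathbb{A}$ such that the operator $T:\mathbb{A}\to\mathbb{A}$, $(Tf)(z)=w(z)f(B(z))$, $f\in\mathbb{A}$, $z\in\mathbb{D}$, satisfies $$\sigma_{usf}(T)=\{0\}\cup\bigcup_{i\ge0}\lambda_i\mathbb{T}.$$
   Context: $\mathbb{U}$ is the open unit disc, $\mathbb{D}$ the closed unit disc, $\mathbb{T}=\partial\mathbb{D}$; $\lambda\mathbb{T}=\{\lambda t:t\in\mathbb{T}\}$. The disc algebra $\mathbb{A}$ consists of functions analytic in $\mathbb{U}$ and continuous on $\mathbb{D}$, with the sup norm. A finite Blaschke product of degree $d$ is $B(z)=e^{i\theta}\prod_{j=1}^d \frac{z-a_j}{1-\overline{a_j}z}$, $|a_j|<1$. Its Wolff–Denjoy point $z_0\in\mathbb{D}$ is the unique point such that the iterates of $B$ converge to $z_0$ uniformly on compact subsets of $\mathbb{U}$; $B$ is elliptic if $z_0\in\mathbb{U}$, and doubly parabolic if $z_0\in\mathbb{T}$, $|B'(z_0)|=1$ and $z_0$ is a fixed point of multiplicity 2. For a bounded operator $T$ on a Banach space $X$, $\sigma_{usf}(T)$ is the set of $\lambda$ for which there exist $x_n\in X$, $\|x_n\|=1$, with $Tx_n-\lambda x_n\to0$ and $(x_n)$ having no norm-convergent subsequence. *)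

theory Defs
  imports "HOL-Complex_Analysis.Complex_Analysis"
begin

text \<open>The disc algebra: analytic in the open unit disc, continuous on the closed disc.
  Values outside the closed disc are irrelevant (the norm only sees the closed disc).\<close>
definition disc_algebra :: "(complex \<Rightarrow> complex) set" where
  "disc_algebra = {f. f holomorphic_on ball 0 1 \<and> continuous_on (cball 0 1) f}"

definition dnorm :: "(complex \<Rightarrow> complex) \<Rightarrow> real" where
  "dnorm f = (SUP z\<in>cball 0 1. cmod (f z))"

definition blaschke :: "real \<Rightarrow> (nat \<Rightarrow> complex) \<Rightarrow> nat \<Rightarrow> complex \<Rightarrow> complex" where
  "blaschke \<theta> a d z = exp (\<i> * of_real \<theta>) * (\<Prod>j<d. (z - a j) / (1 - cnj (a j) * z))"

definition wolff_point :: "(complex \<Rightarrow> complex) \<Rightarrow> complex \<Rightarrow> bool" where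
  "wolff_point B z0 \<longleftrightarrow> z0 \<in> cball 0 1 \<and>
     (\<forall>K. compact K \<and> K \<subseteq> ball 0 1 \<longrightarrow> uniform_limit K (\<lambda>n. (B ^^ n)) (\<lambda>_. z0) sequentially)"

definition elliptic :: "(complex \<Rightarrow> complex) \<Rightarrow> bool" where
  "elliptic B \<longleftrightarrow> (\<exists>z0. wolff_point B z0 \<and> z0 \<in> ball 0 1)"

definition doubly_parabolic :: "(complex \<Rightarrow> complex) \<Rightarrow> bool" where
  "doubly_parabolic B \<longleftrightarrow> (\<exists>z0. wolff_point B z0 \<and> cmod z0 = 1 \<and> cmod (deriv B z0) = 1
      \<and> B z0 = z0 \<and> zorder (\<lambda>z. B z - z) z0 = 2)"

definition usf_spectrum :: "((complex \<Rightarrow> complex) \<Rightarrow> (complex \<Rightarrow> complex)) \<Rightarrow> complex set" where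
  "usf_spectrum T = {\<mu>. \<exists>x :: nat \<Rightarrow> complex \<Rightarrow> complex.
      (\<forall>n. x n \<in> disc_algebra \<and> dnorm (x n) = 1) \<and>
      (\<lambda>n. dnorm (\<lambda>z. T (x n) z - \<mu> * x n z)) \<longlonglongrightarrow> 0 \<and>
      \<not> (\<exists>r g. strict_mono r \<and> g \<in> disc_algebra \<and>
             (\<lambda>n. dnorm (\<lambda>z. x (r n) z - g z)) \<longlonglongrightarrow> 0)}"

end

theory Submission
  imports Defs
begin

text \<open>
  On the unit circle \<open>B\<close> lifts to an increasing map \<open>\<phi>\<close> of the line with
  \<open>\<phi> (x + 2\<pi>) = \<phi> x + 2\<pi> d\<close>. For a boundary fixed point other than the Wolff point, Julia's
  inequality makes the multiplier larger than 1. For each \<open>n \<ge> 2\<close> the equation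
  \<open>\<phi>\<^sup>n x = x + 2\<pi>\<close> yields a periodic orbit of length exactly \<open>n\<close>; these orbits accumulate only on
  a countable homoclinic set \<open>H\<close>, so \<open>E = H \<union> (\<Union>i. O\<^sub>i)\<close> is closed, countable and forward invariant.
  By a Fatou type construction there is a weight \<open>w\<close> in the disc algebra with \<open>w = \<lambda>\<^sub>i\<close> on \<open>O\<^sub>i\<close>,
  with zero set \<open>B\<^sup>-\<^sup>1 E - (\<Union>i. O\<^sub>i)\<close>, and with \<open>\<bar>w\<bar> \<le> \<lambda>\<^sub>0\<close>.

  An approximate eigenvector for \<open>\<mu> \<noteq> 0\<close> concentrates at a point \<open>z\<close> of the circle with
  \<open>\<bar>\<mu>\<bar>\<^sup>k \<le> \<bar>w z \<cdots> w (B\<^sup>k\<^sup>-\<^sup>1 z)\<bar>\<close>, while the products along all backward orbits of \<open>z\<close> are at most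
  \<open>\<bar>\<mu>\<bar>\<^sup>k\<close>. If \<open>z\<close> is in \<open>O\<^sub>i\<close>, this gives \<open>\<bar>\<mu>\<bar> = \<lambda>\<^sub>i\<close>; the other points of \<open>E\<close> are zeros of \<open>w\<close>;
  and if \<open>z\<close> is not in \<open>E\<close>, no zero of \<open>w\<close> lies on its backward orbits, one of which converges to
  \<open>O\<^sub>0\<close>, so that \<open>\<bar>\<mu>\<bar> = \<lambda>\<^sub>0\<close>. Conversely, since \<open>w\<close> vanishes on \<open>B\<^sup>-\<^sup>1 O\<^sub>i - O\<^sub>i\<close> and \<open>O\<^sub>i\<close> is
  repelling, sums of bumps at \<open>O\<^sub>i\<close> that vary slowly on the logarithmic scale are approximate
  eigenvectors for every \<open>\<mu>\<close> of modulus \<open>\<lambda>\<^sub>i\<close>.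
\<close>

section \<open>Interpolation in the disc algebra\<close>

lemma disc_algebraI:
  "f holomorphic_on ball 0 1 \<Longrightarrow> continuous_on (cball 0 1) f \<Longrightarrow> f \<in> disc_algebra"
  by (simp add: disc_algebra_def)

lemma norm_le_dnorm:
  assumes "continuous_on (cball 0 1) f" "z \<in> cball 0 1"
  shows "cmod (f z) \<le> dnorm f"
proof -
  have "compact ((\<lambda>z. cmod (f z)) ` cball 0 1)"
    by (intro compact_continuous_image continuous_intros assms) simp
  then have "bdd_above ((\<lambda>z. cmod (f z)) ` cball 0 1)"
    by (simp add: bounded_imp_bdd_above compact_imp_bounded)
  then show ?thesis
    unfolding dnorm_def using assms(2) by (rule cSUP_upper2) simp
qed

lemma dnorm_le:
  assumes "\<And>z. z \<in> cball 0 1 \<Longrightarrow> cmod (f z) \<le> c"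
  shows "dnorm f \<le> c"
  unfolding dnorm_def by (rule cSUP_least) (use assms in auto)

lemma dnorm_cong:
  assumes "\<And>z. z \<in> cball 0 1 \<Longrightarrow> f z = g z"
  shows "dnorm f = dnorm g"
  unfolding dnorm_def by (rule SUP_cong) (use assms in auto)

text \<open>The maximum modulus principle moves the supremum to the circle, so an approximate
  eigenvector of norm 1 has a boundary point where its modulus is exactly 1.\<close>

lemma dnorm_attained_on_sphere:
  assumes "f \<in> disc_algebra"
  shows "\<exists>z\<in>sphere 0 1. cmod (f z) = dnorm f"
proof -
  have f: "f holomorphic_on ball 0 1" "continuous_on (cball 0 1) f"
    using assms by (auto simp: disc_algebra_def)
  have "continuous_on (sphere 0 1) (\<lambda>z. cmod (f z))"
    by (intro continuous_intros continuous_on_subset[OF f(2)]) auto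
  then obtain z where z: "z \<in> sphere 0 1" "\<And>y. y \<in> sphere 0 1 \<Longrightarrow> cmod (f y) \<le> cmod (f z)"
    using continuous_attains_sup[of "sphere 0 1" "\<lambda>z. cmod (f z)"] by auto
  have "cmod (f y) \<le> cmod (f z)" if "y \<in> cball 0 1" for y
    by (rule maximum_modulus_frontier[of f "cball 0 1"]) (use f z that in auto)
  then have "dnorm f \<le> cmod (f z)" by (rule dnorm_le)
  moreover have "cmod (f z) \<le> dnorm f"
    using norm_le_dnorm[OF f(2)] z(1) by auto
  ultimately show ?thesis using z(1) by auto
qed

lemma uniform_limit_disc_algebra:
  assumes "\<And>n. f n \<in> disc_algebra" "uniform_limit (cball 0 1) f g sequentially"
  shows "g \<in> disc_algebra"
proof (rule disc_algebraI)
  show "continuous_on (cball 0 1) g"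
    using assms by (intro uniform_limit_theorem[OF _ assms(2)]) (auto simp: disc_algebra_def)
  show "g holomorphic_on ball 0 1"
  proof (rule holomorphic_uniform_sequence)
    fix z :: complex assume "z \<in> ball 0 1"
    then obtain e where "e > 0" "cball z e \<subseteq> ball 0 1"
      using open_contains_cball[of "ball (0::complex) 1"] by (metis open_ball)
    then show "\<exists>d>0. cball z d \<subseteq> ball 0 1 \<and> uniform_limit (cball z d) f g sequentially"
      using uniform_limit_on_subset[OF assms(2), of "cball z e"] ball_subset_cball by blast
  qed (use assms(1) in \<open>auto simp: disc_algebra_def\<close>)
qed

section \<open>Functions vanishing on a countable closed subset of the circle\<close>

lemma norm_one_minus_cnj_sphere:
  assumes "cmod p = 1"
  shows "cmod (1 - z * cnj p) = dist z p"
proof -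
  have "p * cnj p = 1" using assms by (simp add: complex_norm_square[symmetric])
  then have "p * (1 - z * cnj p) = p - z" by algebra
  then have "cmod p * cmod (1 - z * cnj p) = cmod (p - z)" by (metis norm_mult)
  then show ?thesis using assms by (simp add: dist_norm norm_minus_commute)
qed

text \<open>\<open>1 - z * cnj p\<close> serves throughout as the coordinate at a boundary point
  \<open>p\<close>: it vanishes at \<open>p\<close> and maps the closed disc into the closed right
  half-plane.\<close>

lemma Re_one_minus_cnj_nonneg:
  assumes "cmod p = 1" "cmod z \<le> 1"
  shows "0 \<le> Re (1 - z * cnj p)"
proof -
  have "Re (z * cnj p) \<le> cmod (z * cnj p)" by (rule complex_Re_le_cmod)
  also have "\<dots> \<le> 1" using assms by (simp add: norm_mult)
  finally show ?thesis by simp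
qed

lemma one_minus_cnj_notin_nonpos:
  assumes "cmod p = 1" "cmod z \<le> 1" "z \<noteq> p"
  shows "1 - z * cnj p \<notin> \<real>\<^sub>\<le>\<^sub>0"
proof
  assume *: "1 - z * cnj p \<in> \<real>\<^sub>\<le>\<^sub>0"
  then have "1 - z * cnj p = 0"
    using Re_one_minus_cnj_nonneg[OF assms(1,2)]
    by (auto simp: complex_nonpos_Reals_iff complex_eq_iff)
  then show False using norm_one_minus_cnj_sphere[OF assms(1), of z] assms(3) by simp
qed

text \<open>The principal root halves the argument, so the right half-plane goes into the sector
  \<bar>Im\<bar> \<le> Re, which inversion preserves. The sector is closed under sums, so terms of
  this form cannot cancel.\<close>

lemma inverse_csqrt_cone:
  assumes "0 \<le> Re u" "u \<noteq> 0"
  shows "\<bar>Im (inverse (csqrt u))\<bar> \<le> Re (inverse (csqrt u))"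
    and "cmod (inverse (csqrt u)) \<le> 2 * Re (inverse (csqrt u))"
    and "0 < Re (inverse (csqrt u))"
proof -
  obtain c where c: "c^2 = u" "0 \<le> Re c" and cs: "csqrt u = c"
    using Re_csqrt[of u] power2_csqrt[of u] by metis
  have "Re (c^2) = (Re c)^2 - (Im c)^2" by (simp add: power2_eq_square)
  then have "(Im c)^2 \<le> (Re c)^2" using c assms by simp
  then have *: "\<bar>Im c\<bar> \<le> Re c" using c(2) by (simp add: abs_le_square_iff[symmetric])
  have "c \<noteq> 0" using c assms by auto
  then have n: "(Re c)^2 + (Im c)^2 > 0" by (simp add: complex_neq_0)
  have 1: "\<bar>Im (inverse c)\<bar> \<le> Re (inverse c)"
    using * n by (simp add: divide_right_mono)
  have "cmod (inverse c) \<le> \<bar>Re (inverse c)\<bar> + \<bar>Im (inverse c)\<bar>" by (rule cmod_le)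
  then have 2: "cmod (inverse c) \<le> 2 * Re (inverse c)" using 1 by linarith
  have "0 < cmod (inverse c)" using \<open>c \<noteq> 0\<close> by simp
  then have 3: "0 < Re (inverse c)" using 2 by linarith
  show "\<bar>Im (inverse (csqrt u))\<bar> \<le> Re (inverse (csqrt u))"
    and "cmod (inverse (csqrt u)) \<le> 2 * Re (inverse (csqrt u))"
    and "0 < Re (inverse (csqrt u))"
    unfolding cs by (rule 1 2 3)+
qed

text \<open>The function is \<open>1 / (\<Sum>k. 2\<^sup>-\<^sup>k (1 - z cnj \<zeta>\<^sub>k)\<^sup>-\<^sup>1\<^sup>/\<^sup>2)\<close> for an enumeration \<open>\<zeta>\<close> of \<open>P\<close>: every summand lies in the
  sector \<open>\<bar>Im\<bar> \<le> Re\<close> and is unbounded near its own point, so the sum tends to infinity at \<open>P\<close>.\<close>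

lemma ex_disc_algebra_zero_set:
  assumes P: "P \<subseteq> sphere 0 1" "closed P" "countable P"
  shows "\<exists>R\<in>disc_algebra. (\<forall>z\<in>P. R z = 0) \<and>
           (\<forall>z\<in>cball 0 1 - P. 0 < Re (R z) \<and> \<bar>Im (R z)\<bar> \<le> Re (R z))"
proof (cases "P = {}")
  case True
  then show ?thesis by (intro bexI[of _ "\<lambda>_. 1"]) (auto simp: disc_algebra_def)
next
  case False
  \<comment> \<open>A finite \<open>P\<close> is enumerated with repetitions; this is harmless, as
    each point keeps at least one summand.\<close>
  define \<zeta> where "\<zeta> = from_nat_into P"
  have ran: "range \<zeta> = P" unfolding \<zeta>_def by (rule range_from_nat_into[OF False P(3)])
  have n1: "cmod (\<zeta> k) = 1" for k
    using P(1) ran by (auto simp: subset_eq)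
  define v where "v = (\<lambda>k z. inverse (csqrt (1 - z * cnj (\<zeta> k))))"
  define t where "t = (\<lambda>k z. of_real ((1/2)^k) * v k z)"
  define S where "S = (\<lambda>z. \<Sum>k. t k z)"
  \<comment> \<open>Points of the disc at distance at least \<delta> from all of \<open>P\<close>;
    there the series has a geometric majorant.\<close>
  define X where "X = (\<lambda>\<delta>. {z \<in> cball 0 1. \<forall>p\<in>P. \<delta> \<le> dist z p})"
  have nv: "cmod (v k z) = 1 / sqrt (dist z (\<zeta> k))" for k z
    by (simp add: v_def norm_inverse norm_one_minus_cnj_sphere[OF n1] divide_inverse)
  have bnd: "cmod (t k z) \<le> (1/2)^k * (1 / sqrt \<delta>)" if "0 < \<delta>" "z \<in> X \<delta>" for \<delta> k z
  proof -
    have "\<delta> \<le> dist z (\<zeta> k)" using that(2) ran by (auto simp: X_def)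
    then have "1 / sqrt (dist z (\<zeta> k)) \<le> 1 / sqrt \<delta>"
      using that(1) by (intro divide_left_mono mult_pos_pos) auto
    then have "(1/2)^k * (1 / sqrt (dist z (\<zeta> k))) \<le> (1/2)^k * (1 / sqrt \<delta>)"
      by (intro mult_left_mono) auto
    then show ?thesis by (simp add: t_def norm_mult nv norm_power)
  qed
  have sumM: "summable (\<lambda>k. (1/2::real)^k * c)" for c
    by (intro summable_mult2 summable_geometric) simp
  have ul: "uniform_limit (X \<delta>) (\<lambda>n z. \<Sum>k<n. t k z) S sequentially" if "0 < \<delta>" for \<delta>
    unfolding S_def by (rule Weierstrass_m_test[OF bnd[OF that] sumM])
  have X_ex: "\<exists>\<delta>>0. cball 0 1 \<inter> cball z \<delta> \<subseteq> X \<delta>" if "z \<notin> P" for z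
  proof -
    define \<delta> where "\<delta> = infdist z P / 2"
    have "infdist z P > 0"
      using that P(2) False by (simp add: infdist_pos_not_in_closed)
    then have "\<delta> > 0" by (simp add: \<delta>_def)
    moreover have "cball 0 1 \<inter> cball z \<delta> \<subseteq> X \<delta>"
    proof
      fix y assume y: "y \<in> cball 0 1 \<inter> cball z \<delta>"
      have "\<delta> \<le> dist y p" if "p \<in> P" for p
      proof -
        have "2 * \<delta> \<le> dist z p" using infdist_le[OF that, of z] by (simp add: \<delta>_def)
        also have "\<dots> \<le> dist z y + dist y p" by (rule dist_triangle)
        finally show ?thesis using y by auto
      qed
      then show "y \<in> X \<delta>" using y by (simp add: X_def)
    qed
    ultimately show ?thesis by blast
  qed
  have ne: "z \<noteq> \<zeta> k" if "z \<notin> P" for z k using that ran by auto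
  have summ: "summable (\<lambda>k. t k z)" if z: "z \<in> cball 0 1 - P" for z
  proof -
    obtain \<delta> where "\<delta> > 0" "cball 0 1 \<inter> cball z \<delta> \<subseteq> X \<delta>" using X_ex z by blast
    then have "z \<in> X \<delta>" using z by auto
    then show ?thesis
      by (intro summable_comparison_test'[OF sumM[of "1 / sqrt \<delta>"]] bnd \<open>\<delta> > 0\<close>)
  qed
  have t_cont: "continuous_on (cball 0 1 - P) (t k)" for k
    unfolding t_def v_def
  proof (intro continuous_intros ballI)
    have *: "1 - z * cnj (\<zeta> k) \<in> - \<real>\<^sub>\<le>\<^sub>0" if "z \<in> cball 0 1 - P" for z
      using one_minus_cnj_notin_nonpos[OF n1, of z k] that ne by auto
    show "continuous_on (cball 0 1 - P) (\<lambda>z. csqrt (1 - z * cnj (\<zeta> k)))"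
      by (rule continuous_on_compose2[where t="- \<real>\<^sub>\<le>\<^sub>0", OF continuous_on_csqrt])
        (use * in \<open>auto intro!: continuous_intros\<close>)
    show "csqrt (1 - z * cnj (\<zeta> k)) \<noteq> 0" if "z \<in> cball 0 1 - P" for z
      using *[OF that] by auto
  qed
  have t_hol: "t k holomorphic_on ball 0 1" for k
    unfolding t_def v_def
  proof (intro holomorphic_intros)
    fix z :: complex assume z: "z \<in> ball 0 1"
    then have "z \<noteq> \<zeta> k" using n1[of k] by auto
    then show "1 - z * cnj (\<zeta> k) \<notin> \<real>\<^sub>\<le>\<^sub>0" using one_minus_cnj_notin_nonpos[OF n1] z by auto
    then show "csqrt (1 - z * cnj (\<zeta> k)) \<noteq> 0" by auto
  qed
  have PB: "ball 0 1 \<inter> P = {}" using P(1) by auto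
  have S_hol: "S holomorphic_on ball 0 1"
  proof (rule holomorphic_uniform_sequence)
    fix z :: complex assume z: "z \<in> ball 0 1"
    obtain \<delta> where \<delta>: "\<delta> > 0" "cball 0 1 \<inter> cball z \<delta> \<subseteq> X \<delta>" using X_ex z PB by blast
    obtain e where e: "e > 0" "cball z e \<subseteq> ball 0 1"
      using z open_contains_cball[of "ball (0::complex) 1"] by (metis open_ball)
    have "cball z (min \<delta> e) \<subseteq> X \<delta>" using \<delta> e ball_subset_cball by fastforce
    then show "\<exists>d>0. cball z d \<subseteq> ball 0 1 \<and> uniform_limit (cball z d) (\<lambda>n z. \<Sum>k<n. t k z) S sequentially"
      using uniform_limit_on_subset[OF ul[OF \<delta>(1)]] e \<delta>(1)
      by (intro exI[of _ "min \<delta> e"]) auto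
  qed (use t_hol in \<open>auto intro!: holomorphic_intros\<close>)
  have S_cont: "continuous_on (cball 0 1 - P) S"
    unfolding continuous_on_eq_continuous_within
  proof
    fix z assume z: "z \<in> cball 0 1 - P"
    obtain \<delta> where \<delta>: "\<delta> > 0" "cball 0 1 \<inter> cball z \<delta> \<subseteq> X \<delta>" using X_ex z by blast
    have "X \<delta> \<inter> P = {}" using \<delta>(1) by (force simp: X_def)
    then have sub: "cball 0 1 \<inter> cball z \<delta> \<subseteq> cball 0 1 - P" using \<delta>(2) by auto
    have "continuous_on (cball 0 1 \<inter> cball z \<delta>) S"
      by (rule uniform_limit_theorem[OF _ uniform_limit_on_subset[OF ul[OF \<delta>(1)] \<delta>(2)]])
        (intro always_eventually allI continuous_intros continuous_on_subset[OF t_cont sub], simp)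
    then have "continuous (at z within cball 0 1 \<inter> cball z \<delta>) S"
      using z \<delta>(1) by (auto simp: continuous_on_eq_continuous_within)
    then have "continuous (at z within (cball 0 1 - P) \<inter> ball z \<delta>) S"
      by (rule continuous_within_subset) auto
    moreover have "at z within (cball 0 1 - P) \<inter> ball z \<delta> = at z within cball 0 1 - P"
      by (rule at_within_nhd[of z "ball z \<delta>"]) (use \<delta>(1) in auto)
    ultimately show "continuous (at z within cball 0 1 - P) S" by simp
  qed
  have cone: "\<bar>Im (t k z)\<bar> \<le> Re (t k z)" "cmod (v k z) \<le> 2 * Re (v k z)" "0 < Re (t k z)"
    if "z \<in> cball 0 1 - P" for k z
  proof -
    have "0 \<le> Re (1 - z * cnj (\<zeta> k))" "1 - z * cnj (\<zeta> k) \<noteq> 0"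
      using Re_one_minus_cnj_nonneg[OF n1] one_minus_cnj_notin_nonpos[OF n1, of z k] ne that by force+
    from inverse_csqrt_cone[OF this]
    have v: "\<bar>Im (v k z)\<bar> \<le> Re (v k z)" "cmod (v k z) \<le> 2 * Re (v k z)" "0 < Re (v k z)"
      unfolding v_def by blast+
    have t: "Re (t k z) = (1/2)^k * Re (v k z)" "Im (t k z) = (1/2)^k * Im (v k z)"
      unfolding t_def by (simp_all del: of_real_power)
    show "cmod (v k z) \<le> 2 * Re (v k z)" by (rule v(2))
    show "\<bar>Im (t k z)\<bar> \<le> Re (t k z)" unfolding t abs_mult using v(1) by (simp add: divide_right_mono)
    show "0 < Re (t k z)" unfolding t using v(3) by simp
  qed
  have Re_S: "Re (S z) = (\<Sum>k. Re (t k z))" "summable (\<lambda>k. Re (t k z))"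
    and Im_S: "Im (S z) = (\<Sum>k. Im (t k z))" "summable (\<lambda>k. Im (t k z))"
    if "z \<in> cball 0 1 - P" for z
    using summ[OF that] unfolding S_def
    by (auto simp: Re_suminf Im_suminf intro: summable_Re summable_Im)
  have lower: "Re (t k z) \<le> Re (S z)" if "z \<in> cball 0 1 - P" for z k
    using sum_le_suminf[OF Re_S(2)[OF that], of "{k}"] cone(3)[OF that] Re_S(1)[OF that]
    by (auto simp: less_imp_le)
  have S_pos: "0 < Re (S z)" if "z \<in> cball 0 1 - P" for z
    using lower[OF that, of 0] cone(3)[OF that, of 0] by linarith
  have S_cone: "\<bar>Im (S z)\<bar> \<le> Re (S z)" if "z \<in> cball 0 1 - P" for z
  proof -
    have "\<bar>Im (S z)\<bar> \<le> (\<Sum>k. Re (t k z))"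
      unfolding Im_S(1)[OF that] real_norm_def[symmetric]
      by (rule norm_suminf_le[OF _ Re_S(2)[OF that]]) (use cone(1)[OF that] in simp)
    then show ?thesis by (simp add: Re_S(1)[OF that])
  qed
  define R where "R = (\<lambda>z. if z \<in> P then 0 else inverse (S z))"
  \<comment> \<open>All summands have positive real part, so a single one bounds the real part of
    \<open>S\<close> from below. The resulting root bound at each point of \<open>P\<close> makes
    \<open>R\<close> continuous there, even if \<open>P\<close> accumulates.\<close>
  have R_bound: "cmod (R z) \<le> 2 * 2^k * sqrt (dist z (\<zeta> k))" if "z \<in> cball 0 1" for z k
  proof (cases "z \<in> P")
    case False
    then have z: "z \<in> cball 0 1 - P" using that by auto
    have "dist z (\<zeta> k) > 0" using ne[OF False, of k] by simp
    have "(1/2)^k * (1 / sqrt (dist z (\<zeta> k))) = (1/2)^k * cmod (v k z)" by (simp add: nv)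
    also have "\<dots> \<le> 2 * Re (t k z)"
      using mult_left_mono[OF cone(2)[OF z, of k], of "(1/2)^k"]
      by (simp add: t_def del: of_real_power)
    also have "\<dots> \<le> 2 * cmod (S z)" using lower[OF z, of k] complex_Re_le_cmod[of "S z"] by linarith
    finally have "(1/2)^k * (1 / sqrt (dist z (\<zeta> k))) \<le> 2 * cmod (S z)" .
    moreover have "cmod (S z) > 0" using S_pos[OF z] by auto
    ultimately show ?thesis using False \<open>dist z (\<zeta> k) > 0\<close>
      by (simp add: R_def norm_inverse norm_divide field_simps)
  qed (simp add: R_def)
  have "R \<in> disc_algebra"
  proof (rule disc_algebraI)
    show "R holomorphic_on ball 0 1"
    proof (rule holomorphic_transform)
      show "(\<lambda>z. inverse (S z)) holomorphic_on ball 0 1"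
      proof (intro holomorphic_intros S_hol)
        fix z :: complex assume "z \<in> ball 0 1"
        then have "z \<in> cball 0 1 - P" using PB by auto
        then show "S z \<noteq> 0" using S_pos[of z] by auto
      qed
    qed (use PB in \<open>auto simp: R_def\<close>)
    show "continuous_on (cball 0 1) R"
      unfolding continuous_on_eq_continuous_within
    proof
      fix z :: complex assume z: "z \<in> cball 0 1"
      show "continuous (at z within cball 0 1) R"
      proof (cases "z \<in> P")
        case True
        then obtain k where k: "z = \<zeta> k" using ran by auto
        have "((\<lambda>y. 2 * 2^k * sqrt (dist y (\<zeta> k))) \<longlongrightarrow> 2 * 2^k * sqrt (dist z (\<zeta> k))) (at z within cball 0 1)"
          by (intro tendsto_intros)
        then have "((\<lambda>y. 2 * 2^k * sqrt (dist y (\<zeta> k))) \<longlongrightarrow> 0) (at z within cball 0 1)"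
          by (simp add: k)
        then have "(R \<longlongrightarrow> 0) (at z within cball 0 1)"
          by (rule Lim_null_comparison[rotated]) (use R_bound in \<open>auto simp: eventually_at_filter\<close>)
        then show ?thesis using True by (simp add: continuous_within R_def)
      next
        case False
        have "continuous_on (cball 0 1 - P) (\<lambda>z. inverse (S z))"
        proof (intro continuous_intros S_cont ballI)
          show "S z \<noteq> 0" if "z \<in> cball 0 1 - P" for z using S_pos[OF that] by auto
        qed
        then have "continuous_on (cball 0 1 - P) R"
          by (rule continuous_on_eq) (auto simp: R_def)
        then have "continuous (at z within cball 0 1 - P) R"
          using z False by (auto simp: continuous_on_eq_continuous_within)
        moreover have "at z within cball 0 1 - P = at z within cball 0 1"
          by (rule at_within_nhd[of z "- P"]) (use False P(2) in auto)
        ultimately show ?thesis by simp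
      qed
    qed
  qed
  moreover have "0 < Re (R z) \<and> \<bar>Im (R z)\<bar> \<le> Re (R z)" if z: "z \<in> cball 0 1 - P" for z
  proof -
    have "(Re (S z))^2 + (Im (S z))^2 > 0" using S_pos[OF z] by (simp add: sum_power2_gt_zero_iff)
    then show ?thesis using z S_pos[OF z] S_cone[OF z] by (simp add: R_def divide_right_mono)
  qed
  ultimately show ?thesis by (intro bexI[of _ R]) (auto simp: R_def)
qed

text \<open>With \<open>R0\<close> vanishing on \<open>N\<close> and \<open>R1\<close> on
  \<open>P\<close>, the quotient R0 / (R0 + R1) works: both values lie in the sector \<bar>Im\<bar>
  \<le> Re, so their real inner product is nonnegative, which gives modulus at most 1 and, off
  \<open>N\<close>, positive real part.\<close>

lemma ex_disc_algebra_interpolation: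
  assumes P: "P \<subseteq> sphere 0 1" "closed P" "countable P"
    and N: "N \<subseteq> sphere 0 1" "closed N" "countable N" and "P \<inter> N = {}"
  shows "\<exists>Q\<in>disc_algebra. (\<forall>z\<in>P. Q z = 1) \<and> (\<forall>z\<in>N. Q z = 0) \<and>
           (\<forall>z\<in>cball 0 1. cmod (Q z) \<le> 1) \<and> (\<forall>z\<in>cball 0 1 - N. 0 < Re (Q z))"
proof -
  obtain R1 where R1: "R1 \<in> disc_algebra" "\<And>z. z \<in> P \<Longrightarrow> R1 z = 0"
      "\<And>z. z \<in> cball 0 1 - P \<Longrightarrow> 0 < Re (R1 z) \<and> \<bar>Im (R1 z)\<bar> \<le> Re (R1 z)"
    using ex_disc_algebra_zero_set[OF P] by blast
  obtain R0 where R0: "R0 \<in> disc_algebra" "\<And>z. z \<in> N \<Longrightarrow> R0 z = 0"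
      "\<And>z. z \<in> cball 0 1 - N \<Longrightarrow> 0 < Re (R0 z) \<and> \<bar>Im (R0 z)\<bar> \<le> Re (R0 z)"
    using ex_disc_algebra_zero_set[OF N] by blast
  have c1: "0 \<le> Re (R1 z)" "\<bar>Im (R1 z)\<bar> \<le> Re (R1 z)" if "z \<in> cball 0 1" for z
    using R1(2)[of z] R1(3)[of z] that by (cases "z \<in> P"; force)+
  have c0: "0 \<le> Re (R0 z)" "\<bar>Im (R0 z)\<bar> \<le> Re (R0 z)" if "z \<in> cball 0 1" for z
    using R0(2)[of z] R0(3)[of z] that by (cases "z \<in> N"; force)+
  have pos: "0 < Re (R0 z + R1 z)" if "z \<in> cball 0 1" for z
    using c1[OF that] c0[OF that] R1(3)[of z] R0(3)[of z] that assms(7)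
    by (cases "z \<in> P") fastforce+
  have nz: "R0 z + R1 z \<noteq> 0" if "z \<in> cball 0 1" for z
    using pos[OF that] by (metis less_irrefl zero_complex.sel(1))
  have inner: "0 \<le> Re (R0 z) * Re (R1 z) + Im (R0 z) * Im (R1 z)" if "z \<in> cball 0 1" for z
  proof -
    have "\<bar>Im (R0 z) * Im (R1 z)\<bar> \<le> Re (R0 z) * Re (R1 z)"
      unfolding abs_mult using c0[OF that] c1[OF that] by (intro mult_mono) auto
    then show ?thesis by linarith
  qed
  define Q where "Q = (\<lambda>z. R0 z / (R0 z + R1 z))"
  have "Q \<in> disc_algebra"
    using R0(1) R1(1) nz unfolding Q_def disc_algebra_def
    by (auto intro!: holomorphic_intros continuous_intros)
  moreover have "Q z = 1" if "z \<in> P" for z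
  proof -
    have "z \<in> cball 0 1" using that P(1) by auto
    then show ?thesis using nz[of z] R1(2)[OF that] by (simp add: Q_def)
  qed
  moreover have "Q z = 0" if "z \<in> N" for z using R0(2)[OF that] by (simp add: Q_def)
  moreover have "cmod (Q z) \<le> 1" if z: "z \<in> cball 0 1" for z
  proof -
    have "(cmod (R0 z))^2 \<le> (cmod (R0 z + R1 z))^2"
      unfolding cmod_power2 using inner[OF z] by (simp add: power2_eq_square algebra_simps)
    then have "cmod (R0 z) \<le> cmod (R0 z + R1 z)" by (rule power2_le_imp_le) simp
    then show ?thesis using nz[OF z] by (simp add: Q_def norm_divide divide_le_eq_1)
  qed
  moreover have "0 < Re (Q z)" if z: "z \<in> cball 0 1 - N" for z
  proof -
    have "0 < Re (R0 z)" using R0(3)[OF z] by simp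
    then have "0 < Re (R0 z) * Re (R0 z) + Im (R0 z) * Im (R0 z)"
      by (simp add: add_pos_nonneg)
    then have "0 < Re (R0 z) * Re (R0 z + R1 z) + Im (R0 z) * Im (R0 z + R1 z)"
      using inner[of z] z by (simp add: algebra_simps)
    moreover have "(Re (R0 z + R1 z))^2 + (Im (R0 z + R1 z))^2 > 0"
      using pos[of z] z by (auto simp: sum_power2_gt_zero_iff)
    ultimately show ?thesis by (simp add: Q_def Re_divide)
  qed
  ultimately show ?thesis by (intro bexI[of _ Q]) auto
qed

section \<open>Julia's inequality and boundary fixed points\<close>

lemma one_minus_norm_Moebius:
  assumes "cmod w < 1" "cmod z < 1"
  shows "1 - (cmod (Moebius_function 0 w z))^2 =
           (1 - (cmod w)^2) * (1 - (cmod z)^2) / (cmod (1 - cnj w * z))^2"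
proof -
  have "cmod (cnj w * z) < 1" using assms norm_mult_less[of "cnj w" 1 z 1] by simp
  then have "1 - cnj w * z \<noteq> 0" by (metis norm_one order_less_irrefl right_minus_eq)
  then have "(cmod (1 - cnj w * z))^2 \<noteq> 0" by simp
  moreover have "(cmod (1 - cnj w * z))^2 - (cmod (z - w))^2 = (1 - (cmod w)^2) * (1 - (cmod z)^2)"
    by (simp add: cmod_power2) algebra
  ultimately show ?thesis
    by (simp add: Moebius_function_simple norm_divide power_divide field_simps)
qed

text \<open>Moebius maps move \<open>a\<close> and \<open>F a\<close> to 0 and reduce the claim to
  Schwarz's lemma. It is stated for one minus the squared pseudohyperbolic distance, a form that
  allows \<open>a\<close> to tend to the boundary after division.\<close>

lemma Schwarz_Pick:
  assumes hol: "F holomorphic_on ball 0 1" and maps: "\<And>z. cmod z < 1 \<Longrightarrow> cmod (F z) < 1"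
    and "cmod a < 1" "cmod z < 1"
  shows "(1 - (cmod a)^2) * (1 - (cmod z)^2) / (cmod (1 - cnj a * z))^2 \<le>
         (1 - (cmod (F a))^2) * (1 - (cmod (F z))^2) / (cmod (1 - cnj (F a) * F z))^2"
proof -
  define h where "h = (\<lambda>\<zeta>. Moebius_function 0 (F a) (F (Moebius_function 0 (- a) \<zeta>)))"
  define \<zeta> where "\<zeta> = Moebius_function 0 a z"
  have M: "cmod (Moebius_function 0 (- a) y) < 1" if "cmod y < 1" for y
    using Moebius_function_norm_lt_1 assms(3) that by simp
  have "cmod (h \<zeta>) \<le> cmod \<zeta>"
  proof (rule Schwarz_Lemma(1))
    have "(Moebius_function 0 (F a) \<circ> (F \<circ> Moebius_function 0 (- a))) holomorphic_on ball 0 1"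
      by (intro holomorphic_on_compose_gen[where t="ball 0 1"] hol Moebius_function_holomorphic)
        (use assms maps M in auto)
    then show "h holomorphic_on ball 0 1" by (simp add: h_def o_def)
    show "h 0 = 0"
      by (simp add: h_def Moebius_function_of_zero Moebius_function_eq_zero)
    show "cmod (h y) < 1" if "cmod y < 1" for y
      using Moebius_function_norm_lt_1 maps M assms(3) that by (simp add: h_def)
    show "cmod \<zeta> < 1" unfolding \<zeta>_def by (intro Moebius_function_norm_lt_1 assms)
  qed
  moreover have "h \<zeta> = Moebius_function 0 (F a) (F z)"
    using Moebius_function_compose[of "- a" a z] assms by (simp add: h_def \<zeta>_def)
  ultimately have "(cmod (Moebius_function 0 (F a) (F z)))^2 \<le> (cmod (Moebius_function 0 a z))^2"
    by (simp add: \<zeta>_def power_mono)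
  then have "1 - (cmod (Moebius_function 0 a z))^2 \<le> 1 - (cmod (Moebius_function 0 (F a) (F z)))^2"
    by simp
  then show ?thesis using assms maps by (simp add: one_minus_norm_Moebius)
qed

text \<open>Schwarz-Pick is applied with \<open>a\<close> running radially to \<open>p\<close>. The
  derivative at \<open>p\<close> controls the ratio of 1 - \<bar>F a\<bar>^2 to 1 - \<bar>a\<bar>^2,
  which tends to \<beta>.\<close>

lemma Julia_inequality:
  assumes hol: "F holomorphic_on ball 0 1" and maps: "\<And>z. cmod z < 1 \<Longrightarrow> cmod (F z) < 1"
    and p: "cmod p = 1" "F p = p" and der: "(F has_field_derivative of_real \<beta>) (at p)"
    and z: "cmod z < 1"
  shows "(cmod (p - F z))^2 * (1 - (cmod z)^2) \<le> \<beta> * (cmod (p - z))^2 * (1 - (cmod (F z))^2)"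
proof -
  define s where "s = (\<lambda>n::nat. 1 / real (n + 2))"
  define a where "a = (\<lambda>n. of_real (1 - s n) * p)"
  define q where "q = (\<lambda>n. (F (a n) - F p) / (a n - p))"
  have s: "0 < s n" "s n < 1" for n by (auto simp: s_def)
  have s_lim: "s \<longlonglongrightarrow> 0" unfolding s_def by (rule LIMSEQ_ignore_initial_segment[OF lim_1_over_n])
  have a_lim: "a \<longlonglongrightarrow> p"
    unfolding a_def by (rule tendsto_eq_intros s_lim refl | simp)+
  have ap: "a n - p = - of_real (s n) * p" for n by (simp add: a_def algebra_simps)
  have p0: "p \<noteq> 0" using p(1) by auto
  have a_ne: "a n \<noteq> p" for n using ap[of n] s[of n] p0 by auto
  have na: "cmod (a n) = 1 - s n" for n 
    using s[of n] p(1) by (simp add: a_def norm_mult del: of_real_diff)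
  have "((\<lambda>y. (F y - F p) / (y - p)) \<longlongrightarrow> of_real \<beta>) (at p)"
    using der by (simp add: has_field_derivative_iff)
  moreover have "filterlim a (at p) sequentially"
    using a_lim a_ne by (simp add: filterlim_at)
  ultimately have q_lim: "q \<longlonglongrightarrow> of_real \<beta>"
    unfolding q_def by (rule filterlim_compose)
  have Fa: "F (a n) = p * (1 - of_real (s n) * q n)" for n
  proof -
    have "F (a n) - p = q n * (a n - p)" using a_ne[of n] p(2) by (simp add: q_def)
    then show ?thesis unfolding ap by (simp add: algebra_simps)
  qed
  have nFa: "1 - (cmod (F (a n)))^2 = s n * (2 * Re (q n) - s n * (cmod (q n))^2)" for n
  proof -
    have "(cmod (F (a n)))^2 = (cmod (1 - of_real (s n) * q n))^2"
      using p(1) by (simp add: Fa norm_mult)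
    then show ?thesis by (simp add: cmod_power2) (simp add: power2_eq_square algebra_simps)
  qed
  have pos1: "0 < cmod (1 - cnj u * v)" if "cmod u < 1" "cmod v < 1" for u v
    using norm_mult_less[of "cnj u" 1 v 1] that
    by (metis complex_mod_cnj mult_1 norm_one order_less_irrefl right_minus_eq zero_less_norm_iff)
  have "(2 - s n) * (1 - (cmod z)^2) * (cmod (1 - cnj (F (a n)) * F z))^2 \<le>
        (2 * Re (q n) - s n * (cmod (q n))^2) * (1 - (cmod (F z))^2) * (cmod (1 - cnj (a n) * z))^2" for n
  proof -
    have an: "cmod (a n) < 1" using na s[of n] by simp
    have "(1 - (cmod (a n))^2) * (1 - (cmod z)^2) * (cmod (1 - cnj (F (a n)) * F z))^2 \<le>
      (1 - (cmod (F (a n)))^2) * (1 - (cmod (F z))^2) * (cmod (1 - cnj (a n) * z))^2"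
      using Schwarz_Pick[OF hol maps an z] pos1[OF an z] pos1[OF maps[OF an] maps[OF z]]
      by (simp add: divide_simps mult.commute)
    moreover have "1 - (cmod (a n))^2 = s n * (2 - s n)"
      by (simp add: na power2_eq_square algebra_simps)
    ultimately have "s n * ((2 - s n) * (1 - (cmod z)^2) * (cmod (1 - cnj (F (a n)) * F z))^2) \<le>
        s n * ((2 * Re (q n) - s n * (cmod (q n))^2) * (1 - (cmod (F z))^2) * (cmod (1 - cnj (a n) * z))^2)"
      by (simp add: nFa mult.assoc)
    then show ?thesis using s(1)[of n] by simp
  qed
  moreover have "(\<lambda>n. (2 - s n) * (1 - (cmod z)^2) * (cmod (1 - cnj (F (a n)) * F z))^2)
      \<longlonglongrightarrow> (2 - 0) * (1 - (cmod z)^2) * (cmod (1 - cnj (p * (1 - of_real 0 * of_real \<beta>)) * F z))^2"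
    unfolding Fa by (intro tendsto_intros s_lim q_lim)
  moreover have "(\<lambda>n. (2 * Re (q n) - s n * (cmod (q n))^2) * (1 - (cmod (F z))^2) * (cmod (1 - cnj (a n) * z))^2)
      \<longlonglongrightarrow> (2 * Re (of_real \<beta>) - 0 * (cmod (of_real \<beta>))^2) * (1 - (cmod (F z))^2) * (cmod (1 - cnj p * z))^2"
    by (intro tendsto_intros s_lim q_lim a_lim)
  ultimately have "(2 - 0) * (1 - (cmod z)^2) * (cmod (1 - cnj (p * (1 - of_real 0 * of_real \<beta>)) * F z))^2
    \<le> (2 * Re (of_real \<beta>) - 0 * (cmod (of_real \<beta>))^2) * (1 - (cmod (F z))^2) * (cmod (1 - cnj p * z))^2"
    by (intro LIMSEQ_le) auto
  then show ?thesis
    using norm_one_minus_cnj_sphere[OF p(1), of z] norm_one_minus_cnj_sphere[OF p(1), of "F z"]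
    by (simp add: mult.commute[of "cnj p"] dist_norm norm_minus_commute[of _ p]) (simp add: algebra_simps)
qed

text \<open>By Julia's inequality the horodiscs at a boundary fixed point with multiplier at most 1 are
  forward invariant, which forces the orbits to converge to that point.\<close>

lemma boundary_fixed_point_repelling:
  assumes hol: "F holomorphic_on ball 0 1" and maps: "\<And>z. cmod z < 1 \<Longrightarrow> cmod (F z) < 1"
    and p: "cmod p = 1" "F p = p" and der: "(F has_field_derivative of_real \<beta>) (at p)"
    and lim: "\<And>z. cmod z < 1 \<Longrightarrow> (\<lambda>n. (F ^^ n) z) \<longlonglongrightarrow> z0" and "z0 \<noteq> p"
  shows "1 < \<beta>"
proof (rule ccontr)
  assume "\<not> 1 < \<beta>"
  then have \<beta>: "\<beta> \<le> 1" by simp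
  \<comment> \<open>Julia's quotient does not grow along the orbit. Cleared of denominators, the
    inequality passes to the limit \<open>z0\<close> even when \<open>z0\<close> lies on the
    circle.\<close>
  have "(cmod (p - z0))^2 * (1 - (cmod z)^2) \<le> (cmod (p - z))^2 * (1 - (cmod z0)^2)" if z: "cmod z < 1" for z
  proof -
    have iter: "cmod ((F ^^ n) z) < 1" for n using z maps by (induction n) auto
    have D: "0 < 1 - (cmod ((F ^^ n) z))^2" for n
      using iter[of n] by (simp add: abs_square_less_1)
    have "(cmod (p - (F ^^ n) z))^2 * (1 - (cmod z)^2) \<le> (cmod (p - z))^2 * (1 - (cmod ((F ^^ n) z))^2)" for n
    proof (induction n)
      case (Suc n)
      let ?A = "\<lambda>n. (cmod (p - (F ^^ n) z))^2" and ?D = "\<lambda>n. 1 - (cmod ((F ^^ n) z))^2"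
      have "?A (Suc n) * ?D n \<le> \<beta> * ?A n * ?D (Suc n)"
        using Julia_inequality[OF hol maps p der iter[of n]] by simp
      also have "\<dots> \<le> 1 * ?A n * ?D (Suc n)"
        using \<beta> D[of "Suc n"] by (intro mult_right_mono) auto
      finally have "?A (Suc n) * ?D n * ?D 0 \<le> ?A n * ?D (Suc n) * ?D 0"
        using D[of 0] by (simp add: mult_right_mono)
      also have "\<dots> = (?A n * ?D 0) * ?D (Suc n)" by simp
      also have "\<dots> \<le> (?A 0 * ?D n) * ?D (Suc n)"
        using Suc D[of "Suc n"] by (intro mult_right_mono) auto
      finally have "?D n * (?A (Suc n) * ?D 0) \<le> ?D n * (?A 0 * ?D (Suc n))"
        by (simp only: ac_simps)
      then show ?case using mult_le_cancel_left_pos[OF D[of n]] by simp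
    qed simp
    then show ?thesis
      by (intro LIMSEQ_le[of "\<lambda>n. (cmod (p - (F ^^ n) z))^2 * (1 - (cmod z)^2)" _
            "\<lambda>n. (cmod (p - z))^2 * (1 - (cmod ((F ^^ n) z))^2)"])
        (auto intro!: tendsto_intros lim z)
  qed
  note * = this
  \<comment> \<open>Now \<open>z\<close> runs radially to \<open>p\<close>: the left side is of
    order \<open>s n\<close> and the right side of the order of its square, which leaves only z0 =
    p.\<close>
  define s where "s = (\<lambda>n. 1 / real (n + 2))"
  have s: "0 < s n" "s n < 1" for n by (auto simp: s_def)
  have s_lim: "s \<longlonglongrightarrow> 0"
    unfolding s_def by (rule LIMSEQ_ignore_initial_segment[OF lim_1_over_n])
  have "(cmod (p - z0))^2 * (2 - s n) \<le> s n * (1 - (cmod z0)^2)" for n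
  proof -
    have 1: "cmod (of_real (1 - s n) * p) = 1 - s n"
      using s[of n] p(1) by (simp add: norm_mult del: of_real_diff)
    have "p - of_real (1 - s n) * p = of_real (s n) * p" by (simp add: algebra_simps)
    then have 2: "cmod (p - of_real (1 - s n) * p) = s n" using s[of n] p(1) by (simp add: norm_mult)
    have "(cmod (p - z0))^2 * (1 - (1 - s n)^2) \<le> (s n)^2 * (1 - (cmod z0)^2)"
      using *[of "of_real (1 - s n) * p", unfolded 1 2] s[of n] by simp
    then have "s n * ((cmod (p - z0))^2 * (2 - s n)) \<le> s n * (s n * (1 - (cmod z0)^2))"
      by (simp add: power2_eq_square algebra_simps)
    then show ?thesis using s(1)[of n] by simp
  qed
  moreover have "(\<lambda>n. (cmod (p - z0))^2 * (2 - s n)) \<longlonglongrightarrow> (cmod (p - z0))^2 * (2 - 0)"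
    by (intro tendsto_intros s_lim)
  moreover have "(\<lambda>n. s n * (1 - (cmod z0)^2)) \<longlonglongrightarrow> 0 * (1 - (cmod z0)^2)"
    by (intro tendsto_intros s_lim)
  ultimately have "(cmod (p - z0))^2 * (2 - 0) \<le> 0 * (1 - (cmod z0)^2)"
    by (intro LIMSEQ_le) auto
  then show False using \<open>z0 \<noteq> p\<close> by simp
qed

section \<open>Slowly varying bumps\<close>

text \<open>On the logarithmic scale \<open>Ln u\<close> this is a bump of height 1 and width \<open>N\<close> around \<open>- N\<^sup>2\<close>. It moves
  into \<open>u = 0\<close> as \<open>N\<close> grows, and the factor \<open>u\<^sup>i\<^sup>\<tau>\<close> turns multiplication of \<open>u\<close> by \<open>\<beta>\<close> into a rotation
  by the angle \<open>\<tau> ln \<beta>\<close>.\<close>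

definition log_bump :: "real \<Rightarrow> real \<Rightarrow> complex \<Rightarrow> complex" where
  "log_bump \<tau> N u = (if u = 0 then 0 else
     exp (\<i> * of_real \<tau> * Ln u) * (of_real (N^2) / (of_real (N^2) + (Ln u + of_real (N^2))^2)))"

text \<open>In the right half-plane the imaginary part of the logarithm is at most pi / 2 in
  modulus, and for N \<ge> 2 the term N^2 absorbs its square, so the real part alone gives the
  bound.\<close>

lemma log_bump_denominator:
  assumes "0 \<le> Re u" "u \<noteq> 0" "2 \<le> N"
  shows "N^2 / 4 + (ln (cmod u) + N^2)^2 \<le> cmod (of_real (N^2) + (Ln u + of_real (N^2))^2)"
proof -
  have "\<bar>Im (Ln u)\<bar> \<le> pi / 2" using assms Re_Ln_pos_le by blast
  \<comment> \<open>The bound 17/10 for pi / 2 has square below 3, which is 3/4 * N^2 at N =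
    2.\<close>
  then have "\<bar>Im (Ln u)\<bar> \<le> 17/10" using pi_less_4 pi_approx by simp
  then have "(Im (Ln u))^2 \<le> (17/10)^2" by (simp add: abs_le_square_iff[symmetric])
  moreover have "2^2 \<le> N^2" using assms(3) by (intro power_mono) auto
  ultimately have "(Im (Ln u))^2 \<le> 3 / 4 * N^2" by (simp add: power2_eq_square)
  then have "N^2 / 4 + (ln (cmod u) + N^2)^2 \<le> Re (of_real (N^2) + (Ln u + of_real (N^2))^2)"
    using assms(2) by (simp add: Re_power2)
  also have "\<dots> \<le> cmod (of_real (N^2) + (Ln u + of_real (N^2))^2)" by (rule complex_Re_le_cmod)
  finally show ?thesis .
qed

lemma norm_exp_i_Ln_le:
  assumes "0 \<le> Re u" "u \<noteq> 0"
  shows "cmod (exp (\<i> * of_real \<tau> * Ln u)) \<le> exp (2 * \<bar>\<tau>\<bar>)"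
proof -
  have "\<bar>Im (Ln u)\<bar> \<le> pi / 2" using assms Re_Ln_pos_le by blast
  then have "\<bar>Im (Ln u)\<bar> \<le> 2" using pi_less_4 by simp
  then have "\<bar>\<tau> * Im (Ln u)\<bar> \<le> \<bar>\<tau>\<bar> * 2" unfolding abs_mult by (intro mult_left_mono) auto
  then show ?thesis by simp
qed

lemma norm_log_bump_le:
  assumes "0 \<le> Re u" "u \<noteq> 0" "2 \<le> N"
  shows "cmod (log_bump \<tau> N u) \<le> exp (2 * \<bar>\<tau>\<bar>) * (N^2 / (N^2 / 4 + (ln (cmod u) + N^2)^2))"
proof -
  have "0 < N^2 / 4 + (ln (cmod u) + N^2)^2" using assms(3) by (simp add: add_pos_nonneg)
  then have "N^2 / cmod (of_real (N^2) + (Ln u + of_real (N^2))^2) \<le> N^2 / (N^2 / 4 + (ln (cmod u) + N^2)^2)"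
    using log_bump_denominator[OF assms] by (intro divide_left_mono) (auto intro!: mult_pos_pos)
  moreover have "cmod (log_bump \<tau> N u) = cmod (exp (\<i> * of_real \<tau> * Ln u)) *
      (N^2 / cmod (of_real (N^2) + (Ln u + of_real (N^2))^2))"
    using assms(2) by (simp add: log_bump_def norm_mult norm_divide norm_power del: of_real_power norm_exp_eq_Re)
  ultimately show ?thesis
    using norm_exp_i_Ln_le[OF assms(1,2), of \<tau>] by (simp only:) (intro mult_mono, auto)
qed

lemma norm_log_bump_le_const:
  assumes "0 \<le> Re u" "2 \<le> N"
  shows "cmod (log_bump \<tau> N u) \<le> 4 * exp (2 * \<bar>\<tau>\<bar>)"
proof (cases "u = 0")
  case False
  have "N^2 / (N^2 / 4 + (ln (cmod u) + N^2)^2) \<le> N^2 / (N^2 / 4)"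
    using assms(2) by (intro divide_left_mono) (auto intro!: mult_pos_pos add_pos_nonneg)
  also have "\<dots> = 4" using assms(2) by simp
  finally show ?thesis
    using norm_log_bump_le[OF assms(1) False assms(2), of \<tau>]
      mult_left_mono[of _ 4 "exp (2 * \<bar>\<tau>\<bar>)"] by (smt (verit) exp_ge_zero mult.commute)
qed (simp add: log_bump_def)

lemma norm_log_bump_le_away:
  assumes "0 \<le> Re u" "u \<noteq> 0" "2 \<le> N" "- (N^2 / 2) \<le> ln (cmod u)"
  shows "cmod (log_bump \<tau> N u) \<le> exp (2 * \<bar>\<tau>\<bar>) * (4 / N^2)"
proof -
  have N2: "0 < N^2" using assms(3) by simp
  have "(N^2 / 2)^2 \<le> (ln (cmod u) + N^2)^2" using assms(4) N2 by (intro power_mono) auto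
  moreover have "(N^2 / 2)^2 = (N^2)^2 / 4" by (simp add: power_divide)
  ultimately have "(N^2)^2 / 4 \<le> N^2 / 4 + (ln (cmod u) + N^2)^2" using N2 by linarith
  then have "N^2 / (N^2 / 4 + (ln (cmod u) + N^2)^2) \<le> N^2 / ((N^2)^2 / 4)"
    using N2 by (intro divide_left_mono) (auto intro!: mult_pos_pos add_pos_nonneg)
  also have "A / (A^2 / 4) = 4 / A" for A :: real by (simp add: power2_eq_square)
  finally have "exp (2 * \<bar>\<tau>\<bar>) * (N^2 / (N^2 / 4 + (ln (cmod u) + N^2)^2)) \<le> exp (2 * \<bar>\<tau>\<bar>) * (4 / N^2)"
    by (intro mult_left_mono) auto
  then show ?thesis using norm_log_bump_le[OF assms(1,2,3), of \<tau>] by linarith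
qed

text \<open>The logarithms satisfy Ln u' = Ln u + ln \<beta> + Ln q. The phase therefore turns by
  \<tau> ln \<beta> up to a factor depending on \<open>q\<close>, and the profile has slope of order
  1 / N. The bound is small for \<open>q\<close> near 1 and large \<open>N\<close>.\<close>

lemma log_bump_slow_variation:
  assumes u: "0 \<le> Re u" and u': "0 \<le> Re u'" and N: "2 \<le> N" and "0 < \<beta>" and q: "0 < Re q"
    and eq: "u' = of_real \<beta> * u * q"
  shows "cmod (log_bump \<tau> N u' - exp (\<i> * of_real (\<tau> * ln \<beta>)) * log_bump \<tau> N u)
    \<le> exp (2 * \<bar>\<tau>\<bar>) * (4 * cmod (exp (\<i> * of_real \<tau> * Ln q) - 1) + 40 * (\<bar>ln \<beta>\<bar> + cmod (Ln q)) / N)"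
proof (cases "u = 0")
  case True
  then show ?thesis using N eq by (simp add: log_bump_def)
next
  case False
  have q0: "q \<noteq> 0" using q by auto
  then have u'0: "u' \<noteq> 0" using False eq \<open>0 < \<beta>\<close> by simp
  define L where "L = Ln u"
  define L' where "L' = Ln u'"
  define \<kappa> where "\<kappa> = Ln q"
  define D where "D = of_real (N^2) + (L + of_real (N^2))^2"
  define D' where "D' = of_real (N^2) + (L' + of_real (N^2))^2"
  define s where "s = \<bar>ln (cmod u) + N^2\<bar>"
  define s' where "s' = \<bar>ln (cmod u') + N^2\<bar>"
  have iL: "\<bar>Im L\<bar> \<le> pi / 2" "\<bar>Im L'\<bar> \<le> pi / 2" "\<bar>Im \<kappa>\<bar> < pi / 2"
    using Re_Ln_pos_le u u' False u'0 Re_Ln_pos_lt_imp[OF q] by (auto simp: L_def L'_def \<kappa>_def)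
  have L\<beta>: "Ln (of_real \<beta> * u) = of_real (ln \<beta>) + L"
    using Ln_times_of_real[OF \<open>0 < \<beta>\<close> False] \<open>0 < \<beta>\<close> by (simp add: L_def Ln_of_real)
  \<comment> \<open>The argument is at most pi / 2 in modulus for \<open>u\<close> and strictly less
    for \<open>q\<close>, so the sum stays inside the principal range.\<close>
  have "Ln (of_real \<beta> * u * q) = Ln (of_real \<beta> * u) + Ln q"
    by (rule Ln_times_simple)
      (use False q0 \<open>0 < \<beta>\<close> iL L\<beta> in \<open>auto simp: \<kappa>_def[symmetric] abs_le_iff abs_less_iff\<close>)
  then have L': "L' = L + of_real (ln \<beta>) + \<kappa>" by (simp add: L'_def eq L\<beta> \<kappa>_def)
  have dD: "N^2 / 4 + s^2 \<le> cmod D" "N^2 / 4 + s'^2 \<le> cmod D'"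
    using log_bump_denominator[OF u False N] log_bump_denominator[OF u' u'0 N]
    by (simp_all add: D_def D'_def L_def L'_def s_def s'_def)
  have N2: "0 < N^2" "0 < N" using N by auto
  have Dpos': "0 < N^2 / 4 + s^2" "0 < N^2 / 4 + s'^2"
    using N2 by (simp_all add: add_pos_nonneg)
  note Dpos = less_le_trans[OF Dpos'(1) dD(1)] less_le_trans[OF Dpos'(2) dD(2)] Dpos'
  define h where "h = cmod (L' - L)"
  have h: "h \<le> \<bar>ln \<beta>\<bar> + cmod \<kappa>" "0 \<le> h"
    using norm_triangle_ineq[of "of_real (ln \<beta>)" \<kappa>] by (simp_all add: h_def L')
  \<comment> \<open>The difference of the fractions factors through the difference of the
    denominators; N * a \<le> N^2 / 4 + a^2 then yields one factor 1 / N.\<close>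
  have \<chi>: "cmod (of_real (N^2) / D' - of_real (N^2) / D) \<le> 40 * h / N"
  proof -
    have split: "N^2 * (h * (s + s' + 4)) / (X * Y) =
        h * (N^2 * (s / X * (1 / Y) + s' / Y * (1 / X) + 4 * (1 / X * (1 / Y))))" for X Y
      by (simp add: add_divide_distrib algebra_simps)
    have Lb: "cmod (L + of_real (N^2)) \<le> s + 2" "cmod (L' + of_real (N^2)) \<le> s' + 2"
      using cmod_le[of "L + of_real (N^2)"] cmod_le[of "L' + of_real (N^2)"] iL pi_less_4 False u'0
      by (auto simp: s_def s'_def L_def L'_def)
    have "of_real (N^2) / D' - of_real (N^2) / D = of_real (N^2) * (D - D') / (D * D')"
      using Dpos by (simp add: field_simps)
    also have "D - D' = - (L' - L) * ((L + of_real (N^2)) + (L' + of_real (N^2)))"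
      by (simp add: D_def D'_def power2_eq_square algebra_simps)
    finally have "cmod (of_real (N^2) / D' - of_real (N^2) / D) =
        N^2 * (h * cmod ((L + of_real (N^2)) + (L' + of_real (N^2)))) / (cmod D * cmod D')"
      by (simp add: norm_divide norm_mult h_def norm_power norm_minus_commute del: of_real_power)
    also have "\<dots> \<le> N^2 * (h * (s + s' + 4)) / ((N^2 / 4 + s^2) * (N^2 / 4 + s'^2))"
    proof (rule frac_le)
      show "N^2 * (h * cmod ((L + of_real (N^2)) + (L' + of_real (N^2)))) \<le> N^2 * (h * (s + s' + 4))"
        using Lb norm_triangle_ineq[of "L + of_real (N^2)" "L' + of_real (N^2)"] h(2) N2
        by (intro mult_left_mono) auto
      show "(N^2 / 4 + s^2) * (N^2 / 4 + s'^2) \<le> cmod D * cmod D'"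
        using dD Dpos by (intro mult_mono) auto
    qed (use h N2 Dpos in \<open>auto simp: s_def s'_def\<close>)
    also have "\<dots> = h * (N^2 * (s / (N^2 / 4 + s^2) * (1 / (N^2 / 4 + s'^2))
        + s' / (N^2 / 4 + s'^2) * (1 / (N^2 / 4 + s^2))
        + 4 * (1 / (N^2 / 4 + s^2) * (1 / (N^2 / 4 + s'^2)))))"
      by (rule split)
    also have "\<dots> \<le> h * (N^2 * (1 / N * (4 / N^2) + 1 / N * (4 / N^2) + 4 * (4 / N^2 * (4 / N^2))))"
    proof (intro mult_left_mono add_mono mult_mono)
      have am: "a / (N^2 / 4 + a^2) \<le> 1 / N" "1 / (N^2 / 4 + a^2) \<le> 4 / N^2" for a
      proof -
        have "0 \<le> (N / 2 - a)^2" by simp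
        then have "N * a \<le> N^2 / 4 + a^2" by (simp add: power2_eq_square algebra_simps)
        moreover have "0 < N^2 / 4 + a^2" using N2 by (simp add: add_pos_nonneg)
        ultimately show "a / (N^2 / 4 + a^2) \<le> 1 / N" using N2 by (simp add: divide_simps mult.commute)
        have "1 / (N^2 / 4 + a^2) \<le> 1 / (N^2 / 4)"
          using N2 \<open>0 < N^2 / 4 + a^2\<close> by (intro divide_left_mono) auto
        then show "1 / (N^2 / 4 + a^2) \<le> 4 / N^2" by simp
      qed
      show "s / (N^2 / 4 + s^2) \<le> 1 / N" "s' / (N^2 / 4 + s'^2) \<le> 1 / N"
        "1 / (N^2 / 4 + s'^2) \<le> 4 / N^2" "1 / (N^2 / 4 + s^2) \<le> 4 / N^2"
        "1 / (N^2 / 4 + s^2) \<le> 4 / N^2" "1 / (N^2 / 4 + s'^2) \<le> 4 / N^2" by (rule am)+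
    qed (use h N2 Dpos in \<open>auto simp: s_def s'_def\<close>)
    also have "\<dots> = h * (8 / N + 64 / N^2)" using N2 by (simp add: field_simps power2_eq_square)
    also have "\<dots> \<le> h * (40 / N)"
    proof (rule mult_left_mono[OF _ h(2)])
      have "64 / N^2 \<le> 32 / N" using N N2 by (simp add: power2_eq_square divide_simps)
      then show "8 / N + 64 / N^2 \<le> 40 / N" by simp
    qed
    finally show ?thesis by (simp only: mult.commute times_divide_eq_right)
  qed
  have \<chi>4: "cmod (of_real (N^2) / D') \<le> 4"
  proof -
    have "N^2 / 4 \<le> cmod D'" using dD(2) by (smt (verit) zero_le_power2)
    then show ?thesis using Dpos by (simp add: norm_divide norm_power field_simps del: of_real_power)
  qed
  have eL: "cmod (exp (\<i> * of_real \<tau> * L)) \<le> exp (2 * \<bar>\<tau>\<bar>)"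
    unfolding L_def by (rule norm_exp_i_Ln_le[OF u False])
  have e1: "cmod (exp (\<i> * of_real (\<tau> * ln \<beta>))) = 1" by simp
  have "log_bump \<tau> N u' - exp (\<i> * of_real (\<tau> * ln \<beta>)) * log_bump \<tau> N u =
      exp (\<i> * of_real \<tau> * L) * exp (\<i> * of_real (\<tau> * ln \<beta>)) *
      ((exp (\<i> * of_real \<tau> * \<kappa>) - 1) * (of_real (N^2) / D') + (of_real (N^2) / D' - of_real (N^2) / D))"
  proof -
    have "exp (\<i> * of_real \<tau> * L') = exp (\<i> * of_real \<tau> * L) * exp (\<i> * of_real (\<tau> * ln \<beta>)) * exp (\<i> * of_real \<tau> * \<kappa>)"
      unfolding exp_add[symmetric] by (simp add: L' algebra_simps)
    then have "log_bump \<tau> N u' = exp (\<i> * of_real \<tau> * L) * exp (\<i> * of_real (\<tau> * ln \<beta>)) * exp (\<i> * of_real \<tau> * \<kappa>) * (of_real (N^2) / D')"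
      using u'0 by (simp add: log_bump_def D'_def L'_def)
    moreover have "log_bump \<tau> N u = exp (\<i> * of_real \<tau> * L) * (of_real (N^2) / D)"
      using False by (simp add: log_bump_def D_def L_def)
    ultimately show ?thesis by (simp only: ring_distribs) (simp add: algebra_simps)
  qed
  then have "cmod (log_bump \<tau> N u' - exp (\<i> * of_real (\<tau> * ln \<beta>)) * log_bump \<tau> N u) =
      cmod (exp (\<i> * of_real \<tau> * L)) *
      cmod ((exp (\<i> * of_real \<tau> * \<kappa>) - 1) * (of_real (N^2) / D') + (of_real (N^2) / D' - of_real (N^2) / D))"
    by (simp only: norm_mult e1 mult_1_right)
  also have "\<dots> \<le> exp (2 * \<bar>\<tau>\<bar>) * (cmod (exp (\<i> * of_real \<tau> * \<kappa>) - 1) * 4 + 40 * h / N)"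
  proof (intro mult_mono eL)
    have "cmod ((exp (\<i> * of_real \<tau> * \<kappa>) - 1) * (of_real (N^2) / D')) \<le> cmod (exp (\<i> * of_real \<tau> * \<kappa>) - 1) * 4"
      unfolding norm_mult[of "exp (\<i> * of_real \<tau> * \<kappa>) - 1"] by (intro mult_left_mono \<chi>4) auto
    then show "cmod ((exp (\<i> * of_real \<tau> * \<kappa>) - 1) * (of_real (N^2) / D') + (of_real (N^2) / D' - of_real (N^2) / D))
        \<le> cmod (exp (\<i> * of_real \<tau> * \<kappa>) - 1) * 4 + 40 * h / N"
      using \<chi> by (intro order_trans[OF norm_triangle_ineq] add_mono)
  qed auto
  also have "\<dots> \<le> exp (2 * \<bar>\<tau>\<bar>) * (4 * cmod (exp (\<i> * of_real \<tau> * \<kappa>) - 1) + 40 * (\<bar>ln \<beta>\<bar> + cmod \<kappa>) / N)"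
    using h(1) N2 by (intro mult_left_mono add_mono divide_right_mono) auto
  finally show ?thesis unfolding \<kappa>_def .
qed

lemma log_bump_denominator_nonzero:
  assumes "0 \<le> Re u" "u \<noteq> 0" "2 \<le> N"
  shows "of_real (N^2) + (Ln u + of_real (N^2))^2 \<noteq> (0::complex)"
proof -
  have "0 < N^2 / 4 + (ln (cmod u) + N^2)^2" using assms(3) by (simp add: add_pos_nonneg)
  then show ?thesis using log_bump_denominator[OF assms] by (metis norm_zero not_le)
qed

text \<open>The profile decays like the inverse square of ln \<bar>u\<bar> while the oscillating
  factor stays bounded, so the value 0 at u = 0 is the continuous one.\<close>

lemma log_bump_lim_0:
  assumes "2 \<le> N"
  shows "(log_bump \<tau> N \<longlongrightarrow> 0) (at 0 within {u. 0 \<le> Re u})"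
proof (rule Lim_null_comparison)
  show "\<forall>\<^sub>F u in at 0 within {u. 0 \<le> Re u}.
      cmod (log_bump \<tau> N u) \<le> exp (2 * \<bar>\<tau>\<bar>) * (N^2 / (N^2 / 4 + (ln (cmod u) + N^2)^2))"
    unfolding eventually_at_filter
    by (rule always_eventually) (use norm_log_bump_le assms in blast)
  have 1: "filterlim (\<lambda>u::complex. cmod u) (at_right 0) (at 0 within {u. 0 \<le> Re u})"
    unfolding filterlim_at by (auto simp: eventually_at_filter intro!: tendsto_eq_intros)
  have "filterlim (\<lambda>u. - ln (cmod u)) at_top (at 0 within {u. 0 \<le> Re u})"
    using filterlim_compose[OF ln_at_0 1] by (simp add: filterlim_uminus_at_bot)
  then have "filterlim (\<lambda>u. (- (N^2) + - ln (cmod u))^2) at_top (at 0 within {u. 0 \<le> Re u})"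
    by (intro filterlim_pow_at_top filterlim_tendsto_add_at_top[OF tendsto_const]) auto
  moreover have "(- (N^2) + - ln (cmod u))^2 = (ln (cmod u) + N^2)^2" for u
    by (simp add: power2_eq_square algebra_simps)
  ultimately have "filterlim (\<lambda>u. (ln (cmod u) + N^2)^2) at_top (at 0 within {u. 0 \<le> Re u})"
    by (simp only:)
  then have "filterlim (\<lambda>u. N^2 / 4 + (ln (cmod u) + N^2)^2) at_top (at 0 within {u. 0 \<le> Re u})"
    by (rule filterlim_tendsto_add_at_top[OF tendsto_const])
  then show "((\<lambda>u. exp (2 * \<bar>\<tau>\<bar>) * (N^2 / (N^2 / 4 + (ln (cmod u) + N^2)^2))) \<longlongrightarrow> 0) (at 0 within {u. 0 \<le> Re u})"
    by (intro tendsto_mult_right_zero tendsto_divide_0[OF tendsto_const] filterlim_at_top_imp_at_infinity)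
qed

lemma continuous_on_log_bump:
  assumes "2 \<le> N"
  shows "continuous_on {u. 0 \<le> Re u} (log_bump \<tau> N)"
  unfolding continuous_on_eq_continuous_within
proof
  fix u assume u: "u \<in> {u. 0 \<le> Re u}"
  show "continuous (at u within {u. 0 \<le> Re u}) (log_bump \<tau> N)"
  proof (cases "u = 0")
    case True
    then show ?thesis using log_bump_lim_0[OF assms, of \<tau>] by (simp add: continuous_within log_bump_def)
  next
    case False
    let ?f = "\<lambda>u. exp (\<i> * of_real \<tau> * Ln u) * (of_real (N^2) / (of_real (N^2) + (Ln u + of_real (N^2))^2))"
    have "u \<notin> \<real>\<^sub>\<le>\<^sub>0" using u False by (auto simp: complex_nonpos_Reals_iff complex_eq_iff)
    then have "continuous (at u) ?f"
      using log_bump_denominator_nonzero[of u N] u False assms by (intro continuous_intros) auto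
    then have "continuous (at u within {u. 0 \<le> Re u}) ?f" by (rule continuous_at_imp_continuous_within)
    then show ?thesis
    proof (rule continuous_transform_within[where \<delta> = "cmod u"])
      fix v assume "dist v u < cmod u"
      then have "v \<noteq> 0" by (auto simp: dist_norm)
      then show "?f v = log_bump \<tau> N v" by (simp add: log_bump_def)
    qed (use u False in auto)
  qed
qed

lemma holomorphic_on_log_bump:
  assumes "2 \<le> N"
  shows "log_bump \<tau> N holomorphic_on {u. 0 < Re u}"
proof (rule holomorphic_transform)
  let ?f = "\<lambda>u. exp (\<i> * of_real \<tau> * Ln u) * (of_real (N^2) / (of_real (N^2) + (Ln u + of_real (N^2))^2))"
  have "of_real (N^2) + (Ln u + of_real (N^2))^2 \<noteq> (0::complex)" "u \<notin> \<real>\<^sub>\<le>\<^sub>0" if "0 < Re u" for u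
  proof -
    have "u \<noteq> 0" using that by auto
    then show "of_real (N^2) + (Ln u + of_real (N^2))^2 \<noteq> (0::complex)"
      using log_bump_denominator_nonzero[OF less_imp_le[OF that] _ assms] by blast
    show "u \<notin> \<real>\<^sub>\<le>\<^sub>0" using that by (auto simp: complex_nonpos_Reals_iff)
  qed
  then show "?f holomorphic_on {u. 0 < Re u}" by (intro holomorphic_intros) auto
  show "?f u = log_bump \<tau> N u" if "u \<in> {u. 0 < Re u}" for u using that by (auto simp: log_bump_def)
qed

lemma log_bump_disc_algebra:
  assumes "2 \<le> N" "cmod p = 1"
  shows "(\<lambda>z. log_bump \<tau> N (1 - z * cnj p)) \<in> disc_algebra"
proof (rule disc_algebraI)
  have "0 < Re (1 - z * cnj p)" if "z \<in> ball 0 1" for z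
  proof -
    have "Re (z * cnj p) \<le> cmod (z * cnj p)" by (rule complex_Re_le_cmod)
    also have "\<dots> < 1" using assms(2) that by (simp add: norm_mult)
    finally show ?thesis by simp
  qed
  then have "(log_bump \<tau> N \<circ> (\<lambda>z. 1 - z * cnj p)) holomorphic_on ball 0 1"
    by (intro holomorphic_on_compose_gen[OF _ holomorphic_on_log_bump[OF assms(1)]])
      (auto intro!: holomorphic_intros)
  then show "(\<lambda>z. log_bump \<tau> N (1 - z * cnj p)) holomorphic_on ball 0 1" by (simp add: o_def)
  show "continuous_on (cball 0 1) (\<lambda>z. log_bump \<tau> N (1 - z * cnj p))"
    by (rule continuous_on_compose2[OF continuous_on_log_bump[OF assms(1)]])
      (use Re_one_minus_cnj_nonneg[OF assms(2)] in \<open>auto intro!: continuous_intros\<close>)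
qed

text \<open>At u = exp (- N^2) the profile equals 1 and the phase has modulus 1; this keeps the norm
  of the bumps away from 0.\<close>

lemma log_bump_peak:
  assumes "2 \<le> N"
  shows "log_bump \<tau> N (of_real (exp (- (N^2)))) = exp (\<i> * of_real \<tau> * of_real (- (N^2)))"
proof -
  have "Ln (of_real (exp (- (N^2)))) = of_real (- (N^2))"
    by (subst Ln_of_real) simp_all
  then show ?thesis using assms unfolding log_bump_def by (simp del: of_real_exp exp_of_real)
qed

text \<open>Off \<open>p\<close> the logarithm of \<bar>u\<bar> stays bounded below while the centre
  - N^2 of the bump escapes. Moving points are allowed so that the compactness criterion for norms
  can be applied.\<close>

lemma log_bump_tendsto_0:
  assumes p: "cmod p = 1" and N: "filterlim N at_top sequentially" "\<And>n. 2 \<le> N n"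
    and y: "\<And>n. y n \<in> cball 0 1" "y \<longlonglongrightarrow> y0" "y0 \<noteq> p"
  shows "(\<lambda>n. log_bump \<tau> (N n) (1 - y n * cnj p)) \<longlonglongrightarrow> 0"
proof (rule Lim_null_comparison)
  define \<delta> where "\<delta> = dist y0 p / 2"
  have \<delta>: "0 < \<delta>" "\<delta> < dist y0 p" using y(3) by (auto simp: \<delta>_def)
  have N2: "filterlim (\<lambda>n. (N n)^2) at_top sequentially"
    by (rule filterlim_pow_at_top[OF _ N(1)]) simp
  have "(\<lambda>n. dist (y n) p) \<longlonglongrightarrow> dist y0 p" by (intro tendsto_intros y)
  then have "\<forall>\<^sub>F n in sequentially. \<delta> < dist (y n) p" by (rule order_tendstoD(1)[OF _ \<delta>(2)])
  moreover have "\<forall>\<^sub>F n in sequentially. - 2 * ln \<delta> \<le> (N n)^2"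
    using N2 by (simp add: filterlim_at_top)
  ultimately show "\<forall>\<^sub>F n in sequentially. cmod (log_bump \<tau> (N n) (1 - y n * cnj p)) \<le> exp (2 * \<bar>\<tau>\<bar>) * (4 / (N n)^2)"
  proof eventually_elim
    case (elim n)
    have *: "cmod (1 - y n * cnj p) = dist (y n) p" by (rule norm_one_minus_cnj_sphere[OF p])
    then have "1 - y n * cnj p \<noteq> 0" using elim(1) \<delta>(1) by force
    moreover have "ln \<delta> \<le> ln (dist (y n) p)" using elim(1) \<delta>(1) by (intro ln_mono) auto
    then have "- ((N n)^2 / 2) \<le> ln (cmod (1 - y n * cnj p))" unfolding * using elim(2) by linarith
    ultimately show ?case
      using Re_one_minus_cnj_nonneg[OF p] y(1)[of n] N(2)[of n] by (intro norm_log_bump_le_away) auto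
  qed
  show "(\<lambda>n. exp (2 * \<bar>\<tau>\<bar>) * (4 / (N n)^2)) \<longlonglongrightarrow> 0"
    by (intro tendsto_mult_right_zero tendsto_divide_0[OF tendsto_const]
        filterlim_at_top_imp_at_infinity N2)
qed

section \<open>Norm convergence tested along sequences of points\<close>

lemma dnorm_nonneg:
  assumes "continuous_on (cball 0 1) f"
  shows "0 \<le> dnorm f"
  using order_trans[OF norm_ge_zero norm_le_dnorm[OF assms, of 0]] by simp

text \<open>Points of maximal modulus have a convergent subsequence in the compact disc, so a norm
  estimate reduces to a local study near each limit point.\<close>

lemma dnorm_tendsto_0_compactness:
  assumes cont: "\<And>n. continuous_on (cball 0 1) (h n)"
    and seq: "\<And>s r z. (\<And>n. s n \<in> cball 0 1) \<Longrightarrow> s \<longlonglongrightarrow> z \<Longrightarrow> strict_mono (r :: nat \<Rightarrow> nat) \<Longrightarrow>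
      (\<lambda>n. h (r n) (s n)) \<longlonglongrightarrow> 0"
  shows "(\<lambda>n. dnorm (h n)) \<longlonglongrightarrow> 0"
proof (rule ccontr)
  assume "\<not> (\<lambda>n. dnorm (h n)) \<longlonglongrightarrow> 0"
  have nonneg: "0 \<le> dnorm (h n)" for n
    by (rule dnorm_nonneg[OF cont])
  have "\<exists>z\<in>cball 0 1. dnorm (h n) \<le> cmod (h n z)" for n
  proof -
    have "\<exists>z\<in>cball 0 1. \<forall>y\<in>cball 0 1. cmod (h n y) \<le> cmod (h n z)"
      by (intro continuous_attains_sup continuous_intros cont) auto
    then show ?thesis using dnorm_le by meson
  qed
  then obtain s where s: "\<And>n. s n \<in> cball 0 1" "\<And>n. dnorm (h n) \<le> cmod (h n (s n))" by metis
  obtain e where e: "e > 0" "\<exists>\<^sub>F n in sequentially. e \<le> dnorm (h n)"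
  proof -
    obtain e where "e > 0" "\<not> (\<forall>\<^sub>F n in sequentially. dist (dnorm (h n)) 0 < e)"
      using \<open>\<not> (\<lambda>n. dnorm (h n)) \<longlonglongrightarrow> 0\<close> unfolding tendsto_iff by blast
    then show ?thesis using that nonneg by (auto simp: frequently_def not_le)
  qed
  then have "infinite {n. e \<le> dnorm (h n)}"
    by (simp add: frequently_cofinite[symmetric] cofinite_eq_sequentially)
  then obtain r :: "nat \<Rightarrow> nat" where r: "strict_mono r" "\<And>n. e \<le> dnorm (h (r n))"
    using infinite_enumerate by blast
  have "seq_compact (cball (0::complex) 1)" by (simp add: compact_imp_seq_compact)
  then obtain z r' where r': "strict_mono r'" "((s \<circ> r) \<circ> r') \<longlonglongrightarrow> z"
    unfolding seq_compact_def using s(1) by (metis comp_apply)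
  have "(\<lambda>n. h ((r \<circ> r') n) (((s \<circ> r) \<circ> r') n)) \<longlonglongrightarrow> 0"
    by (rule seq[OF _ r'(2) strict_mono_o[OF r(1) r'(1)]]) (use s(1) in auto)
  then have "(\<lambda>n. cmod (h (r (r' n)) (s (r (r' n))))) \<longlonglongrightarrow> 0"
    by (simp add: tendsto_norm_zero)
  then have "e \<le> 0"
    by (rule LIMSEQ_le_const) (use r(2) s(2) order_trans in blast)
  then show False using e(1) by simp
qed

lemma dnorm_cmult:
  assumes "continuous_on (cball 0 1) f"
  shows "dnorm (\<lambda>z. c * f z) = cmod c * dnorm f"
proof (rule antisym)
  show "dnorm (\<lambda>z. c * f z) \<le> cmod c * dnorm f"
    by (rule dnorm_le) (simp add: norm_mult mult_left_mono norm_le_dnorm[OF assms])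
  show "cmod c * dnorm f \<le> dnorm (\<lambda>z. c * f z)"
  proof (cases "c = 0")
    case False
    have "dnorm f \<le> dnorm (\<lambda>z. c * f z) / cmod c"
    proof (rule dnorm_le)
      fix z :: complex assume "z \<in> cball 0 1"
      then have "cmod (c * f z) \<le> dnorm (\<lambda>z. c * f z)"
        by (intro norm_le_dnorm[of "\<lambda>z. c * f z"] continuous_intros assms)
      then show "cmod (f z) \<le> dnorm (\<lambda>z. c * f z) / cmod c"
        using False by (simp add: norm_mult field_simps)
    qed
    then show ?thesis using False by (simp add: field_simps)
  next
    case True
    then show ?thesis using norm_le_dnorm[of "\<lambda>z. c * f z" 0] by (simp add: True)
  qed
qed

section \<open>Dynamics on the circle\<close>

lemma funpow_decreasing_limit:
  fixes G :: "real \<Rightarrow> real"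
  assumes cont: "\<And>x. isCont G x" and mono: "mono G" and fixc: "G c = c"
    and dec: "\<And>x. c < x \<Longrightarrow> G x < x" and "c \<le> x"
  shows "(\<lambda>n. (G ^^ n) x) \<longlonglongrightarrow> c"
proof -
  have ge: "c \<le> (G ^^ n) x" for n
  proof (induction n)
    case (Suc n)
    then show ?case using monoD[OF mono Suc] fixc by simp
  qed (use \<open>c \<le> x\<close> in simp)
  have le: "G y \<le> y" if "c \<le> y" for y
    using dec[of y] fixc that by (cases "y = c") auto
  have "decseq (\<lambda>n. (G ^^ n) x)"
    by (rule decseq_SucI) (use le ge in auto)
  then obtain L where L: "(\<lambda>n. (G ^^ n) x) \<longlonglongrightarrow> L"
    using decseq_convergent[of "\<lambda>n. (G ^^ n) x" c] ge by blast
  have "(\<lambda>n. G ((G ^^ n) x)) \<longlonglongrightarrow> G L"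
    by (rule isCont_tendsto_compose[OF cont L])
  moreover have "(\<lambda>n. G ((G ^^ n) x)) \<longlonglongrightarrow> L"
    using LIMSEQ_Suc[OF L] by simp
  ultimately have "G L = L" by (rule LIMSEQ_unique)
  moreover have "c \<le> L" using LIMSEQ_le_const[OF L] ge by blast
  ultimately have "L = c" using dec[of L] by force
  then show ?thesis using L by simp
qed

lemma funpow_increasing_limit:
  fixes G :: "real \<Rightarrow> real"
  assumes cont: "\<And>x. isCont G x" and mono: "mono G" and fixc: "G c = c"
    and inc: "\<And>x. x < c \<Longrightarrow> x < G x" and "x \<le> c"
  shows "(\<lambda>n. (G ^^ n) x) \<longlonglongrightarrow> c"
proof -
  \<comment> \<open>Conjugation by the reflection x \<mapsto> - x turns the increasing case into the
    decreasing one.\<close>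
  define H where "H = (\<lambda>x. - G (- x))"
  have "(\<lambda>n. (H ^^ n) (- x)) \<longlonglongrightarrow> - c"
  proof (rule funpow_decreasing_limit)
    show "isCont H y" for y
      unfolding H_def by (intro continuous_intros isCont_o2[OF _ cont])
    show "mono H" unfolding H_def using mono by (simp add: mono_def)
    show "H y < y" if "- c < y" for y using inc[of "- y"] that by (simp add: H_def)
  qed (use fixc \<open>x \<le> c\<close> in \<open>auto simp: H_def\<close>)
  moreover have "(H ^^ n) (- x) = - (G ^^ n) x" for n
    by (induction n) (auto simp: H_def)
  ultimately show ?thesis using tendsto_minus_cancel_left[of "\<lambda>n. (H ^^ n) (- x)"] by (simp add: tendsto_minus_cancel)
qed

text \<open>Zeros are crossed only upwards. A first return to values at most 0 after
  \<open>a\<close> would be a zero reached from positive values, against the positive derivative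
  there.\<close>

lemma pos_after_zero_if_deriv_pos_at_zeros:
  fixes u :: "real \<Rightarrow> real"
  assumes der: "\<And>x. (u has_real_derivative u' x) (at x)"
    and pos: "\<And>x. u x = 0 \<Longrightarrow> 0 < u' x" and "u a = 0" "a < b"
  shows "0 < u b"
proof (rule ccontr)
  assume "\<not> 0 < u b"
  obtain e where e: "e > 0" "\<And>h. 0 < h \<Longrightarrow> h < e \<Longrightarrow> u a < u (a + h)"
    using DERIV_pos_inc_right[OF der pos] \<open>u a = 0\<close> by blast
  define c where "c = a + min e (b - a) / 2"
  have c: "a < c" "c < b" "0 < u c"
    using e(2)[of "min e (b - a) / 2"] e(1) \<open>a < b\<close> \<open>u a = 0\<close> by (auto simp: c_def min_def field_simps)
  define X where "X = {x \<in> {c..b}. u x \<le> 0}"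
  have cont: "continuous_on A u" for A
    by (meson DERIV_isCont continuous_at_imp_continuous_on der)
  have "X = {c..b} \<inter> u -` {..0}" by (auto simp: X_def)
  then have "closed X" by (simp add: continuous_closed_preimage cont)
  have "b \<in> X" using \<open>\<not> 0 < u b\<close> c by (auto simp: X_def)
  define s where "s = Inf X"
  have bb: "bdd_below X" by (auto simp: X_def bdd_below_def)
  have "s \<in> X" unfolding s_def using closed_contains_Inf[OF _ bb \<open>closed X\<close>] \<open>b \<in> X\<close> by auto
  then have s: "c \<le> s" "s \<le> b" "u s \<le> 0" by (auto simp: X_def)
  have before: "0 < u y" if "c \<le> y" "y < s" for y
    using that s(2) cInf_lower[OF _ bb, of y] by (force simp: X_def s_def)
  have "c < s" using s c by (cases "c = s") auto
  have "\<exists>y. c \<le> y \<and> y \<le> s \<and> u y = 0"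
    by (rule IVT2) (use s c \<open>c < s\<close> DERIV_isCont[OF der] in auto)
  then obtain y where "c \<le> y" "y \<le> s" "u y = 0" by blast
  then have "u s = 0" using before[of y] by (cases "y = s") auto
  obtain e' where e': "e' > 0" "\<And>h. 0 < h \<Longrightarrow> h < e' \<Longrightarrow> u (s - h) < u s"
    using DERIV_pos_inc_left[OF der pos] \<open>u s = 0\<close> by blast
  define h where "h = min e' (s - c) / 2"
  have "0 < h" "h < e'" "c \<le> s - h" using e'(1) \<open>c < s\<close> by (auto simp: h_def min_def field_simps)
  then show False using e'(2)[of h] before[of "s - h"] \<open>u s = 0\<close> by auto
qed

lemma neg_before_zero_if_deriv_pos_at_zeros:
  fixes u :: "real \<Rightarrow> real"
  assumes der: "\<And>x. (u has_real_derivative u' x) (at x)"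
    and pos: "\<And>x. u x = 0 \<Longrightarrow> 0 < u' x" and "u a = 0" "b < a"
  shows "u b < 0"
proof -
  have "0 < - u (- (- b))"
  proof (rule pos_after_zero_if_deriv_pos_at_zeros[where u = "\<lambda>x. - u (- x)" and u' = "\<lambda>x. u' (- x)" and a = "- a"])
    show "((\<lambda>x. - u (- x)) has_real_derivative u' (- x)) (at x)" for x
      using DERIV_minus[OF DERIV_chain2[OF der[of "- x"] DERIV_minus[OF DERIV_ident]]] by simp
  qed (use assms in auto)
  then show ?thesis by simp
qed

section \<open>Circle coverings, their lifts and multipliers\<close>

lemma cis_eq_imp_eq:
  assumes "cis x = cis y" "\<bar>x - y\<bar> < 2 * pi"
  shows "x = y"
proof -
  have "sin x = sin y" "cos x = cos y" using assms(1) by (auto simp: complex_eq_iff)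
  then obtain n :: int where n: "x = y + 2 * pi * n" using sin_cos_eq_iff[of x y] by auto
  then have "\<bar>of_int n * (2 * pi)\<bar> < 1 * (2 * pi)" using assms(2) by (simp add: mult.commute)
  then have "\<bar>real_of_int n\<bar> < 1" unfolding abs_mult by simp
  then have "n = 0" by linarith
  then show ?thesis using n by simp
qed

lemma cis_eq_cis_iff: "cis x = cis y \<longleftrightarrow> (\<exists>k::int. x = y + 2 * pi * of_int k)"
  using sin_cos_eq_iff[of x y] by (auto simp: complex_eq_iff)

lemma cis_add_2pi: "cis (x + 2 * pi) = cis x"
  by (simp add: complex_eq_iff)

lemma ex_cis_eq:
  assumes "z \<in> sphere 0 1"
  shows "\<exists>x. z = cis x"
proof
  have "z \<noteq> 0" "sgn z = z" using assms by (auto simp: sgn_div_norm)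
  then show "z = cis (Arg z)" using cis_Arg[of z] by simp
qed

text \<open>The data of a finite Blaschke product that the argument uses: a lift
  \<open>\<phi>\<close> of the circle map with its derivative, the degree, and the limit
  \<open>z0\<close> of the iterates. The derivative of \<open>B\<close> has the form that the chain
  rule dictates for \<open>B (cis x) = cis (\<phi> x)\<close>.\<close>

locale circle_covering =
  fixes B :: "complex \<Rightarrow> complex" and \<phi> \<phi>' :: "real \<Rightarrow> real" and d :: nat and z0 :: complex
  assumes B_hol: "B holomorphic_on ball 0 1"
    and B_cont: "continuous_on (cball 0 1) B"
    and B_ball: "cmod z < 1 \<Longrightarrow> cmod (B z) < 1"
    and B_cis: "B (cis x) = cis (\<phi> x)"
    and \<phi>_deriv: "(\<phi> has_real_derivative \<phi>' x) (at x)"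
    and \<phi>'_pos: "0 < \<phi>' x"
    and B_deriv: "(B has_field_derivative of_real (\<phi>' x) * cis (\<phi> x) / cis x) (at (cis x))"
    and \<phi>_period: "\<phi> (x + 2 * pi) = \<phi> x + 2 * pi * real d"
    and d_ge: "2 \<le> d"
    and iterates_lim: "cmod z < 1 \<Longrightarrow> (\<lambda>n. (B ^^ n) z) \<longlonglongrightarrow> z0"
    and z0_fixed: "cmod z0 = 1 \<Longrightarrow> B z0 = z0"
begin

lemma \<phi>_strict_mono: "strict_mono \<phi>"
proof (rule strict_monoI)
  fix x y :: real assume "x < y"
  then show "\<phi> x < \<phi> y"
    by (rule DERIV_pos_imp_increasing) (use \<phi>_deriv \<phi>'_pos in blast)
qed

lemma isCont_\<phi>: "isCont \<phi> x"
  using \<phi>_deriv by (rule DERIV_isCont)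

lemma \<phi>_period_nat: "\<phi> (x + 2 * pi * real k) = \<phi> x + 2 * pi * real d * real k"
proof (induction k)
  case (Suc k)
  have "x + 2 * pi * real (Suc k) = (x + 2 * pi * real k) + 2 * pi"
    by (simp add: algebra_simps)
  then have "\<phi> (x + 2 * pi * real (Suc k)) = \<phi> (x + 2 * pi * real k) + 2 * pi * real d"
    by (simp only: \<phi>_period)
  then show ?case unfolding Suc by (simp add: algebra_simps)
qed simp

lemma \<phi>_period_int: "\<phi> (x + 2 * pi * of_int k) = \<phi> x + 2 * pi * real d * of_int k"
proof (cases "k \<ge> 0")
  case True
  then show ?thesis using \<phi>_period_nat[of x "nat k"] by simp
next
  case False
  then show ?thesis using \<phi>_period_nat[of "x + 2 * pi * of_int k" "nat (- k)"]
    by (simp add: algebra_simps)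
qed

text \<open>The difference is continuous and 2 pi-periodic, hence bounded.\<close>

lemma \<phi>_linear_bound: "\<exists>C\<ge>0. \<forall>x. \<bar>\<phi> x - real d * x\<bar> \<le> C"
proof -
  define h where "h = (\<lambda>x. \<bar>\<phi> x - real d * x\<bar>)"
  have "continuous_on {0..2*pi} h"
    unfolding h_def
    by (intro continuous_intros continuous_at_imp_continuous_on ballI isCont_\<phi>)
  then have "\<exists>m\<in>{0..2*pi}. \<forall>x\<in>{0..2*pi}. h x \<le> h m"
    by (intro continuous_attains_sup) auto
  then obtain m where m: "\<And>x. x \<in> {0..2*pi} \<Longrightarrow> h x \<le> h m" by blast
  have "h x \<le> h m" for x
  proof -
    define k where "k = \<lfloor>x / (2 * pi)\<rfloor>"
    define y where "y = x - 2 * pi * of_int k"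
    have "of_int k \<le> x / (2 * pi)" "x / (2 * pi) < of_int k + 1" unfolding k_def by linarith+
    then have "y \<in> {0..2*pi}" by (auto simp: y_def field_simps)
    moreover have "h x = h y"
      using \<phi>_period_int[of y k] by (simp add: h_def y_def algebra_simps)
    ultimately show ?thesis using m by simp
  qed
  then show ?thesis by (intro exI[of _ "h m"]) (auto simp: h_def)
qed

lemma surj_\<phi>: "surj \<phi>"
proof -
  obtain C where C: "C \<ge> 0" "\<And>x. \<bar>\<phi> x - real d * x\<bar> \<le> C" using \<phi>_linear_bound by blast
  have "\<exists>x. \<phi> x = y" for y
  proof -
    define M where "M = C + \<bar>y\<bar>"
    have My: "C + \<bar>y\<bar> = M" by (simp add: M_def)
    have "\<phi> (- M) \<le> y" "y \<le> \<phi> M"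
    proof -
      have "2 * M \<le> real d * M" using d_ge C(1) by (intro mult_right_mono) (auto simp: M_def)
      moreover have "\<bar>\<phi> M - real d * M\<bar> \<le> C" "\<bar>\<phi> (- M) + real d * M\<bar> \<le> C"
        using C(2)[of M] C(2)[of "- M"] by auto
      ultimately show "\<phi> (- M) \<le> y" "y \<le> \<phi> M" using C(1) My by linarith+
    qed
    moreover have "- M \<le> M" using C(1) by (simp add: M_def)
    ultimately show ?thesis using IVT[of \<phi> "- M" y M] isCont_\<phi> by blast
  qed
  then show ?thesis by (metis surjI)
qed

definition g :: "real \<Rightarrow> real" where "g = inv \<phi>"

lemma \<phi>_g [simp]: "\<phi> (g x) = x"
  unfolding g_def using surj_\<phi> by (rule surj_f_inv_f)

lemma g_\<phi> [simp]: "g (\<phi> x) = x"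
  unfolding g_def using strict_mono_imp_inj_on[OF \<phi>_strict_mono] by (rule inv_f_f)

lemma g_strict_mono: "strict_mono g"
proof (rule strict_monoI)
  fix x y :: real assume "x < y"
  then show "g x < g y" using strict_mono_less[OF \<phi>_strict_mono, of "g x" "g y"] by simp
qed

lemma isCont_g: "isCont g x"
  using isCont_inverse_function[of 1 "g x" g \<phi>] isCont_\<phi> by simp

lemma funpow_\<phi>_strict_mono: "strict_mono (\<phi> ^^ n)"
  by (induction n) (auto simp: strict_mono_def o_def intro: strict_monoD[OF \<phi>_strict_mono])

lemma funpow_g_strict_mono: "strict_mono (g ^^ n)"
  by (induction n) (auto simp: strict_mono_def o_def intro: strict_monoD[OF g_strict_mono])

lemma isCont_funpow_\<phi>: "isCont (\<phi> ^^ n) x"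
  by (induction n) (auto simp: o_def id_def intro: isCont_o2[OF _ isCont_\<phi>])

lemma isCont_funpow_g: "isCont (g ^^ n) x"
  by (induction n) (auto simp: o_def id_def intro: isCont_o2[OF _ isCont_g])

lemma funpow_\<phi>_g [simp]: "(\<phi> ^^ n) ((g ^^ n) x) = x"
  by (induction n arbitrary: x) (simp_all add: funpow_swap1)

lemma funpow_\<phi>_period: "(\<phi> ^^ n) (x + 2 * pi * of_int k) = (\<phi> ^^ n) x + 2 * pi * of_int (int d ^ n * k)"
proof (induction n)
  case (Suc n)
  show ?case unfolding funpow.simps o_def Suc \<phi>_period_int by simp
qed simp

lemma B_funpow_cis: "(B ^^ n) (cis x) = cis ((\<phi> ^^ n) x)"
  by (induction n) (simp_all add: B_cis)

lemma B_sphere: "z \<in> sphere 0 1 \<Longrightarrow> B z \<in> sphere 0 1"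
  using ex_cis_eq[of z] B_cis by force

lemma B_cball: "z \<in> cball 0 1 \<Longrightarrow> B z \<in> cball 0 1"
  using B_sphere[of z] B_ball[of z] by (cases "cmod z = 1") auto

lemma B_funpow_cball: "z \<in> cball 0 1 \<Longrightarrow> (B ^^ n) z \<in> cball 0 1"
  by (induction n) (use B_cball in auto)

text \<open>The derivative of \<open>\<phi> ^^ n\<close> by the chain rule; at a point of period
  \<open>n\<close> it is the multiplier of the cycle.\<close>

definition multiplier :: "nat \<Rightarrow> real \<Rightarrow> real" where
  "multiplier n x = (\<Prod>j<n. \<phi>' ((\<phi> ^^ j) x))"

lemma funpow_\<phi>_deriv: "((\<phi> ^^ n) has_real_derivative multiplier n x) (at x)"
proof (induction n)
  case (Suc n)
  show ?case using DERIV_chain2[OF \<phi>_deriv[of "(\<phi> ^^ n) x"] Suc]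
    by (simp add: multiplier_def mult.commute o_def)
qed (simp add: multiplier_def id_def)

lemma B_funpow_deriv:
  "((B ^^ n) has_field_derivative of_real (multiplier n x) * cis ((\<phi> ^^ n) x) / cis x) (at (cis x))"
proof (induction n)
  case (Suc n)
  have "((\<lambda>z. B ((B ^^ n) z)) has_field_derivative
      (of_real (\<phi>' ((\<phi> ^^ n) x)) * cis (\<phi> ((\<phi> ^^ n) x)) / cis ((\<phi> ^^ n) x)) *
      (of_real (multiplier n x) * cis ((\<phi> ^^ n) x) / cis x)) (at (cis x))"
    by (rule DERIV_chain2[OF _ Suc]) (simp add: B_funpow_cis B_deriv)
  then show ?case by (simp add: multiplier_def o_def mult_ac)
qed (simp add: multiplier_def id_def)

lemma B_funpow_hol: "(B ^^ n) holomorphic_on ball 0 1"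
  and B_funpow_ball: "cmod z < 1 \<Longrightarrow> cmod ((B ^^ n) z) < 1"
proof (induction n arbitrary: z)
  case (Suc n)
  { case 1
    have "(B ^^ n) ` ball 0 1 \<subseteq> ball 0 1" using Suc(2) by auto
    then show ?case using holomorphic_on_compose_gen[OF Suc(1) B_hol] by (simp add: o_def) }
  { case 2
    then show ?case using Suc(2) B_ball by simp }
qed (auto simp: id_def)

text \<open>The iterate \<open>B ^^ m\<close> is a self-map of the disc whose iterates also converge
  to \<open>z0\<close>, and its derivative at the fixed point is the real number
  \<open>multiplier m x\<close>, so the criterion for repelling boundary points applies.\<close>

lemma multiplier_gt_1:
  assumes "0 < m" "(B ^^ m) (cis x) = cis x" "cis x \<noteq> z0"
  shows "1 < multiplier m x"
proof (rule boundary_fixed_point_repelling[of "B ^^ m" "cis x" _ z0])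
  show "(B ^^ m) holomorphic_on ball 0 1" by (rule B_funpow_hol)
  show "cmod ((B ^^ m) z) < 1" if "cmod z < 1" for z using that by (rule B_funpow_ball)
  show "((B ^^ m) has_field_derivative of_real (multiplier m x)) (at (cis x))"
    using B_funpow_deriv[of m x] assms(2) by (simp add: B_funpow_cis)
  show "(\<lambda>n. ((B ^^ m) ^^ n) z) \<longlonglongrightarrow> z0" if "cmod z < 1" for z
  proof -
    have "((\<lambda>n. (B ^^ n) z) \<circ> (\<lambda>n. m * n)) \<longlonglongrightarrow> z0"
      using assms(1) by (intro LIMSEQ_subseq_LIMSEQ iterates_lim that) (simp add: strict_mono_def)
    then show ?thesis by (simp add: o_def funpow_mult)
  qed
qed (use assms in auto)

section \<open>The largest fixed point of the lift and the periodic orbits\<close>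

definition t0 :: real where "t0 = Sup {x. \<phi> x \<le> x}"

text \<open>\<open>\<phi> x - real d * x\<close> is bounded and d \<ge> 2, so the lift lies above
  the identity far to the right and below it far to the left. The supremum therefore exists and is
  the largest fixed point.\<close>

lemma \<phi>_t0 [simp]: "\<phi> t0 = t0" and \<phi>_gt: "t0 < x \<Longrightarrow> x < \<phi> x"
proof -
  obtain C where C: "C \<ge> 0" "\<And>x. \<bar>\<phi> x - real d * x\<bar> \<le> C" using \<phi>_linear_bound by blast
  let ?X = "{x. \<phi> x \<le> x}"
  have "x \<le> C" if "\<phi> x \<le> x" for x
  proof (rule ccontr)
    assume "\<not> x \<le> C"
    then have "2 * x \<le> real d * x" using d_ge C(1) by (intro mult_right_mono) auto
    then show False using C(2)[of x] that \<open>\<not> x \<le> C\<close> by (auto simp: abs_le_iff)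
  qed
  then have bdd: "bdd_above ?X" by (auto simp: bdd_above_def)
  have "2 * C \<le> real d * C" using d_ge C(1) by (intro mult_right_mono) auto
  then have ne: "- C \<in> ?X" using C(2)[of "- C"] by (auto simp: abs_le_iff)
  have "closed ?X"
    by (intro closed_Collect_le continuous_intros continuous_at_imp_continuous_on ballI isCont_\<phi>)
  then have le: "\<phi> t0 \<le> t0"
    using closed_contains_Sup[OF _ bdd] ne unfolding t0_def by auto
  show gt: "x < \<phi> x" if "t0 < x" for x
    using cSup_upper[OF _ bdd, of x] that unfolding t0_def by force
  show "\<phi> t0 = t0"
  proof (rule antisym[OF le], rule ccontr)
    assume "\<not> t0 \<le> \<phi> t0"
    have "t0 < g t0" using strict_monoD[OF g_strict_mono, of "\<phi> t0" t0] \<open>\<not> t0 \<le> \<phi> t0\<close> by simp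
    then show False using gt[of "g t0"] by simp
  qed
qed

lemma g_t0 [simp]: "g t0 = t0"
  using g_\<phi>[of t0] by simp

lemma g_less: "t0 < x \<Longrightarrow> g x < x"
  using \<phi>_gt[of "g x"] strict_monoD[OF g_strict_mono, of t0 x] by simp

lemma funpow_\<phi>_t0 [simp]: "(\<phi> ^^ n) t0 = t0"
  by (induction n) auto

lemma funpow_g_lim: "t0 \<le> x \<Longrightarrow> (\<lambda>n. (g ^^ n) x) \<longlonglongrightarrow> t0"
  by (rule funpow_decreasing_limit)
    (use isCont_g g_less strict_mono_mono[OF g_strict_mono] in auto)

lemma funpow_\<phi>_gt: "t0 < x \<Longrightarrow> t0 < (\<phi> ^^ n) x"
  using strict_monoD[OF funpow_\<phi>_strict_mono, of t0 x n] by simp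

text \<open>With n = i + 2, the displacement of \<open>\<phi> ^^ n\<close> is 0 at \<open>t0\<close>
  and 2 pi (d^n - 1) at \<open>t0 + 2 * pi\<close>. Since n \<ge> 2 and d \<ge> 2, the latter
  exceeds 2 pi, so a displacement of one turn occurs strictly in between.\<close>

lemma ex_periodic_point:
  "\<exists>x. t0 < x \<and> x < t0 + 2 * pi \<and> (\<phi> ^^ (i + 2)) x = x + 2 * pi"
proof -
  define u where "u = (\<lambda>x. (\<phi> ^^ (i + 2)) x - x)"
  have "(2::int)^2 \<le> int d ^ (i + 2)"
    using d_ge power_mono[of 2 "int d" 2] power_increasing[of 2 "i + 2" "int d"] by linarith
  then have "(4::int) \<le> int d ^ (i + 2)" by simp
  then have D: "(4::real) \<le> of_int (int d ^ (i + 2))" by (metis of_int_le_iff of_int_numeral)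
  have u: "u t0 = 0" "u (t0 + 2 * pi) = 2 * pi * of_int (int d ^ (i + 2)) - 2 * pi"
    using funpow_\<phi>_period[of "i + 2" t0 1] by (simp_all add: u_def del: funpow.simps)
  have "2 * pi * 4 \<le> 2 * pi * of_int (int d ^ (i + 2))"
    by (rule mult_left_mono[OF D]) simp
  then have u2: "2 * pi < u (t0 + 2 * pi)" unfolding u using pi_gt_zero by linarith
  have "\<exists>x. t0 \<le> x \<and> x \<le> t0 + 2 * pi \<and> u x = 2 * pi"
    by (rule IVT) (use u(1) u2 in \<open>auto simp: u_def intro!: continuous_intros isCont_funpow_\<phi> simp del: funpow.simps\<close>)
  then obtain x where x: "t0 \<le> x" "x \<le> t0 + 2 * pi" "u x = 2 * pi" by blast
  then have "x \<noteq> t0" "x \<noteq> t0 + 2 * pi" using u(1) u2 by auto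
  then show ?thesis using x by (intro exI[of _ x]) (auto simp: u_def)
qed

definition per :: "nat \<Rightarrow> real" where
  "per i = (SOME x. t0 < x \<and> x < t0 + 2 * pi \<and> (\<phi> ^^ (i + 2)) x = x + 2 * pi)"

lemma per: "t0 < per i" "per i < t0 + 2 * pi" "(\<phi> ^^ (i + 2)) (per i) = per i + 2 * pi"
  using someI_ex[OF ex_periodic_point[of i]] unfolding per_def by blast+

lemma funpow_per_increasing: "j < k \<Longrightarrow> (\<phi> ^^ j) (per i) < (\<phi> ^^ k) (per i)"
  by (rule strict_monoD[of "\<lambda>k. (\<phi> ^^ k) (per i)"])
    (auto simp: strict_mono_Suc_iff intro!: \<phi>_gt funpow_\<phi>_gt per)

text \<open>The last point of the cycle is mapped to \<open>per i + 2 * pi\<close>, which is less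
  than t0 + 4 pi and so less than the image of \<open>t0 + 2 * pi\<close>. Hence the whole cycle
  lies in one fundamental interval, on which \<open>cis\<close> is injective.\<close>

lemma funpow_per_bounds:
  assumes "j < i + 2"
  shows "t0 < (\<phi> ^^ j) (per i)" "(\<phi> ^^ j) (per i) < t0 + 2 * pi"
proof -
  show "t0 < (\<phi> ^^ j) (per i)" by (intro funpow_\<phi>_gt per)
  have "\<phi> ((\<phi> ^^ (i + 1)) (per i)) = per i + 2 * pi" using per(3)[of i] by simp
  also have "\<dots> < t0 + 2 * pi * 2" using per(2)[of i] by simp
  also have "\<dots> \<le> t0 + 2 * pi * real d" using d_ge by simp
  also have "\<dots> = \<phi> (t0 + 2 * pi)" by (simp add: \<phi>_period)
  finally have "(\<phi> ^^ (i + 1)) (per i) < t0 + 2 * pi"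
    by (simp only: strict_mono_less[OF \<phi>_strict_mono])
  moreover have "(\<phi> ^^ j) (per i) \<le> (\<phi> ^^ (i + 1)) (per i)"
    using funpow_per_increasing[of j "i + 1" i] assms by (cases "j = i + 1") auto
  ultimately show "(\<phi> ^^ j) (per i) < t0 + 2 * pi" by linarith
qed

definition orbit :: "nat \<Rightarrow> complex set" where
  "orbit i = (\<lambda>j. cis ((\<phi> ^^ j) (per i))) ` {..<i + 2}"

lemma finite_orbit [simp]: "finite (orbit i)"
  by (simp add: orbit_def)

lemma orbit_sphere: "orbit i \<subseteq> sphere 0 1"
  by (auto simp: orbit_def)

lemma cis_funpow_per_inj: "inj_on (\<lambda>j. cis ((\<phi> ^^ j) (per i))) {..<i + 2}"
proof (rule inj_onI)
  fix j k assume jk: "j \<in> {..<i + 2}" "k \<in> {..<i + 2}" "cis ((\<phi> ^^ j) (per i)) = cis ((\<phi> ^^ k) (per i))"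
  have "(\<phi> ^^ j) (per i) = (\<phi> ^^ k) (per i)"
    using cis_eq_imp_eq[OF jk(3)] funpow_per_bounds[of j i] funpow_per_bounds[of k i] jk by auto
  then show "j = k" using funpow_per_increasing[of j k i] funpow_per_increasing[of k j i]
    by (cases j k rule: linorder_cases) auto
qed

lemma card_orbit: "card (orbit i) = i + 2"
  unfolding orbit_def card_image[OF cis_funpow_per_inj] by simp

lemma B_period_per: "(B ^^ (i + 2)) (cis (per i)) = cis (per i)"
  unfolding B_funpow_cis per(3) by (simp add: cis.code)

lemma B_funpow_period_mult: "(B ^^ ((i + 2) * k)) (cis (per i)) = cis (per i)"
proof (induction k)
  case (Suc k)
  have "(i + 2) * Suc k = (i + 2) + (i + 2) * k" by simp
  then show ?case
    using funpow_add[of "i + 2" "(i + 2) * k" B] by (simp only: o_def Suc B_period_per)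
qed simp

lemma orbit_eq_range_per: "orbit i = range (\<lambda>k. (B ^^ k) (cis (per i)))"
proof -
  have "(B ^^ k) (cis (per i)) \<in> orbit i" for k
  proof -
    have "(B ^^ k) (cis (per i)) = (B ^^ (k mod (i + 2) + (i + 2) * (k div (i + 2)))) (cis (per i))"
      by (simp only: mod_mult_div_eq)
    also have "\<dots> = (B ^^ (k mod (i + 2))) (cis (per i))"
      unfolding funpow_add o_def B_funpow_period_mult ..
    finally show ?thesis unfolding orbit_def B_funpow_cis by auto
  qed
  then show ?thesis by (auto simp: orbit_def B_funpow_cis)
qed

text \<open>Each point generates the cycle: from step \<open>k\<close>, another
  \<open>k * (i + 1)\<close> steps complete \<open>k\<close> whole periods and lead back to the
  starting point.\<close>

lemma orbit_eq_range:
  assumes "z \<in> orbit i"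
  shows "orbit i = range (\<lambda>k. (B ^^ k) z)"
proof -
  obtain k where k: "z = (B ^^ k) (cis (per i))" using assms orbit_eq_range_per by auto
  have "(B ^^ (k * (i + 1))) z = (B ^^ ((i + 2) * k)) (cis (per i))"
    unfolding k funpow_add[symmetric, THEN fun_cong, unfolded o_def] by (simp add: algebra_simps)
  then have *: "cis (per i) = (B ^^ (k * (i + 1))) z" by (simp only: B_funpow_period_mult)
  have "(B ^^ a) (cis (per i)) = (B ^^ (a + k * (i + 1))) z" for a
    unfolding funpow_add o_def *[symmetric] ..
  moreover have "(B ^^ a) z = (B ^^ (a + k)) (cis (per i))" for a
    unfolding funpow_add o_def k ..
  ultimately show ?thesis unfolding orbit_eq_range_per by (metis (no_types, lifting) image_subset_iff range_eqI subset_antisym)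
qed

lemma B_orbit: "z \<in> orbit i \<Longrightarrow> B z \<in> orbit i"
  using orbit_eq_range[of z i] rangeI[of "\<lambda>k. (B ^^ k) z" 1] by simp

text \<open>Orbits that meet coincide, and the cardinalities i + 2 tell them apart.\<close>

lemma orbit_disjoint:
  assumes "z \<in> orbit i" "z \<in> orbit j"
  shows "i = j"
proof -
  have "orbit i = orbit j" using assms orbit_eq_range by metis
  then have "i + 2 = j + 2" using card_orbit by metis
  then show ?thesis by simp
qed

lemma cis_t0_notin_orbit: "cis t0 \<notin> orbit i"
proof
  assume "cis t0 \<in> orbit i"
  then obtain j where j: "j < i + 2" "cis t0 = cis ((\<phi> ^^ j) (per i))" by (auto simp: orbit_def)
  then show False using cis_eq_imp_eq[OF j(2)] funpow_per_bounds[OF j(1)] by auto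
qed

text \<open>On the circle \<open>z0\<close> would be a fixed point, whereas an orbit has at least
  two points.\<close>

lemma z0_notin_orbit: "z0 \<notin> orbit i"
proof
  assume *: "z0 \<in> orbit i"
  then have "z0 \<in> sphere 0 1" using orbit_sphere by blast
  then have "B z0 = z0" using z0_fixed by simp
  then have "(B ^^ k) z0 = z0" for k by (induction k) auto
  then have "orbit i = {z0}" using orbit_eq_range[OF *] by auto
  then show False using card_orbit[of i] by simp
qed

text \<open>\<open>per i\<close> is the image of \<open>per i + 2 * pi\<close> under
  \<open>g ^^ (i + 2)\<close>, hence squeezed between \<open>t0\<close> and a backward iterate of
  \<open>t0 + 4 * pi\<close>.\<close>

lemma per_lim: "per \<longlonglongrightarrow> t0"
proof (rule tendsto_sandwich[of "\<lambda>_. t0" _ _ "\<lambda>i. (g ^^ (i + 2)) (t0 + 4 * pi)"])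
  have eq: "per i = (g ^^ (i + 2)) (per i + 2 * pi)" for i
  proof -
    have "(\<phi> ^^ (i + 2)) (per i) = (\<phi> ^^ (i + 2)) ((g ^^ (i + 2)) (per i + 2 * pi))"
      unfolding funpow_\<phi>_g per(3) ..
    then show ?thesis using strict_mono_eq[OF funpow_\<phi>_strict_mono] by blast
  qed
  have "per i \<le> (g ^^ (i + 2)) (t0 + 4 * pi)" for i
    by (subst eq, rule strict_mono_less_eq[OF funpow_g_strict_mono, THEN iffD2]) (use per(2)[of i] in simp)
  then show "\<forall>\<^sub>F i in sequentially. per i \<le> (g ^^ (i + 2)) (t0 + 4 * pi)" by simp
  show "(\<lambda>i. (g ^^ (i + 2)) (t0 + 4 * pi)) \<longlonglongrightarrow> t0"
    by (rule LIMSEQ_ignore_initial_segment[OF funpow_g_lim]) simp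
  show "\<forall>\<^sub>F i in sequentially. t0 \<le> per i" using per(1) by (simp add: less_imp_le)
qed simp

text \<open>If \<open>cis x\<close> is fixed, \<phi> moves \<open>x\<close> by k turns and the
  second iterate moves it by k (1 + d) turns, which is never exactly one.\<close>

lemma cis_ne_z0:
  assumes "\<phi> (\<phi> x) = x + 2 * pi"
  shows "cis x \<noteq> z0"
proof
  assume *: "cis x = z0"
  then have "cmod z0 = 1" by (metis norm_cis)
  then have "cis (\<phi> x) = cis x" using z0_fixed * B_cis by metis
  then obtain k :: int where k: "\<phi> x = x + 2 * pi * of_int k" using cis_eq_cis_iff by blast
  then have "\<phi> (\<phi> x) = x + 2 * pi * of_int k + 2 * pi * real d * of_int k"
    using \<phi>_period_int[of x k] by simp
  then have "2 * pi * of_int k + 2 * pi * real d * of_int k = 2 * pi" using assms by simp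
  then have "2 * pi * (of_int k * (1 + real d)) = 2 * pi * 1" by algebra
  then have "of_int k * (1 + real d) = 1" using pi_gt_zero by (simp only: mult_cancel_left) simp
  then have "real_of_int (k * (1 + int d)) = 1" by simp
  then have "k * (1 + int d) = 1" by (simp only: of_int_eq_1_iff)
  then show False using d_ge zmult_eq_1_iff[of k "1 + int d"] by auto
qed

text \<open>All zeros of \<open>\<phi> (\<phi> y) - y - 2\<pi>\<close> have positive derivative, so there is only one.\<close>

lemma backward_branch_lim: "(\<lambda>n. ((\<lambda>y. g (g (y + 2 * pi))) ^^ n) x) \<longlonglongrightarrow> per 0"
proof -
  \<comment> \<open>A lift of the inverse branch of \<open>B ^^ 2\<close> that fixes
    \<open>per 0\<close>; the sign of \<open>u y\<close> tells on which side of \<open>y\<close> the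
    value \<open>G y\<close> lies.\<close>
  define G where "G = (\<lambda>y. g (g (y + 2 * pi)))"
  define u where "u = (\<lambda>y. (\<phi> ^^ 2) y - y - 2 * pi)"
  have u_der: "(u has_real_derivative (multiplier 2 y - 1)) (at y)" for y
    unfolding u_def by (auto intro!: derivative_eq_intros funpow_\<phi>_deriv)
  have u_pos: "0 < multiplier 2 y - 1" if "u y = 0" for y
  proof -
    have "\<phi> (\<phi> y) = y + 2 * pi" using that by (simp add: u_def numeral_2_eq_2)
    moreover from this have "(B ^^ 2) (cis y) = cis y"
      unfolding B_funpow_cis by (simp add: numeral_2_eq_2 cis_add_2pi)
    ultimately show ?thesis using multiplier_gt_1[of 2 y] cis_ne_z0[of y] by simp
  qed
  have pp2: "\<phi> (\<phi> (per 0)) = per 0 + 2 * pi" using per(3)[of 0] by (simp add: numeral_2_eq_2)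
  then have u0: "u (per 0) = 0" by (simp add: u_def numeral_2_eq_2)
  have less_iff: "G y < y \<longleftrightarrow> 0 < u y" "y < G y \<longleftrightarrow> u y < 0" for y
  proof -
    have "G y < y \<longleftrightarrow> \<phi> (\<phi> (G y)) < \<phi> (\<phi> y)" "y < G y \<longleftrightarrow> \<phi> (\<phi> y) < \<phi> (\<phi> (G y))"
      using strict_mono_less[OF \<phi>_strict_mono] by auto
    then show "G y < y \<longleftrightarrow> 0 < u y" "y < G y \<longleftrightarrow> u y < 0"
      by (auto simp: u_def numeral_2_eq_2 G_def)
  qed
  have cont: "isCont G y" for y
    unfolding G_def by (intro isCont_o2[OF _ isCont_g] continuous_intros)
  have mono: "mono G"
    unfolding G_def mono_def using strict_mono_less_eq[OF g_strict_mono] by simp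
  have fixp: "G (per 0) = per 0"
    unfolding G_def pp2[symmetric] by simp
  have "(\<lambda>n. (G ^^ n) x) \<longlonglongrightarrow> per 0"
  proof (cases "per 0 \<le> x")
    case True
    then show ?thesis
      by (intro funpow_decreasing_limit[OF cont mono fixp])
        (use less_iff pos_after_zero_if_deriv_pos_at_zeros[OF u_der u_pos u0] in auto)
  next
    case False
    then show ?thesis
      by (intro funpow_increasing_limit[OF cont mono fixp])
        (use less_iff neg_before_zero_if_deriv_pos_at_zeros[OF u_der u_pos u0] in auto)
  qed
  then show ?thesis by (simp add: G_def)
qed

text \<open>The limit points of the orbits: the fixed point \<open>t0\<close> and a backward orbit of \<open>t0 + 2\<pi>\<close>
  converging to it.\<close>

definition homoclinic :: "complex set" where
  "homoclinic = insert (cis t0) (range (\<lambda>j. cis ((g ^^ Suc j) (t0 + 2 * pi))))"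

text \<open>Without its first \<open>i\<close> orbits the set is still compact; this separates
  finitely many orbits from the rest by closed sets.\<close>

definition tail :: "nat \<Rightarrow> complex set" where
  "tail i = homoclinic \<union> (\<Union>n\<in>{i..}. orbit n)"

text \<open>Points are counted backwards from the end of an orbit: \<open>\<phi> ^^ (n + 2)\<close>
  sends \<open>per n\<close> to \<open>per n + 2 * pi\<close>, and pulling back j + 1 times stays on
  the orbit as long as j < n + 2. For fixed \<open>j\<close> these points converge to a homoclinic
  point as \<open>n\<close> grows.\<close>

definition lift_tail :: "nat \<Rightarrow> nat \<Rightarrow> real set" where
  "lift_tail i j = (g ^^ Suc j) ` insert (t0 + 2 * pi) ((\<lambda>n. per n + 2 * pi) ` {n. i \<le> n \<and> j < n + 2})"

section \<open>Compactness of the union of the orbits and the homoclinic set\<close>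

lemma compact_lift_tail: "compact (lift_tail i j)"
proof -
  \<comment> \<open>\<open>m\<close> is the least admissible \<open>n\<close>. The index set is a
    final segment, so \<open>lift_tail i j\<close> is a continuous image of a convergent sequence
    together with its limit.\<close>
  define m where "m = max i (j - 1)"
  have "{n. i \<le> n \<and> j < n + 2} = range (\<lambda>n. n + m)"
  proof (intro subset_antisym subsetI)
    fix n assume "n \<in> {n. i \<le> n \<and> j < n + 2}"
    then have "n = (n - m) + m" by (auto simp: m_def)
    then show "n \<in> range (\<lambda>n. n + m)" by blast
  qed (auto simp: m_def)
  then have "lift_tail i j = (g ^^ Suc j) ` insert (t0 + 2 * pi) (range (\<lambda>n. per (n + m) + 2 * pi))"
    by (simp only: lift_tail_def image_image)
  moreover have "(\<lambda>n. per (n + m) + 2 * pi) \<longlonglongrightarrow> t0 + 2 * pi"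
    by (intro tendsto_intros LIMSEQ_ignore_initial_segment per_lim)
  then have "compact (insert (t0 + 2 * pi) (range (\<lambda>n. per (n + m) + 2 * pi)))"
    by (rule compact_sequence_with_limit)
  ultimately show ?thesis
    by (simp only:) (intro compact_continuous_image continuous_at_imp_continuous_on ballI isCont_funpow_g)
qed

lemma lift_tail_bounds: "x \<in> lift_tail i j \<Longrightarrow> t0 \<le> x \<and> x \<le> (g ^^ Suc j) (t0 + 4 * pi)"
proof -
  assume "x \<in> lift_tail i j"
  then obtain y where y: "x = (g ^^ Suc j) y" "t0 \<le> y" "y \<le> t0 + 4 * pi"
  proof -
    consider "x = (g ^^ Suc j) (t0 + 2 * pi)" | n where "x = (g ^^ Suc j) (per n + 2 * pi)"
      using \<open>x \<in> lift_tail i j\<close> unfolding lift_tail_def by blast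
    then show thesis
    proof cases
      case 1
      then show thesis by (rule that) auto
    next
      case (2 n)
      then show thesis using per(1,2)[of n] by (intro that[OF 2]) auto
    qed
  qed
  have "(g ^^ n) t0 = t0" for n by (induction n) auto
  then show ?thesis
    using strict_mono_less_eq[OF funpow_g_strict_mono, of "Suc j" t0 y]
      strict_mono_less_eq[OF funpow_g_strict_mono, of "Suc j" y "t0 + 4 * pi"] y by metis
qed

text \<open>The pieces shrink to \<open>t0\<close> as \<open>j\<close> grows. A limit point other
  than \<open>t0\<close> stays to the right of some c > t0 and so lies in a union of finitely many
  compact pieces.\<close>

lemma compact_insert_UN_lift_tail: "compact (insert t0 (\<Union>j. lift_tail i j))" (is "compact ?S")
proof -
  have bound: "(g ^^ j) (t0 + 4 * pi) \<le> t0 + 4 * pi" for j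
  proof (induction j)
    case (Suc j)
    have "g ((g ^^ j) (t0 + 4 * pi)) \<le> g (t0 + 4 * pi)"
      using Suc strict_mono_less_eq[OF g_strict_mono] by blast
    also have "\<dots> < t0 + 4 * pi" by (rule g_less) simp
    finally show ?case by simp
  qed simp
  have sub: "?S \<subseteq> {t0..t0 + 4 * pi}"
  proof
    fix x assume "x \<in> ?S"
    then consider "x = t0" | j where "x \<in> lift_tail i j" by blast
    then show "x \<in> {t0..t0 + 4 * pi}"
    proof cases
      case (2 j)
      then show ?thesis using lift_tail_bounds[OF 2] bound[of "Suc j"] by (auto simp del: funpow.simps)
    qed simp
  qed
  have "closed ?S"
    unfolding closed_sequential_limits
  proof (intro allI impI)
    fix s l assume *: "(\<forall>n. s n \<in> ?S) \<and> s \<longlonglongrightarrow> l"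
    show "l \<in> ?S"
    proof (cases "l = t0")
      case False
      have "t0 \<le> s n" for n using * sub by (meson atLeastAtMost_iff subsetD)
      then have "t0 \<le> l" using * LIMSEQ_le_const[of s l t0] by blast
      define c where "c = (t0 + l) / 2"
      have c: "t0 < c" "c < l" using \<open>t0 \<le> l\<close> False by (auto simp: c_def)
      have "\<forall>\<^sub>F j in sequentially. (g ^^ j) (t0 + 4 * pi) < c"
        using order_tendstoD(2)[OF funpow_g_lim c(1)] by simp
      then obtain J where J: "\<And>j. J \<le> j \<Longrightarrow> (g ^^ j) (t0 + 4 * pi) < c"
        by (auto simp: eventually_sequentially)
      have "closed (\<Union>j\<in>{..<J}. lift_tail i j)"
        by (intro closed_UN ballI compact_imp_closed compact_lift_tail) simp
      moreover have "\<forall>\<^sub>F n in sequentially. s n \<in> (\<Union>j\<in>{..<J}. lift_tail i j)"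
      proof -
        have "\<forall>\<^sub>F n in sequentially. c < s n" using * order_tendstoD(1) c(2) by blast
        then show ?thesis
        proof eventually_elim
          case (elim n)
          have "s n \<in> ?S" using * by blast
          moreover have "s n \<noteq> t0" using elim c(1) by auto
          ultimately obtain j where j: "s n \<in> lift_tail i j" by blast
          then have "s n \<le> (g ^^ Suc j) (t0 + 4 * pi)" using lift_tail_bounds by blast
          then have "j < J" using J[of "Suc j"] elim by (cases "j < J") auto
          then show ?case using j by blast
        qed
      qed
      ultimately have "l \<in> (\<Union>j\<in>{..<J}. lift_tail i j)"
        using * by (intro Lim_in_closed_set[of _ s sequentially]) auto
      then show ?thesis by blast
    qed simp
  qed
  then show ?thesis
    using sub bounded_subset[OF bounded_closed_interval] by (auto simp: compact_eq_bounded_closed)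
qed

lemma funpow_per_eq_g:
  assumes "Suc j \<le> n + 2"
  shows "(g ^^ Suc j) (per n + 2 * pi) = (\<phi> ^^ (n + 1 - j)) (per n)"
proof -
  have "(\<phi> ^^ Suc j) ((\<phi> ^^ (n + 1 - j)) (per n)) = (\<phi> ^^ (Suc j + (n + 1 - j))) (per n)"
    by (simp only: funpow_add o_def)
  also have "Suc j + (n + 1 - j) = n + 2" using assms by simp
  finally have "(\<phi> ^^ Suc j) ((\<phi> ^^ (n + 1 - j)) (per n)) = (\<phi> ^^ Suc j) ((g ^^ Suc j) (per n + 2 * pi))"
    by (simp only: per(3) funpow_\<phi>_g)
  then show ?thesis using strict_mono_eq[OF funpow_\<phi>_strict_mono] by metis
qed

lemma cis_lift_tail: "cis ` insert t0 (\<Union>j. lift_tail i j) = tail i"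
proof (intro subset_antisym subsetI)
  fix z assume "z \<in> cis ` insert t0 (\<Union>j. lift_tail i j)"
  then consider "z = cis t0" | j where "z = cis ((g ^^ Suc j) (t0 + 2 * pi))"
    | j n where "z = cis ((g ^^ Suc j) (per n + 2 * pi))" "i \<le> n" "j < n + 2"
    unfolding lift_tail_def by blast
  then show "z \<in> tail i"
  proof cases
    case (3 j n)
    then have "z \<in> orbit n" unfolding orbit_def
      using funpow_per_eq_g[of j n] by (auto simp del: funpow.simps)
    then show ?thesis using 3 by (auto simp: tail_def)
  qed (auto simp: tail_def homoclinic_def simp del: funpow.simps)
next
  fix z assume "z \<in> tail i"
  then consider "z = cis t0" | j where "z = cis ((g ^^ Suc j) (t0 + 2 * pi))"
    | n where "z \<in> orbit n" "i \<le> n"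
    unfolding tail_def homoclinic_def by blast
  then show "z \<in> cis ` insert t0 (\<Union>j. lift_tail i j)"
  proof cases
    case (3 n)
    then obtain k where k: "k < n + 2" "z = cis ((\<phi> ^^ k) (per n))" by (auto simp: orbit_def)
    define j where "j = n + 1 - k"
    have "n + 1 - j = k" "j < n + 2" using k by (auto simp: j_def)
    then have "(\<phi> ^^ k) (per n) = (g ^^ Suc j) (per n + 2 * pi)" using funpow_per_eq_g[of j n] by simp
    then have "(\<phi> ^^ k) (per n) \<in> lift_tail i j" using \<open>j < n + 2\<close> 3 unfolding lift_tail_def by blast
    then show ?thesis using k by blast
  qed (auto simp: lift_tail_def simp del: funpow.simps)
qed

lemma compact_tail: "compact (tail i)"
  unfolding cis_lift_tail[symmetric]
  by (intro compact_continuous_image compact_insert_UN_lift_tail continuous_intros)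

lemma countable_tail: "countable (tail i)"
proof -
  have "countable (\<Union>n\<in>{i..}. orbit n)" by (intro countable_UN) (auto intro: countable_finite)
  then show ?thesis unfolding tail_def homoclinic_def by (auto simp del: funpow.simps)
qed

lemma B_homoclinic:
  assumes "z \<in> homoclinic"
  shows "B z \<in> homoclinic" "\<exists>k. (B ^^ k) z = cis t0"
proof -
  consider "z = cis t0" | j where "z = cis ((g ^^ Suc j) (t0 + 2 * pi))"
    using assms unfolding homoclinic_def by blast
  then show "B z \<in> homoclinic"
  proof cases
    case 1
    then show ?thesis by (simp add: B_cis homoclinic_def)
  next
    case (2 j)
    then have "B z = cis ((g ^^ j) (t0 + 2 * pi))" by (simp add: B_cis)
    then show ?thesis
      by (cases j) (auto simp: homoclinic_def cis.code simp del: funpow.simps(2))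
  qed
  consider "z = cis t0" | j where "z = cis ((g ^^ Suc j) (t0 + 2 * pi))"
    using assms unfolding homoclinic_def by blast
  then show "\<exists>k. (B ^^ k) z = cis t0"
  proof cases
    case 1
    then show ?thesis by (intro exI[of _ 0]) simp
  next
    case (2 j)
    have "(B ^^ Suc j) z = cis (t0 + 2 * pi)" unfolding 2 B_funpow_cis funpow_\<phi>_g ..
    then show ?thesis by (intro exI[of _ "Suc j"]) (simp add: cis.code)
  qed
qed

text \<open>A homoclinic point reaches the fixed point \<open>cis t0\<close>, which lies on none of
  the orbits.\<close>

lemma homoclinic_orbit_disjoint: "z \<in> homoclinic \<Longrightarrow> z \<notin> orbit i"
  using B_homoclinic(2)[of z] orbit_eq_range[of z i] cis_t0_notin_orbit[of i] by (metis rangeI)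

lemma B_tail: "z \<in> tail i \<Longrightarrow> B z \<in> tail i"
  using B_homoclinic(1) B_orbit unfolding tail_def by blast

text \<open>Over one turn the lift stays in a bounded interval, so only finitely many lifts of
  \<open>c\<close> are hit.\<close>

lemma finite_fibre: "finite {z \<in> sphere 0 1. B z = c}"
proof (cases "\<exists>y. c = cis y")
  case True
  then obtain y where y: "c = cis y" by blast
  define K where "K = {k::int. \<phi> 0 \<le> y + 2 * pi * of_int k \<and> y + 2 * pi * of_int k \<le> \<phi> (2 * pi)}"
  have "K \<subseteq> {\<lfloor>(\<phi> 0 - y) / (2 * pi)\<rfloor>..\<lceil>(\<phi> (2 * pi) - y) / (2 * pi)\<rceil>}"
  proof
    fix k assume "k \<in> K"
    then have "(\<phi> 0 - y) / (2 * pi) \<le> of_int k" "of_int k \<le> (\<phi> (2 * pi) - y) / (2 * pi)"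
      by (auto simp: K_def field_simps)
    then show "k \<in> {\<lfloor>(\<phi> 0 - y) / (2 * pi)\<rfloor>..\<lceil>(\<phi> (2 * pi) - y) / (2 * pi)\<rceil>}"
      by (auto simp: floor_le_iff le_ceiling_iff)
  qed
  then have "finite K" by (rule finite_subset) simp
  have "{z \<in> sphere 0 1. B z = c} \<subseteq> (\<lambda>k. cis (g (y + 2 * pi * of_int k))) ` K"
  proof
    fix z assume z: "z \<in> {z \<in> sphere 0 1. B z = c}"
    then obtain x where x: "0 \<le> x" "x < 2 * pi" "z = cis x"
      using Arg2pi[of z] by (auto simp: cis_conv_exp is_Arg_def)
    have "cis (\<phi> x) = cis y" using z x y B_cis by auto
    then have "sin (\<phi> x) = sin y" "cos (\<phi> x) = cos y" by (auto simp: complex_eq_iff)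
    then obtain k :: int where k: "\<phi> x = y + 2 * pi * of_int k" using sin_cos_eq_iff[of "\<phi> x" y] by auto
    moreover have "\<phi> 0 \<le> \<phi> x" "\<phi> x \<le> \<phi> (2 * pi)"
      using x strict_mono_less_eq[OF \<phi>_strict_mono] by auto
    ultimately have "k \<in> K" by (simp add: K_def)
    moreover have "x = g (y + 2 * pi * of_int k)" using k g_\<phi> by metis
    ultimately show "z \<in> (\<lambda>k. cis (g (y + 2 * pi * of_int k))) ` K" using x by auto
  qed
  then show ?thesis using \<open>finite K\<close> finite_subset by blast
next
  case False
  then have "{z \<in> sphere 0 1. B z = c} = {}" using ex_cis_eq B_sphere by blast
  then show ?thesis by (simp only: finite.emptyI)
qed

section \<open>The zero set and the construction of the weight\<close>

definition preimage :: "nat \<Rightarrow> complex set" where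
  "preimage i = {z \<in> sphere 0 1. B z \<in> tail i}"

definition heads :: "nat \<Rightarrow> complex set" where
  "heads i = (\<Union>n\<in>{..i}. orbit n)"

lemma finite_heads: "finite (heads i)"
  by (simp add: heads_def)

lemma heads_sphere: "heads i \<subseteq> sphere 0 1"
  using orbit_sphere by (auto simp: heads_def)

lemma tail_0_eq: "tail 0 = tail (Suc i) \<union> heads i"
proof -
  have "{0..} = {Suc i..} \<union> {..i}" by auto
  then have "(\<Union>n\<in>{0..}. orbit n) = (\<Union>n\<in>{Suc i..}. orbit n) \<union> (\<Union>n\<in>{..i}. orbit n)"
    by (simp only: UN_Un)
  then show ?thesis by (auto simp: tail_def heads_def)
qed

lemma tail_heads_disjoint: "tail (Suc i) \<inter> heads i = {}"
proof -
  have False if z: "z \<in> tail (Suc i)" "z \<in> heads i" for z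
  proof -
    obtain n where n: "n \<le> i" "z \<in> orbit n" using z(2) by (auto simp: heads_def)
    then have "z \<notin> homoclinic" using homoclinic_orbit_disjoint by blast
    then obtain m where "Suc i \<le> m" "z \<in> orbit m" using z(1) by (auto simp: tail_def)
    then show False using orbit_disjoint[OF n(2)] n(1) by fastforce
  qed
  then show ?thesis by blast
qed

lemma closed_preimage: "closed (preimage i)"
proof -
  have "preimage i = sphere 0 1 \<inter> B -` tail i" by (auto simp: preimage_def)
  moreover have "continuous_on (sphere 0 1) B" by (rule continuous_on_subset[OF B_cont]) auto
  ultimately show ?thesis
    using continuous_closed_preimage[of "sphere 0 1" B "tail i"] compact_tail[THEN compact_imp_closed] by simp
qed

lemma countable_preimage: "countable (preimage i)"
proof -
  have "preimage i = (\<Union>c\<in>tail i. {z \<in> sphere 0 1. B z = c})" by (auto simp: preimage_def)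
  then show ?thesis
    by (simp only:) (intro countable_UN countable_tail countable_finite finite_fibre)
qed

text \<open>\<open>heads i\<close> is finite and forward invariant, so the set splits into the
  preimage of the compact set \<open>tail (Suc i)\<close>, which misses \<open>heads i\<close>, and
  a finite set.\<close>

lemma closed_preimage_minus_heads: "closed (preimage 0 - heads i)"
proof -
  have Bh: "B z \<in> heads i" if "z \<in> heads i" for z using that B_orbit by (auto simp: heads_def)
  have "preimage 0 - heads i = preimage (Suc i) \<union> ((\<Union>c\<in>heads i. {z \<in> sphere 0 1. B z = c}) - heads i)"
    using tail_0_eq[of i] tail_heads_disjoint[of i] Bh by (auto simp: preimage_def)
  moreover have "finite ((\<Union>c\<in>heads i. {z \<in> sphere 0 1. B z = c}) - heads i)"
    using finite_fibre finite_heads by blast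
  ultimately show ?thesis
    by (simp only:) (intro closed_Un closed_preimage finite_imp_closed)
qed

lemma heads_subset_preimage: "heads i \<subseteq> preimage 0"
proof
  fix z assume z: "z \<in> heads i"
  then obtain n where "z \<in> orbit n" by (auto simp: heads_def)
  then have "B z \<in> tail 0" using B_orbit unfolding tail_def by blast
  then show "z \<in> preimage 0" using z heads_sphere[of i] by (auto simp: preimage_def)
qed

text \<open>With \<open>Q i\<close> equal to 1 on the orbits 0, ..., i and to 0 on the rest of
  \<open>preimage 0\<close>, the weight is the sum of the functions (lam i - lam (Suc i)) Q i. On
  orbit j the terms i \<ge> j survive and telescope to \<open>lam j\<close>; off
  \<open>preimage 0\<close> all terms have positive real part and cannot cancel.\<close>

lemma ex_weight:
  fixes lam :: "nat \<Rightarrow> real"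
  assumes dec: "\<And>i. lam (Suc i) < lam i" and lim: "lam \<longlonglongrightarrow> 0"
  shows "\<exists>w\<in>disc_algebra. (\<forall>z\<in>cball 0 1. cmod (w z) \<le> lam 0) \<and>
    (\<forall>i. \<forall>z\<in>orbit i. w z = of_real (lam i)) \<and> (\<forall>z\<in>preimage 0 - (\<Union>i. orbit i). w z = 0) \<and>
    (\<forall>z\<in>cball 0 1 - preimage 0. w z \<noteq> 0)"
proof -
  have "\<exists>Q\<in>disc_algebra. (\<forall>z\<in>heads i. Q z = 1) \<and> (\<forall>z\<in>preimage 0 - heads i. Q z = 0) \<and>
      (\<forall>z\<in>cball 0 1. cmod (Q z) \<le> 1) \<and> (\<forall>z\<in>cball 0 1 - (preimage 0 - heads i). 0 < Re (Q z))" for i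
  proof (rule ex_disc_algebra_interpolation)
    show "preimage 0 - heads i \<subseteq> sphere 0 1" by (auto simp: preimage_def)
    show "countable (preimage 0 - heads i)" by (rule countable_subset[OF _ countable_preimage]) auto
  qed (use heads_sphere finite_heads closed_preimage_minus_heads in \<open>auto intro: finite_imp_closed countable_finite\<close>)
  then obtain Q where Q: "\<And>i. Q i \<in> disc_algebra" "\<And>i z. z \<in> heads i \<Longrightarrow> Q i z = 1"
      "\<And>i z. z \<in> preimage 0 - heads i \<Longrightarrow> Q i z = 0" "\<And>i z. z \<in> cball 0 1 \<Longrightarrow> cmod (Q i z) \<le> 1"
      "\<And>i z. z \<in> cball 0 1 - (preimage 0 - heads i) \<Longrightarrow> 0 < Re (Q i z)"
    by metis
  define c where "c = (\<lambda>i. lam i - lam (Suc i))"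
  have c_pos: "0 < c i" for i using dec by (simp add: c_def)
  have c_sums: "(\<lambda>i. c (i + j)) sums lam j" for j
    using telescope_sums'[OF LIMSEQ_ignore_initial_segment[OF lim, of j]] by (simp add: c_def)
  have c_summable: "summable c" using c_sums[of 0] by (simp add: sums_iff)
  define w where "w = (\<lambda>z. \<Sum>i. of_real (c i) * Q i z)"
  have bound: "cmod (of_real (c i) * Q i z) \<le> c i" if "z \<in> cball 0 1" for i z
    using Q(4)[OF that, of i] c_pos[of i] by (simp add: norm_mult mult_left_le)
  have "uniform_limit (cball 0 1) (\<lambda>n z. \<Sum>i<n. of_real (c i) * Q i z) w sequentially"
    unfolding w_def by (rule Weierstrass_m_test[OF bound c_summable])
  then have "w \<in> disc_algebra"
    by (rule uniform_limit_disc_algebra[rotated])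
      (use Q(1) in \<open>auto simp: disc_algebra_def intro!: holomorphic_intros continuous_intros\<close>)
  moreover have "cmod (w z) \<le> lam 0" if "z \<in> cball 0 1" for z
  proof -
    have "cmod (w z) \<le> suminf c"
      unfolding w_def by (rule norm_suminf_le[OF bound[OF that] c_summable])
    then show ?thesis using c_sums[of 0] by (simp add: sums_iff)
  qed
  moreover have "w z = of_real (lam j)" if z: "z \<in> orbit j" for j z
  proof -
    have zc: "z \<in> cball 0 1" using z orbit_sphere by (force simp: subset_eq)
    have summ: "summable (\<lambda>i. of_real (c i) * Q i z)"
      by (rule summable_comparison_test'[OF c_summable bound[OF zc]])
    have "z \<in> preimage 0" using z heads_subset_preimage[of j] by (auto simp: heads_def)
    have "Q i z = 0" if "i < j" for i
    proof (rule Q(3))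
      have "z \<notin> heads i" using orbit_disjoint[OF z] that by (fastforce simp: heads_def)
      then show "z \<in> preimage 0 - heads i" using \<open>z \<in> preimage 0\<close> by blast
    qed
    then have "w z = (\<Sum>i. of_real (c (i + j)) * Q (i + j) z)"
      unfolding w_def by (subst suminf_split_initial_segment[OF summ, of j]) simp
    also have "\<dots> = (\<Sum>i. of_real (c (i + j)))"
    proof (rule suminf_cong)
      fix i
      have "z \<in> heads (i + j)" using z by (auto simp: heads_def)
      then show "of_real (c (i + j)) * Q (i + j) z = of_real (c (i + j))" using Q(2) by simp
    qed
    also have "\<dots> = of_real (lam j)"
      using sums_of_real[OF c_sums[of j], where 'a=complex] by (simp add: sums_iff)
    finally show ?thesis .
  qed
  moreover have "w z = 0" if "z \<in> preimage 0 - (\<Union>i. orbit i)" for z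
  proof -
    have "Q i z = 0" for i by (rule Q(3)) (use that in \<open>auto simp: heads_def\<close>)
    then show ?thesis by (simp add: w_def)
  qed
  moreover have "w z \<noteq> 0" if z: "z \<in> cball 0 1 - preimage 0" for z
  proof -
    have zc: "z \<in> cball 0 1" using z by simp
    have summ: "summable (\<lambda>i. of_real (c i) * Q i z)"
      by (rule summable_comparison_test'[OF c_summable bound[OF zc]])
    have pos: "0 < Re (of_real (c i) * Q i z)" for i using Q(5)[of z i] c_pos[of i] z by simp
    have "0 < (\<Sum>i. Re (of_real (c i) * Q i z))"
      by (rule suminf_pos[OF summable_Re[OF summ] pos])
    then have "0 < Re (w z)" unfolding w_def Re_suminf[OF summ] .
    then show ?thesis by auto
  qed
  ultimately show ?thesis by (intro bexI[of _ w]) blast+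
qed

section \<open>Cocycles and the upper inclusion for the spectrum\<close>

definition cocycle :: "(complex \<Rightarrow> complex) \<Rightarrow> nat \<Rightarrow> complex \<Rightarrow> complex" where
  "cocycle w k z = (\<Prod>j<k. w ((B ^^ j) z))"

lemma cocycle_Suc: "cocycle w (Suc k) z = w z * cocycle w k (B z)"
  unfolding cocycle_def by (simp add: prod.lessThan_Suc_shift funpow_swap1 del: prod.lessThan_Suc)

text \<open>\<open>cocycle w k\<close> is the weight of the k-th power of the operator T. The
  induction uses T^(k+1) - \<mu>^(k+1) = T (T^k - \<mu>^k) + \<mu>^k (T - \<mu>); the constant
  depends on \<open>k\<close> but not on \<open>f\<close> or \<open>z\<close>.\<close>

lemma approx_eigen_iterate:
  assumes w: "continuous_on (cball 0 1) w" and M: "\<And>z. z \<in> cball 0 1 \<Longrightarrow> cmod (w z) \<le> M"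
  shows "\<exists>C. \<forall>f z. f \<in> disc_algebra \<longrightarrow> z \<in> cball 0 1 \<longrightarrow>
    cmod (cocycle w k z * f ((B ^^ k) z) - \<mu> ^ k * f z) \<le> C * dnorm (\<lambda>z. w z * f (B z) - \<mu> * f z)"
proof (induction k)
  case 0
  then show ?case by (intro exI[of _ 0]) (simp add: cocycle_def)
next
  case (Suc k)
  then obtain C where C: "\<And>f z. f \<in> disc_algebra \<Longrightarrow> z \<in> cball 0 1 \<Longrightarrow>
    cmod (cocycle w k z * f ((B ^^ k) z) - \<mu> ^ k * f z) \<le> C * dnorm (\<lambda>z. w z * f (B z) - \<mu> * f z)"
    by blast
  have "cmod (cocycle w (Suc k) z * f ((B ^^ Suc k) z) - \<mu> ^ Suc k * f z)
      \<le> (M * C + cmod \<mu> ^ k) * dnorm (\<lambda>z. w z * f (B z) - \<mu> * f z)"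
    if f: "f \<in> disc_algebra" and z: "z \<in> cball 0 1" for f z
  proof -
    let ?e = "dnorm (\<lambda>z. w z * f (B z) - \<mu> * f z)"
    have Bz: "B z \<in> cball 0 1" using z by (rule B_cball)
    have fc: "continuous_on (cball 0 1) f" using f by (simp add: disc_algebra_def)
    have "continuous_on (cball 0 1) (\<lambda>z. w z * f (B z) - \<mu> * f z)"
      by (intro continuous_intros w fc continuous_on_compose2[OF fc B_cont]) (use B_cball in auto)
    then have 1: "cmod (w z * f (B z) - \<mu> * f z) \<le> ?e" using z by (rule norm_le_dnorm)
    have "0 \<le> M" using M[of 0] norm_ge_zero[of "w 0"] by (meson centre_in_cball order_trans zero_le_one)
    have "cocycle w (Suc k) z * f ((B ^^ Suc k) z) - \<mu> ^ Suc k * f z =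
        w z * (cocycle w k (B z) * f ((B ^^ k) (B z)) - \<mu> ^ k * f (B z)) + \<mu> ^ k * (w z * f (B z) - \<mu> * f z)"
      by (simp add: cocycle_Suc funpow_swap1 algebra_simps)
    also have "cmod \<dots> \<le> cmod (w z) * cmod (cocycle w k (B z) * f ((B ^^ k) (B z)) - \<mu> ^ k * f (B z))
        + cmod \<mu> ^ k * cmod (w z * f (B z) - \<mu> * f z)"
      by (rule norm_triangle_le) (simp add: norm_mult norm_power)
    also have "\<dots> \<le> M * (C * ?e) + cmod \<mu> ^ k * ?e"
      by (intro add_mono mult_mono M z C f Bz 1 order_refl) (use \<open>0 \<le> M\<close> in auto)
    finally show ?thesis by (simp add: algebra_simps)
  qed
  then show ?case by blast
qed

lemma continuous_cocycle_cis:
  assumes "continuous_on (cball 0 1) w"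
  shows "isCont (\<lambda>x. cocycle w k (cis x)) x"
proof -
  have "continuous_on UNIV (\<lambda>x. w (cis ((\<phi> ^^ j) x)))" for j
    by (rule continuous_on_compose2[OF assms])
      (intro continuous_on_cis continuous_at_imp_continuous_on ballI isCont_funpow_\<phi>, auto)
  then have "continuous_on UNIV (\<lambda>x. cocycle w k (cis x))"
    unfolding cocycle_def B_funpow_cis by (intro continuous_intros)
  then show ?thesis by (simp add: continuous_on_eq_continuous_at)
qed

text \<open>\<open>cis x\<close> is a limit of points where the approximate eigenvector has modulus
  1. Comparing T^k f with \<mu>^k f at these points gives the forward bound; comparing them at
  preimages of these points under \<open>B ^^ k\<close> gives the backward bound.\<close>

lemma usf_spectrum_point:
  assumes w: "w \<in> disc_algebra" and \<mu>: "\<mu> \<in> usf_spectrum (\<lambda>f z. w z * f (B z))"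
  shows "\<exists>x. (\<forall>k. cmod \<mu> ^ k \<le> cmod (cocycle w k (cis x))) \<and>
    (\<forall>k y. cis ((\<phi> ^^ k) y) = cis x \<longrightarrow> cmod (cocycle w k (cis y)) \<le> cmod \<mu> ^ k)"
proof -
  have wc: "continuous_on (cball 0 1) w" using w by (simp add: disc_algebra_def)
  obtain f where f: "\<And>n. f n \<in> disc_algebra" "\<And>n. dnorm (f n) = 1"
      and e_lim: "(\<lambda>n. dnorm (\<lambda>z. w z * f n (B z) - \<mu> * f n z)) \<longlonglongrightarrow> 0"
    using \<mu> unfolding usf_spectrum_def by blast
  define e where "e = (\<lambda>n. dnorm (\<lambda>z. w z * f n (B z) - \<mu> * f n z))"
  have fle: "cmod (f n z) \<le> 1" if "z \<in> cball 0 1" for n z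
    using norm_le_dnorm[of "f n" z] f[of n] that by (simp add: disc_algebra_def)
  have "\<exists>s. 0 \<le> s \<and> s \<le> 2 * pi \<and> cmod (f n (cis s)) = 1" for n
  proof -
    obtain z where z: "z \<in> sphere 0 1" "cmod (f n z) = 1"
      using dnorm_attained_on_sphere[OF f(1), of n] f(2) by auto
    then show ?thesis
      using Arg2pi[of z] by (intro exI[of _ "Arg2pi z"]) (auto simp: cis_conv_exp is_Arg_def)
  qed
  then obtain s where s: "\<And>n. s n \<in> {0..2 * pi}" "\<And>n. cmod (f n (cis (s n))) = 1"
    by (metis atLeastAtMost_iff)
  obtain x r where r: "strict_mono r" and sx: "(s \<circ> r) \<longlonglongrightarrow> x"
    using compact_Icc[of 0 "2 * pi"] s(1) unfolding compact_def by metis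
  have er: "(\<lambda>n. e (r n)) \<longlonglongrightarrow> 0"
    using LIMSEQ_subseq_LIMSEQ[OF e_lim r] by (simp add: e_def o_def)
  have it: "\<exists>C. \<forall>n z. z \<in> cball 0 1 \<longrightarrow> cmod (cocycle w k z * f n ((B ^^ k) z) - \<mu> ^ k * f n z) \<le> C * e n" for k
    using approx_eigen_iterate[OF wc norm_le_dnorm[OF wc], of k \<mu>] f(1) unfolding e_def by blast
  have "cmod \<mu> ^ k \<le> cmod (cocycle w k (cis x))" for k
  proof -
    obtain C where C: "\<And>n z. z \<in> cball 0 1 \<Longrightarrow>
        cmod (cocycle w k z * f n ((B ^^ k) z) - \<mu> ^ k * f n z) \<le> C * e n" using it by blast
    have "cmod \<mu> ^ k \<le> cmod (cocycle w k (cis (s n))) + C * e n" for n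
    proof -
      let ?z = "cis (s n)"
      have z: "?z \<in> cball 0 1" by simp
      have "cmod \<mu> ^ k = cmod (\<mu> ^ k * f n ?z)" by (simp add: norm_mult norm_power s(2))
      also have "\<dots> \<le> cmod (cocycle w k ?z * f n ((B ^^ k) ?z))
          + cmod (cocycle w k ?z * f n ((B ^^ k) ?z) - \<mu> ^ k * f n ?z)"
        by (metis norm_minus_commute norm_triangle_sub)
      also have "\<dots> \<le> cmod (cocycle w k ?z) * 1 + C * e n"
        unfolding norm_mult by (intro add_mono mult_left_mono fle B_funpow_cball z) (use C[OF z] in \<open>auto simp: norm_mult\<close>)
      finally show ?thesis by simp
    qed
    then have "\<forall>n. cmod \<mu> ^ k \<le> cmod (cocycle w k (cis ((s \<circ> r) n))) + C * e (r n)" by simp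
    moreover have "(\<lambda>n. cmod (cocycle w k (cis ((s \<circ> r) n))) + C * e (r n)) \<longlonglongrightarrow> cmod (cocycle w k (cis x)) + C * 0"
      by (intro tendsto_intros er isCont_tendsto_compose[OF continuous_cocycle_cis[OF wc] sx])
    ultimately have "cmod \<mu> ^ k \<le> cmod (cocycle w k (cis x)) + C * 0"
      by (intro LIMSEQ_le_const[of "\<lambda>n. cmod (cocycle w k (cis ((s \<circ> r) n))) + C * e (r n)"]) auto
    then show ?thesis by simp
  qed
  moreover have "cmod (cocycle w k (cis y)) \<le> cmod \<mu> ^ k" if y: "cis ((\<phi> ^^ k) y) = cis x" for k y
  proof -
    obtain C where C: "\<And>n z. z \<in> cball 0 1 \<Longrightarrow>
        cmod (cocycle w k z * f n ((B ^^ k) z) - \<mu> ^ k * f n z) \<le> C * e n" using it by blast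
    obtain l :: int where l: "(\<phi> ^^ k) y = x + 2 * pi * of_int l" using y cis_eq_cis_iff by blast
    \<comment> \<open>The lifts follow the inverse branch through \<open>y\<close>: they are
      preimages of the peak points and converge to \<open>y\<close> along \<open>r\<close>.\<close>
    define t where "t = (\<lambda>n. (g ^^ k) (s n + 2 * pi * of_int l))"
    have gy: "(g ^^ k) (x + 2 * pi * of_int l) = y"
    proof -
      have "(\<phi> ^^ k) ((g ^^ k) (x + 2 * pi * of_int l)) = (\<phi> ^^ k) y" by (simp add: l)
      then show ?thesis using strict_mono_eq[OF funpow_\<phi>_strict_mono] by blast
    qed
    have "(\<lambda>n. (g ^^ k) ((s \<circ> r) n + 2 * pi * of_int l)) \<longlonglongrightarrow> (g ^^ k) (x + 2 * pi * of_int l)"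
      by (rule isCont_tendsto_compose[OF isCont_funpow_g]) (intro tendsto_intros sx)
    then have t_lim: "(t \<circ> r) \<longlonglongrightarrow> y" unfolding gy by (simp add: t_def o_def)
    have "cmod (cocycle w k (cis (t n))) \<le> cmod \<mu> ^ k + C * e n" for n
    proof -
      let ?z = "cis (t n)"
      have z: "?z \<in> cball 0 1" by simp
      have "cis (s n + 2 * pi * of_int l) = cis (s n)" using cis_eq_cis_iff by blast
      then have Bz: "(B ^^ k) ?z = cis (s n)" by (simp add: B_funpow_cis t_def)
      have "cmod (cocycle w k ?z) = cmod (cocycle w k ?z * f n ((B ^^ k) ?z))"
        unfolding norm_mult Bz s(2) by simp
      also have "\<dots> \<le> cmod (\<mu> ^ k * f n ?z)
          + cmod (cocycle w k ?z * f n ((B ^^ k) ?z) - \<mu> ^ k * f n ?z)"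
        by (rule norm_triangle_sub)
      also have "\<dots> \<le> cmod \<mu> ^ k * 1 + C * e n"
        by (intro add_mono C z) (use fle[OF z] in \<open>auto simp: norm_mult norm_power intro: mult_left_le\<close>)
      finally show ?thesis by simp
    qed
    then have "\<forall>n. cmod (cocycle w k (cis ((t \<circ> r) n))) \<le> cmod \<mu> ^ k + C * e (r n)" by simp
    moreover have "(\<lambda>n. cmod (cocycle w k (cis ((t \<circ> r) n)))) \<longlonglongrightarrow> cmod (cocycle w k (cis y))"
      by (intro tendsto_intros isCont_tendsto_compose[OF continuous_cocycle_cis[OF wc] t_lim])
    moreover have "(\<lambda>n. cmod \<mu> ^ k + C * e (r n)) \<longlonglongrightarrow> cmod \<mu> ^ k + C * 0"
      by (intro tendsto_intros er)
    ultimately have "cmod (cocycle w k (cis y)) \<le> cmod \<mu> ^ k + C * 0"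
      by (intro LIMSEQ_le) auto
    then show ?thesis by simp
  qed
  ultimately show ?thesis by blast
qed

lemma cocycle_orbit:
  assumes "\<And>z. z \<in> orbit i \<Longrightarrow> w z = c" "z \<in> orbit i"
  shows "cocycle w k z = c ^ k"
  using assms(2)
proof (induction k arbitrary: z)
  case (Suc k)
  then show ?case using assms(1) B_orbit by (simp add: cocycle_Suc)
qed (simp add: cocycle_def)

lemma B_period_orbit:
  assumes "z \<in> orbit i"
  shows "(B ^^ (i + 2)) z = z"
proof -
  obtain m where m: "z = (B ^^ m) (cis (per i))" using assms orbit_eq_range_per by auto
  have "(B ^^ (i + 2)) ((B ^^ m) (cis (per i))) = (B ^^ m) ((B ^^ (i + 2)) (cis (per i)))"
    by (metis add.commute comp_apply funpow_add)
  then show ?thesis by (simp only: m B_period_per)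
qed

text \<open>Two steps along the inverse branch to orbit 0 contribute a factor \<open>b n\<close>
  that tends to c^2. If \<bar>c\<bar> > r, the cocycle would eventually outgrow r^(2n). It never
  vanishes on the branch: strict preimages of a point outside the forward invariant set
  \<open>tail 0\<close> avoid \<open>preimage 0\<close>.\<close>

lemma backward_branch_growth:
  assumes w: "continuous_on (cball 0 1) w" and w_orbit0: "\<And>z. z \<in> orbit 0 \<Longrightarrow> w z = of_real c"
    and nz: "\<And>z. z \<in> cball 0 1 - preimage 0 \<Longrightarrow> w z \<noteq> 0" and x: "cis x \<notin> tail 0"
    and bound: "\<And>k y. cis ((\<phi> ^^ k) y) = cis x \<Longrightarrow> cmod (cocycle w k (cis y)) \<le> r ^ k"
    and "0 < r"
  shows "\<bar>c\<bar> \<le> r"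
proof (rule ccontr)
  assume "\<not> \<bar>c\<bar> \<le> r"
  define y where "y = (\<lambda>n. ((\<lambda>y. g (g (y + 2 * pi))) ^^ n) x)"
  define b where "b = (\<lambda>n. cmod (w (cis (y (Suc n)))) * cmod (w (cis (\<phi> (y (Suc n))))))"
  define a where "a = (\<lambda>n. cmod (cocycle w (2 * n) (cis (y n))))"
  have \<phi>y: "\<phi> (\<phi> (y (Suc n))) = y n + 2 * pi" for n by (simp add: y_def)
  have BB: "B (B (cis (y (Suc n)))) = cis (y n)" for n by (simp add: B_cis \<phi>y cis_add_2pi)
  have cis_y: "cis ((\<phi> ^^ (2 * n)) (y n)) = cis x" for n
  proof (induction n)
    case (Suc n)
    have "cis ((\<phi> ^^ (2 * Suc n)) (y (Suc n))) = (B ^^ (2 * n)) (B (B (cis (y (Suc n)))))"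
      by (simp add: B_funpow_cis[symmetric] funpow_swap1 B_cis)
    also have "\<dots> = cis x" unfolding BB B_funpow_cis by (rule Suc)
    finally show ?case .
  qed (simp add: y_def)
  have a_le: "a n \<le> (r^2) ^ n" for n
    using bound[OF cis_y, of n] by (simp add: a_def power_mult)
  have a_Suc: "a (Suc n) = b n * a n" for n
    by (simp add: a_def b_def cocycle_Suc BB norm_mult B_cis[symmetric])
  have notin: "cis (y n) \<notin> tail 0" for n
  proof (induction n)
    case (Suc n)
    then show ?case using BB[of n] B_tail by metis
  qed (simp add: x y_def)
  have b_pos: "0 < b n" for n
  proof -
    have "B (cis (y (Suc n))) \<notin> tail 0" using notin[of n] BB[of n] B_tail by metis
    then have "cis (y (Suc n)) \<notin> preimage 0" "cis (\<phi> (y (Suc n))) \<notin> preimage 0"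
      using notin[of n] BB[of n] by (auto simp: preimage_def B_cis)
    then show ?thesis using nz by (simp add: b_def)
  qed
  have a_pos: "0 < a n" for n
    by (induction n) (simp_all add: a_Suc b_pos, simp add: a_def cocycle_def)
  have ylim: "(\<lambda>n. y (Suc n)) \<longlonglongrightarrow> per 0"
    using LIMSEQ_Suc[OF backward_branch_lim[of x]] by (simp only: y_def)
  have w1: "isCont (\<lambda>x. w (cis x)) t" for t
    using continuous_cocycle_cis[OF w, where k = 1 and x = t] by (simp add: cocycle_def)
  have "b \<longlonglongrightarrow> cmod (w (cis (per 0))) * cmod (w (cis (\<phi> (per 0))))"
    unfolding b_def
    by (intro tendsto_intros isCont_tendsto_compose[OF w1] isCont_tendsto_compose[OF isCont_\<phi>] ylim)
  moreover have "cis (per 0) \<in> orbit 0" using orbit_eq_range_per[of 0] rangeI[of "\<lambda>k. (B ^^ k) (cis (per 0))" 0] by simp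
  moreover from this have "cis (\<phi> (per 0)) \<in> orbit 0" using B_orbit B_cis by metis
  ultimately have b_lim: "b \<longlonglongrightarrow> \<bar>c\<bar> * \<bar>c\<bar>" using w_orbit0 by simp
  define \<rho> where "\<rho> = (r^2 + \<bar>c\<bar>^2) / 2"
  have "r^2 < \<bar>c\<bar>^2" using \<open>\<not> \<bar>c\<bar> \<le> r\<close> \<open>0 < r\<close> by (intro power_strict_mono) auto
  then have \<rho>: "r^2 < \<rho>" "\<rho> < \<bar>c\<bar> * \<bar>c\<bar>" by (auto simp: \<rho>_def power2_eq_square)
  have \<rho>0: "0 < \<rho>" using \<rho>(1) \<open>0 < r\<close> by (meson less_trans zero_less_power)
  obtain N where N: "\<And>n. N \<le> n \<Longrightarrow> \<rho> < b n"
    using order_tendstoD(1)[OF b_lim \<rho>(2)] by (auto simp: eventually_sequentially)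
  have "\<rho> ^ m * a N \<le> a (N + m)" for m
  proof (induction m)
    case (Suc m)
    have "\<rho> ^ Suc m * a N = \<rho> * (\<rho> ^ m * a N)" by simp
    also have "\<dots> \<le> b (N + m) * a (N + m)"
      using N[of "N + m"] \<rho>0 a_pos[of N] b_pos Suc by (intro mult_mono) (auto intro: less_imp_le)
    finally show ?case by (simp add: a_Suc)
  qed simp
  then have le: "\<rho> ^ m * a N \<le> (r^2) ^ N * (r^2) ^ m" for m
    using a_le[of "N + m"] order_trans by (fastforce simp: power_add)
  have "a N \<le> (r^2) ^ N * (r^2 / \<rho>) ^ m" for m
    using le[of m] \<rho>0 by (simp add: power_divide field_simps)
  moreover have "(\<lambda>m. (r^2) ^ N * (r^2 / \<rho>) ^ m) \<longlonglongrightarrow> (r^2) ^ N * 0"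
    by (intro tendsto_intros LIMSEQ_power_zero) (use \<rho> \<rho>0 in simp)
  ultimately have "a N \<le> (r^2) ^ N * 0" by (intro LIMSEQ_le_const) auto
  then show False using a_pos[of N] by simp
qed

text \<open>If the concentration point lies in \<open>tail 0\<close>, the nonzero weight puts it on
  some orbit, and after one period it is its own preimage, so the backward bound applies to it.
  Otherwise the branch to orbit 0 and the bound \<open>lam 0\<close> of the weight fix the
  modulus.\<close>

lemma usf_spectrum_modulus:
  assumes w: "w \<in> disc_algebra" and le: "\<And>z. z \<in> cball 0 1 \<Longrightarrow> cmod (w z) \<le> lam 0"
    and w_orbit: "\<And>i z. z \<in> orbit i \<Longrightarrow> w z = of_real (lam i)"
    and zero: "\<And>z. z \<in> preimage 0 - (\<Union>i. orbit i) \<Longrightarrow> w z = 0"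
    and nz: "\<And>z. z \<in> cball 0 1 - preimage 0 \<Longrightarrow> w z \<noteq> 0"
    and lam: "\<And>i. 0 < lam i"
    and \<mu>: "\<mu> \<in> usf_spectrum (\<lambda>f z. w z * f (B z))" "\<mu> \<noteq> 0"
  shows "\<exists>i. cmod \<mu> = lam i"
proof -
  have wc: "continuous_on (cball 0 1) w" using w by (simp add: disc_algebra_def)
  obtain x where fwd: "\<And>k. cmod \<mu> ^ k \<le> cmod (cocycle w k (cis x))"
    and bwd: "\<And>k y. cis ((\<phi> ^^ k) y) = cis x \<Longrightarrow> cmod (cocycle w k (cis y)) \<le> cmod \<mu> ^ k"
    using usf_spectrum_point[OF w \<mu>(1)] by blast
  have fwd1: "cmod \<mu> \<le> cmod (w (cis x))" using fwd[of 1] by (simp add: cocycle_def)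
  show ?thesis
  proof (cases "cis x \<in> tail 0")
    case True
    then have "cis x \<in> preimage 0" using B_tail by (simp add: preimage_def)
    moreover have "w (cis x) \<noteq> 0" using fwd1 \<mu>(2) by auto
    ultimately obtain i where i: "cis x \<in> orbit i" using zero by blast
    have "cmod \<mu> \<le> lam i" using fwd1 w_orbit[OF i] lam[of i] by simp
    moreover have "lam i \<le> cmod \<mu>"
    proof -
      have "cis ((\<phi> ^^ (i + 2)) x) = cis x" using B_period_orbit[OF i] by (simp only: B_funpow_cis)
      then have "cmod (cocycle w (i + 2) (cis x)) \<le> cmod \<mu> ^ (i + 2)" by (rule bwd)
      then have "lam i ^ (i + 2) \<le> cmod \<mu> ^ (i + 2)"
        using cocycle_orbit[of i w "of_real (lam i)" "cis x" "i + 2", OF w_orbit i] lam[of i]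
        by (simp add: norm_power del: power_Suc power_add add_2_eq_Suc')
      then show ?thesis using power_mono_iff[of "lam i" "cmod \<mu>" "i + 2"] lam[of i] by simp
    qed
    ultimately show ?thesis by force
  next
    case False
    have "\<bar>lam 0\<bar> \<le> cmod \<mu>"
      by (rule backward_branch_growth[OF wc w_orbit nz False bwd]) (use \<mu>(2) in auto)
    moreover have "cmod \<mu> \<le> lam 0" using fwd1 le[of "cis x"] by simp
    ultimately show ?thesis by (intro exI[of _ 0]) auto
  qed
qed

section \<open>Approximate eigenvectors carried by a periodic orbit\<close>

lemma expansion_at_periodic_point:
  "\<exists>q. (\<forall>z. 1 - B z * cnj (cis (\<phi> x)) = of_real (\<phi>' x) * (1 - z * cnj (cis x)) * q z) \<and>
     isCont q (cis x) \<and> q (cis x) = 1"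
proof -
  let ?D = "of_real (\<phi>' x) * cis (\<phi> x) / cis x"
  \<comment> \<open>The Caratheodory form of the derivative writes the coordinate at the image point
    as \<phi>' x times the coordinate at \<open>cis x\<close> times a factor \<open>q\<close> near
    1, as the slow variation of the bumps requires.\<close>
  obtain h where h: "\<And>z. B z - B (cis x) = h z * (z - cis x)" "isCont h (cis x)" "h (cis x) = ?D"
    using B_deriv[of x] unfolding CARAT_DERIV by blast
  have D0: "?D \<noteq> 0" using \<phi>'_pos[of x] by simp
  have c1: "cis y * cnj (cis y) = 1" for y by (simp add: complex_norm_square[symmetric])
  have inv: "1 / cis x = cnj (cis x)" by (simp add: cis_cnj cis_inverse divide_inverse)
  define q where "q = (\<lambda>z. h z / ?D)"
  have "1 - B z * cnj (cis (\<phi> x)) = of_real (\<phi>' x) * (1 - z * cnj (cis x)) * q z" for z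
  proof -
    have "h z = ?D * q z" using D0 by (simp add: q_def)
    also have "?D = of_real (\<phi>' x) * cis (\<phi> x) * cnj (cis x)" by (simp add: inv[symmetric])
    finally have hz: "h z = of_real (\<phi>' x) * cis (\<phi> x) * cnj (cis x) * q z" .
    have "B z = cis (\<phi> x) + h z * (z - cis x)" using h(1)[of z] by (simp add: B_cis algebra_simps)
    then have "1 - B z * cnj (cis (\<phi> x)) =
      1 - (cis (\<phi> x) * cnj (cis (\<phi> x))) - (cis (\<phi> x) * cnj (cis (\<phi> x))) * of_real (\<phi>' x) * q z * (z * cnj (cis x) - cis x * cnj (cis x))"
      unfolding hz by algebra
    then show ?thesis unfolding c1 by (simp add: algebra_simps)
  qed
  moreover have "isCont q (cis x)" unfolding q_def using D0 by (intro continuous_intros h(2)) simp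
  moreover have "q (cis x) = 1" using D0 h(3) by (simp add: q_def)
  ultimately show ?thesis by blast
qed

text \<open>\<open>F n\<close> is a sum of bumps at the points of the orbit with unimodular
  coefficients \<open>a j\<close>. Composition with \<open>B\<close> turns the bump at the next
  point into about exp (i \<tau> ln \<beta>) times the bump at the current one, so the eigenvalue
  equation becomes a recursion for \<open>a\<close>. As \<open>F n\<close> tends to 0 off the orbit
  while its norm does not, no normalised subsequence converges.\<close>

lemma usf_spectrum_orbit:
  assumes w: "w \<in> disc_algebra" 
    and w_orbit: "\<And>z. z \<in> orbit i \<Longrightarrow> w z = of_real c"
    and zero: "\<And>z. z \<in> preimage 0 - (\<Union>i. orbit i) \<Longrightarrow> w z = 0"
    and \<mu>: "cmod \<mu> = c" and "0 < c"
  shows "\<mu> \<in> usf_spectrum (\<lambda>f z. w z * f (B z))"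
proof -
  have wc: "continuous_on (cball 0 1) w" using w by (simp add: disc_algebra_def)
  define m where "m = i + 2"
  define X where "X = (\<lambda>j. (\<phi> ^^ j) (per i))"
  define p where "p = (\<lambda>j. cis (X j))"
  define \<alpha> where "\<alpha> = Arg \<mu>"
  define \<sigma> where "\<sigma> = (\<lambda>j. \<Sum>k<j. ln (\<phi>' (X k)))"
  \<comment> \<open>This \<tau> makes the recursion close up after \<open>m\<close> steps; the
    divisor \<open>\<sigma> m\<close> is the logarithm of the multiplier of the cycle and hence
    positive.\<close>
  define \<tau> where "\<tau> = \<alpha> * real m / \<sigma> m"
  define a where "a = (\<lambda>j. cis (\<alpha> * real j - \<tau> * \<sigma> j))"
  have X_Suc: "X (Suc j) = \<phi> (X j)" for j by (simp add: X_def)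
  have p_Suc: "B (p j) = p (Suc j)" for j by (simp add: p_def X_Suc B_cis)
  have p_norm: "cmod (p j) = 1" for j by (simp add: p_def)
  have orbit_p: "orbit i = p ` {..<m}" by (simp add: orbit_def p_def X_def m_def)
  have p_m: "p m = p 0" unfolding p_def X_def m_def per(3) by (simp add: cis_add_2pi)
  have p_inj: "j = k" if "p j = p k" "j < m" "k < m" for j k
    using inj_onD[OF cis_funpow_per_inj[of i], of j k] that by (simp add: p_def X_def m_def)
  have m0: "0 < m" by (simp add: m_def)
  have "\<sigma> m = ln (multiplier m (per i))"
    unfolding \<sigma>_def multiplier_def X_def by (rule ln_prod[symmetric]) (auto simp: less_imp_neq[OF \<phi>'_pos, symmetric])
  moreover have "1 < multiplier m (per i)"
  proof (rule multiplier_gt_1[OF m0])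
    show "(B ^^ m) (cis (per i)) = cis (per i)" unfolding m_def by (rule B_period_per)
    have "cis (per i) \<in> orbit i" using orbit_p m0 by (force simp: p_def X_def)
    then show "cis (per i) \<noteq> z0" using z0_notin_orbit by metis
  qed
  ultimately have "0 < \<sigma> m" by simp
  then have a_m: "a m = 1" by (simp add: a_def \<tau>_def)
  have a_0: "a 0 = 1" by (simp add: a_def \<sigma>_def)
  have \<mu>_eq: "\<mu> = of_real c * cis \<alpha>"
    using rcis_cmod_Arg[of \<mu>] \<mu> by (simp add: \<alpha>_def rcis_def)
  have a_Suc: "a (Suc j) * exp (\<i> * of_real (\<tau> * ln (\<phi>' (X j)))) = a j * cis \<alpha>" for j
    unfolding a_def cis_conv_exp[symmetric] cis_mult by (simp add: \<sigma>_def algebra_simps)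
  define N where "N = (\<lambda>n. 2 + real n)"
  have N2: "2 \<le> N n" for n by (simp add: N_def)
  have N_lim: "filterlim (\<lambda>n. N (r n)) at_top sequentially" if "strict_mono r" for r
    unfolding N_def
    by (intro filterlim_tendsto_add_at_top[OF tendsto_const]
        filterlim_compose[OF filterlim_real_sequentially] filterlim_subseq that)
  define \<psi> where "\<psi> = (\<lambda>n j z. log_bump \<tau> (N n) (1 - z * cnj (p j)))"
  define F where "F = (\<lambda>n z. \<Sum>j<m. a j * \<psi> n j z)"
  have \<psi>_DA: "\<psi> n j \<in> disc_algebra" for n j
    unfolding \<psi>_def by (rule log_bump_disc_algebra[OF N2 p_norm])
  have F_DA: "F n \<in> disc_algebra" for n
    using \<psi>_DA unfolding F_def disc_algebra_def by (auto intro!: holomorphic_intros continuous_intros)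
  have Fc: "continuous_on (cball 0 1) (F n)" for n using F_DA by (simp add: disc_algebra_def)
  have FBc: "continuous_on (cball 0 1) (\<lambda>z. F n (B z))" for n
    by (rule continuous_on_compose2[OF Fc B_cont]) (use B_cball in auto)
  define K where "K = 4 * exp (2 * \<bar>\<tau>\<bar>)"
  have \<psi>_le: "cmod (\<psi> n j z) \<le> K" if "z \<in> cball 0 1" for n j z
    unfolding \<psi>_def K_def using that
    by (intro norm_log_bump_le_const Re_one_minus_cnj_nonneg p_norm N2) auto
  have a1: "cmod (a j) = 1" for j by (simp add: a_def)
  have F_le: "cmod (F n z) \<le> real m * K" if "z \<in> cball 0 1" for n z
  proof -
    have "cmod (F n z) \<le> (\<Sum>j<m. cmod (a j * \<psi> n j z))" unfolding F_def by (rule norm_sum)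
    also have "\<dots> \<le> (\<Sum>j<m. K)" by (intro sum_mono) (simp add: norm_mult a1 \<psi>_le[OF that])
    finally show ?thesis by simp
  qed
  have \<psi>_lim: "(\<lambda>n. \<psi> (r n) j (y n)) \<longlonglongrightarrow> 0"
    if "strict_mono r" "\<And>n. y n \<in> cball 0 1" "y \<longlonglongrightarrow> y0" "y0 \<noteq> p j" for r j y y0
    unfolding \<psi>_def by (rule log_bump_tendsto_0[OF p_norm N_lim[OF that(1)] N2 that(2-4)])
  have F_lim: "(\<lambda>n. F (r n) (y n)) \<longlonglongrightarrow> 0"
    if "strict_mono r" "\<And>n. y n \<in> cball 0 1" "y \<longlonglongrightarrow> y0" "y0 \<notin> orbit i" for r y y0
  proof -
    have "(\<lambda>n. \<Sum>j<m. a j * \<psi> (r n) j (y n)) \<longlonglongrightarrow> (\<Sum>j<m. a j * 0)"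
      by (intro tendsto_intros \<psi>_lim[OF that(1-3)]) (use that(4) orbit_p in auto)
    then show ?thesis by (simp add: F_def)
  qed
  have F_lim': "(\<lambda>n. F (r n) (y n) - a k * \<psi> (r n) k (y n)) \<longlonglongrightarrow> 0"
    if "strict_mono r" "\<And>n. y n \<in> cball 0 1" "y \<longlonglongrightarrow> p k" "k < m" for r y k
  proof -
    have "(\<lambda>n. \<Sum>j\<in>{..<m} - {k}. a j * \<psi> (r n) j (y n)) \<longlonglongrightarrow> (\<Sum>j\<in>{..<m} - {k}. a j * 0)"
      by (intro tendsto_intros \<psi>_lim[OF that(1-3)]) (use p_inj that(4) in force)
    moreover have "F (r n) (y n) - a k * \<psi> (r n) k (y n) = (\<Sum>j\<in>{..<m} - {k}. a j * \<psi> (r n) j (y n))" for n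
      using that(4) by (simp add: F_def sum_diff1)
    ultimately show ?thesis by simp
  qed
  define h where "h = (\<lambda>n z. w z * F n (B z) - \<mu> * F n z)"
  have hc: "continuous_on (cball 0 1) (h n)" for n
    unfolding h_def by (intro continuous_intros wc Fc FBc)
  have h_lim: "(\<lambda>n. dnorm (h n)) \<longlonglongrightarrow> 0"
  proof (rule dnorm_tendsto_0_compactness[OF hc])
    fix s :: "nat \<Rightarrow> complex" and r :: "nat \<Rightarrow> nat" and z
    assume s: "\<And>n. s n \<in> cball 0 1" "s \<longlonglongrightarrow> z" and r: "strict_mono r"
    have z: "z \<in> cball 0 1" using closed_sequentially[OF closed_cball, of s] s by blast
    have Bs: "\<And>n. B (s n) \<in> cball 0 1" using s(1) by (rule B_cball)
    have Bs_lim: "(\<lambda>n. B (s n)) \<longlonglongrightarrow> B z"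
      using continuous_on_tendsto_compose[OF B_cont s(2) z] s(1) by simp
    have w_lim: "(\<lambda>n. w (s n)) \<longlonglongrightarrow> w z"
      using continuous_on_tendsto_compose[OF wc s(2) z] s(1) by simp
    show "(\<lambda>n. h (r n) (s n)) \<longlonglongrightarrow> 0"
    proof (cases "z \<in> orbit i")
      case False
      \<comment> \<open>Near a point off the orbit \<open>F\<close> itself tends to 0. If
        \<open>B z\<close> is on the orbit, the composed term stays bounded and the zero of
        \<open>w\<close> at \<open>z\<close> kills it.\<close>
      have "(\<lambda>n. w (s n) * F (r n) (B (s n))) \<longlonglongrightarrow> 0"
      proof (cases "B z \<in> orbit i")
        case True
        have "w z = 0"
        proof (rule zero)
          have "z \<notin> orbit j" for j
            using orbit_disjoint[OF B_orbit True] False by blast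
          moreover have "cmod z = 1"
          proof (rule ccontr)
            assume "cmod z \<noteq> 1"
            then have "cmod (B z) < 1" using z B_ball by auto
            then show False using True orbit_sphere[of i] by auto
          qed
          moreover have "B z \<in> tail 0" using True unfolding tail_def by blast
          ultimately show "z \<in> preimage 0 - (\<Union>i. orbit i)" by (simp add: preimage_def)
        qed
        then have "(\<lambda>n. cmod (w (s n)) * (real m * K)) \<longlonglongrightarrow> 0"
          using w_lim by (intro tendsto_mult_left_zero tendsto_norm_zero) simp
        then show ?thesis
          by (rule Lim_null_comparison[rotated])
            (intro always_eventually allI, unfold norm_mult, intro mult_left_mono F_le Bs norm_ge_zero)
      next
        case False
        then have "(\<lambda>n. w (s n) * F (r n) (B (s n))) \<longlonglongrightarrow> w z * 0"
          by (intro tendsto_mult w_lim F_lim[OF r Bs Bs_lim])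
        then show ?thesis by simp
      qed
      then have "(\<lambda>n. w (s n) * F (r n) (B (s n)) - \<mu> * F (r n) (s n)) \<longlonglongrightarrow> 0 - \<mu> * 0"
        by (intro tendsto_intros F_lim[OF r s False])
      then show ?thesis by (simp add: h_def)
    next
      case True
      then obtain k where k: "k < m" "z = p k" using orbit_p by auto
      \<comment> \<open>The successor index wraps around at \<open>m\<close>;
        \<open>a m = a 0\<close> keeps the recursion valid there.\<close>
      define k' where "k' = (if Suc k = m then 0 else Suc k)"
      have k': "k' < m" "p k' = p (Suc k)" "a k' = a (Suc k)"
        using k(1) p_m a_m a_0 m0 by (auto simp: k'_def)
      define \<beta> where "\<beta> = \<phi>' (X k)"
      have pk: "cis (\<phi> (X k)) = p k'" "cis (X k) = p k" using k'(2) by (simp_all add: p_def X_Suc)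
      obtain q where q: "\<And>y. 1 - B y * cnj (p k') = of_real \<beta> * (1 - y * cnj (p k)) * q y"
          "isCont q (p k)" "q (p k) = 1"
        using expansion_at_periodic_point[of "X k"] unfolding pk \<beta>_def[symmetric] by blast
      have q_lim: "(\<lambda>n. q (s n)) \<longlonglongrightarrow> 1"
        using isCont_tendsto_compose[OF q(2)] s(2) k(2) q(3) by metis
      define E where "E = exp (\<i> * of_real (\<tau> * ln \<beta>))"
      define \<delta> where "\<delta> = (\<lambda>n. \<psi> (r n) k' (B (s n)) - E * \<psi> (r n) k (s n))"
      have Bz: "B z = p k'" by (simp add: k k' p_Suc)
      have 1: "(\<lambda>n. F (r n) (B (s n)) - a k' * \<psi> (r n) k' (B (s n))) \<longlonglongrightarrow> 0"
        by (rule F_lim'[OF r Bs _ k'(1)]) (use Bs_lim Bz in simp)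
      have 2: "(\<lambda>n. F (r n) (s n) - a k * \<psi> (r n) k (s n)) \<longlonglongrightarrow> 0"
        by (rule F_lim'[OF r s(1) _ k(1)]) (use s(2) k(2) in simp)
      have Lq: "(\<lambda>n. Ln (q (s n))) \<longlonglongrightarrow> Ln 1" by (intro tendsto_Ln q_lim) auto
      have 3: "\<delta> \<longlonglongrightarrow> 0"
      proof (rule Lim_null_comparison)
        have "\<forall>\<^sub>F n in sequentially. 0 < Re (q (s n))"
          using order_tendstoD(1)[OF tendsto_Re[OF q_lim], of 0] by simp
        then show "\<forall>\<^sub>F n in sequentially. cmod (\<delta> n) \<le> exp (2 * \<bar>\<tau>\<bar>) *
            (4 * cmod (exp (\<i> * of_real \<tau> * Ln (q (s n))) - 1) + 40 * (\<bar>ln \<beta>\<bar> + cmod (Ln (q (s n)))) / N (r n))"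
        proof eventually_elim
          case (elim n)
          show ?case
            unfolding \<delta>_def \<psi>_def E_def
            by (rule log_bump_slow_variation[OF Re_one_minus_cnj_nonneg[OF p_norm]
                  Re_one_minus_cnj_nonneg[OF p_norm] N2 _ elim q(1)])
              (use s(1)[of n] Bs[of n] \<phi>'_pos in \<open>auto simp: \<beta>_def\<close>)
        qed
        have "(\<lambda>n. inverse (N (r n))) \<longlonglongrightarrow> 0" by (rule tendsto_inverse_0_at_top[OF N_lim[OF r]])
        then have "(\<lambda>n. exp (2 * \<bar>\<tau>\<bar>) * (4 * cmod (exp (\<i> * of_real \<tau> * Ln (q (s n))) - 1)
              + 40 * (\<bar>ln \<beta>\<bar> + cmod (Ln (q (s n)))) * inverse (N (r n)))) \<longlonglongrightarrow>
            exp (2 * \<bar>\<tau>\<bar>) * (4 * cmod (exp (\<i> * of_real \<tau> * Ln 1) - 1) + 40 * (\<bar>ln \<beta>\<bar> + cmod (Ln 1)) * 0)"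
          by (intro tendsto_intros Lq)
        then show "(\<lambda>n. exp (2 * \<bar>\<tau>\<bar>) * (4 * cmod (exp (\<i> * of_real \<tau> * Ln (q (s n))) - 1)
              + 40 * (\<bar>ln \<beta>\<bar> + cmod (Ln (q (s n)))) / N (r n))) \<longlonglongrightarrow> 0"
          by (simp add: divide_inverse)
      qed
      have wz: "w z = of_real c" using w_orbit True by simp
      have 4: "(\<lambda>n. (w (s n) - of_real c) * (a k' * \<psi> (r n) k' (B (s n)))) \<longlonglongrightarrow> 0"
      proof (rule Lim_null_comparison)
        show "\<forall>\<^sub>F n in sequentially. cmod ((w (s n) - of_real c) * (a k' * \<psi> (r n) k' (B (s n)))) \<le> cmod (w (s n) - of_real c) * K"
          by (intro always_eventually allI) (simp add: norm_mult a1 mult_left_mono \<psi>_le[OF Bs])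
        have "(\<lambda>n. w (s n) - of_real c) \<longlonglongrightarrow> w z - of_real c" by (intro tendsto_intros w_lim)
        then show "(\<lambda>n. cmod (w (s n) - of_real c) * K) \<longlonglongrightarrow> 0"
          by (intro tendsto_mult_left_zero tendsto_norm_zero) (simp add: wz)
      qed
      \<comment> \<open>The error splits into the bumps at the other orbit points, the variation of
        \<open>w\<close> near \<open>z\<close>, and the failure \<open>\<delta>\<close> of exact
        rotation; the main terms cancel by the recursion.\<close>
      have "(\<lambda>n. w (s n) * (F (r n) (B (s n)) - a k' * \<psi> (r n) k' (B (s n)))
            - \<mu> * (F (r n) (s n) - a k * \<psi> (r n) k (s n))
            + (w (s n) - of_real c) * (a k' * \<psi> (r n) k' (B (s n))) + of_real c * a k' * \<delta> n)
          \<longlonglongrightarrow> w z * 0 - \<mu> * 0 + 0 + of_real c * a k' * 0"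
        by (intro tendsto_intros w_lim 1 2 3 4)
      moreover have "h (r n) (s n) = w (s n) * (F (r n) (B (s n)) - a k' * \<psi> (r n) k' (B (s n)))
            - \<mu> * (F (r n) (s n) - a k * \<psi> (r n) k (s n))
            + (w (s n) - of_real c) * (a k' * \<psi> (r n) k' (B (s n))) + of_real c * a k' * \<delta> n" for n
      proof -
        have "a k' * E = a k * cis \<alpha>" unfolding E_def \<beta>_def k'(3) by (rule a_Suc)
        then have "of_real c * (a k' * E) = \<mu> * a k" by (simp add: \<mu>_eq)
        then have "of_real c * a k' * \<delta> n = of_real c * a k' * \<psi> (r n) k' (B (s n)) - \<mu> * a k * \<psi> (r n) k (s n)"
          unfolding \<delta>_def by algebra
        then show ?thesis unfolding h_def by algebra
      qed
      ultimately show ?thesis by simp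
    qed
  qed
  have F_norm: "\<forall>\<^sub>F n in sequentially. 1 / 2 < dnorm (F n)"
  proof -
    \<comment> \<open>On the radius to \<open>p 0\<close>, at distance exp (- N^2) from the circle,
      the bump at \<open>p 0\<close> takes its peak value while the others tend to 0.\<close>
    define y where "y = (\<lambda>n. of_real (1 - exp (- ((N n)^2))) * p 0)"
    have y: "y n \<in> cball 0 1" for n
      using p_norm[of 0] by (simp add: y_def norm_mult del: of_real_diff)
    have "filterlim N at_top sequentially"
      using N_lim[of id] by (simp add: strict_mono_def)
    then have "filterlim (\<lambda>n. - ((N n)^2)) at_bot sequentially"
      by (simp add: filterlim_uminus_at_top[symmetric] filterlim_pow_at_top)
    then have "(\<lambda>n. exp (- ((N n)^2))) \<longlonglongrightarrow> 0" by (rule filterlim_compose[OF exp_at_bot])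
    then have "y \<longlonglongrightarrow> of_real (1 - 0) * p 0" unfolding y_def by (intro tendsto_intros)
    then have "(\<lambda>n. F (id n) (y n) - a 0 * \<psi> (id n) 0 (y n)) \<longlonglongrightarrow> 0"
      by (intro F_lim' y m0) (auto simp: strict_mono_def)
    then have "\<forall>\<^sub>F n in sequentially. cmod (F n (y n) - \<psi> n 0 (y n)) < 1 / 2"
      using order_tendstoD(2)[OF tendsto_norm_zero, of _ sequentially "1 / 2"] a_0 by simp
    then show ?thesis
    proof eventually_elim
      case (elim n)
      have "p 0 * cnj (p 0) = 1" using p_norm[of 0] by (simp add: complex_norm_square[symmetric])
      then have "1 - y n * cnj (p 0) = of_real (exp (- ((N n)^2)))"
        by (simp add: y_def mult.assoc)
      then have "\<psi> n 0 (y n) = exp (\<i> * of_real \<tau> * of_real (- ((N n)^2)))"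
        unfolding \<psi>_def using log_bump_peak[of "N n" \<tau>] N2[of n] by (simp only:)
      then have "cmod (\<psi> n 0 (y n)) = 1" by simp
      then have "1 / 2 < cmod (F n (y n))"
        using elim norm_triangle_ineq2[of "\<psi> n 0 (y n)" "F n (y n)"] by (simp add: norm_minus_commute)
      also have "\<dots> \<le> dnorm (F n)" by (rule norm_le_dnorm[OF Fc y])
      finally show ?case .
    qed
  qed
  then obtain n0 where n0: "\<And>n. n0 \<le> n \<Longrightarrow> 1 / 2 < dnorm (F n)"
    by (auto simp: eventually_sequentially)
  define x where "x = (\<lambda>n z. of_real (1 / dnorm (F (n + n0))) * F (n + n0) z)"
  have dF: "1 / 2 < dnorm (F (n + n0))" for n by (rule n0) simp
  have x_DA: "x n \<in> disc_algebra" for n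
    using F_DA[of "n + n0"] dF[of n] unfolding x_def disc_algebra_def
    by (auto intro!: holomorphic_intros continuous_intros)
  have x_norm: "dnorm (x n) = 1" for n
    unfolding x_def dnorm_cmult[OF Fc] using dF[of n] by (simp add: norm_divide)
  have "(\<lambda>n. dnorm (\<lambda>z. w z * x n (B z) - \<mu> * x n z)) \<longlonglongrightarrow> 0"
  proof (rule Lim_null_comparison)
    show "(\<lambda>n. 2 * dnorm (h (n + n0))) \<longlonglongrightarrow> 0"
      by (intro tendsto_mult_right_zero LIMSEQ_ignore_initial_segment h_lim)
    have "dnorm (\<lambda>z. w z * x n (B z) - \<mu> * x n z) = 1 / dnorm (F (n + n0)) * dnorm (h (n + n0))" for n
    proof -
      have "dnorm (\<lambda>z. w z * x n (B z) - \<mu> * x n z) = dnorm (\<lambda>z. of_real (1 / dnorm (F (n + n0))) * h (n + n0) z)"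
        by (simp add: x_def h_def algebra_simps)
      then show ?thesis unfolding dnorm_cmult[OF hc] using dF[of n] by (simp add: norm_divide)
    qed
    moreover have "0 \<le> dnorm (h n)" for n
      by (rule dnorm_nonneg[OF hc])
    moreover have "1 / dnorm (F (n + n0)) \<le> 2" for n using dF[of n] by (simp add: field_simps)
    moreover have "0 < 1 / dnorm (F (n + n0))" for n using dF[of n] by simp
    ultimately show "\<forall>\<^sub>F n in sequentially. norm (dnorm (\<lambda>z. w z * x n (B z) - \<mu> * x n z)) \<le> 2 * dnorm (h (n + n0))"
      by (intro always_eventually allI)
        (simp only: real_norm_def abs_mult abs_of_pos abs_of_nonneg mult_right_mono)
  qed
  moreover have "\<not> (\<exists>r g. strict_mono r \<and> g \<in> disc_algebra \<and> (\<lambda>n. dnorm (\<lambda>z. x (r n) z - g z)) \<longlonglongrightarrow> 0)"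
  proof
    assume "\<exists>r g. strict_mono r \<and> g \<in> disc_algebra \<and> (\<lambda>n. dnorm (\<lambda>z. x (r n) z - g z)) \<longlonglongrightarrow> 0"
    then obtain r G where r: "strict_mono r" and G: "G \<in> disc_algebra"
      and lim: "(\<lambda>n. dnorm (\<lambda>z. x (r n) z - G z)) \<longlonglongrightarrow> 0" by blast
    have Gc: "continuous_on (cball 0 1) G" using G by (simp add: disc_algebra_def)
    \<comment> \<open>\<open>F\<close> tends to 0 at every interior point and the norms are bounded
      below, so a limit vanishes in the disc and, by continuity, on its closure. This contradicts
      norm 1.\<close>
    have "G z = 0" if z: "z \<in> ball 0 1" for z
    proof -
      have zc: "z \<in> cball 0 1" using z by simp
      have "strict_mono (\<lambda>n. r n + n0)" using r by (simp add: strict_mono_def)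
      moreover have "z \<notin> orbit i" using z orbit_sphere[of i] by auto
      ultimately have "(\<lambda>n. F (r n + n0) z) \<longlonglongrightarrow> 0" using F_lim[of "\<lambda>n. r n + n0" "\<lambda>_. z" z] zc by simp
      then have "(\<lambda>n. 2 * cmod (F (r n + n0) z)) \<longlonglongrightarrow> 0" by (intro tendsto_mult_right_zero tendsto_norm_zero)
      then have x0: "(\<lambda>n. x (r n) z) \<longlonglongrightarrow> 0"
      proof (rule Lim_null_comparison[rotated], intro always_eventually allI)
        fix n
        have "1 / dnorm (F (r n + n0)) \<le> 2" using dF[of "r n"] by (simp add: field_simps)
        then have "1 / dnorm (F (r n + n0)) * cmod (F (r n + n0) z) \<le> 2 * cmod (F (r n + n0) z)"
          by (rule mult_right_mono) simp
        then show "cmod (x (r n) z) \<le> 2 * cmod (F (r n + n0) z)"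
          using dF[of "r n"] by (simp add: x_def norm_mult norm_divide)
      qed
      have "(\<lambda>n. x (r n) z - G z) \<longlonglongrightarrow> 0"
      proof (rule Lim_null_comparison[OF _ lim], intro always_eventually allI)
        show "cmod (x (r n) z - G z) \<le> dnorm (\<lambda>z. x (r n) z - G z)" for n
          using x_DA[of "r n"] Gc by (intro norm_le_dnorm[of "\<lambda>z. x (r n) z - G z"] zc continuous_intros)
            (simp_all add: disc_algebra_def)
      qed
      from tendsto_diff[OF x0 this] have "(\<lambda>n. G z) \<longlonglongrightarrow> 0" by simp
      then show ?thesis by (simp add: LIMSEQ_const_iff)
    qed
    then have "G z = 0" if "z \<in> cball 0 1" for z
      by (rule continuous_constant_on_closure[of "ball 0 1" G 0 z, rotated 1]) (use Gc that in auto)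
    then have "dnorm (\<lambda>z. x (r n) z - G z) = 1" for n
      using dnorm_cong[of "\<lambda>z. x (r n) z - G z" "x (r n)"] x_norm by simp
    then show False using lim by (simp add: LIMSEQ_const_iff)
  qed
  ultimately show ?thesis unfolding usf_spectrum_def using x_DA x_norm by blast
qed

text \<open>A unit vector is chosen for each \<open>lam i\<close> with error below 1 / (i + 1), so
  the images under the operator tend to 0. A limit G of a subsequence satisfies w * (G o B) = 0,
  hence G o B = 0; since \<open>B\<close> maps the circle onto itself, G vanishes, against norm
  1.\<close>

lemma zero_in_usf_spectrum:
  assumes w: "w \<in> disc_algebra" and nz: "\<And>z. z \<in> ball 0 1 \<Longrightarrow> w z \<noteq> 0"
    and spec: "\<And>i. of_real (lam i) \<in> usf_spectrum (\<lambda>f z. w z * f (B z))"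
    and pos: "\<And>i. 0 < lam i" and lim: "lam \<longlonglongrightarrow> 0"
  shows "0 \<in> usf_spectrum (\<lambda>f z. w z * f (B z))"
proof -
  have wc: "continuous_on (cball 0 1) w" using w by (simp add: disc_algebra_def)
  have "\<exists>x\<in>disc_algebra. dnorm x = 1 \<and> dnorm (\<lambda>z. w z * x (B z) - of_real (lam i) * x z) < 1 / real (Suc i)" for i
  proof -
    obtain f where f: "\<And>n. f n \<in> disc_algebra" "\<And>n. dnorm (f n) = 1"
        and "(\<lambda>n. dnorm (\<lambda>z. w z * f n (B z) - of_real (lam i) * f n z)) \<longlonglongrightarrow> 0"
      using spec[of i] unfolding usf_spectrum_def by blast
    then have "\<forall>\<^sub>F n in sequentially. dnorm (\<lambda>z. w z * f n (B z) - of_real (lam i) * f n z) < 1 / real (Suc i)"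
      by (intro order_tendstoD(2)) auto
    then obtain n where "dnorm (\<lambda>z. w z * f n (B z) - of_real (lam i) * f n z) < 1 / real (Suc i)"
      using eventually_happens trivial_limit_sequentially by blast
    then show ?thesis using f by blast
  qed
  then have "\<exists>x. \<forall>i. x i \<in> disc_algebra \<and> dnorm (x i) = 1 \<and>
      dnorm (\<lambda>z. w z * x i (B z) - of_real (lam i) * x i z) < 1 / real (Suc i)"
    by (intro choice allI) blast
  then obtain x where x: "\<And>i. x i \<in> disc_algebra" "\<And>i. dnorm (x i) = 1"
      "\<And>i. dnorm (\<lambda>z. w z * x i (B z) - of_real (lam i) * x i z) < 1 / real (Suc i)"
    by blast
  have xc: "continuous_on (cball 0 1) (x i)" for i using x(1) by (simp add: disc_algebra_def)
  have xBc: "continuous_on (cball 0 1) (\<lambda>z. x i (B z))" for i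
    by (rule continuous_on_compose2[OF xc B_cont]) (use B_cball in auto)
  have Tx: "cmod (w z * x i (B z)) \<le> 1 / real (Suc i) + lam i" if z: "z \<in> cball 0 1" for i z
  proof -
    have "cmod (w z * x i (B z) - of_real (lam i) * x i z)
        \<le> dnorm (\<lambda>z. w z * x i (B z) - of_real (lam i) * x i z)"
      by (rule norm_le_dnorm[OF _ z]) (intro continuous_intros wc xc xBc)
    then have "cmod (w z * x i (B z) - of_real (lam i) * x i z) \<le> 1 / real (Suc i)"
      using x(3)[of i] by linarith
    moreover have "cmod (of_real (lam i) * x i z) \<le> lam i"
      using norm_le_dnorm[OF xc z, of i] x(2)[of i] pos[of i] by (simp add: norm_mult mult_left_le)
    ultimately show ?thesis
      using norm_triangle_sub[of "w z * x i (B z)" "of_real (lam i) * x i z"] by linarith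
  qed
  have b_lim: "(\<lambda>i. 1 / real (Suc i) + lam i) \<longlonglongrightarrow> 0"
    using tendsto_add[OF LIMSEQ_Suc[OF lim_1_over_n] lim] by simp
  have "(\<lambda>i. dnorm (\<lambda>z. w z * x i (B z) - 0 * x i z)) \<longlonglongrightarrow> 0"
  proof (rule Lim_null_comparison[OF _ b_lim], intro always_eventually allI)
    fix i
    have "dnorm (\<lambda>z. w z * x i (B z) - 0 * x i z) \<le> 1 / real (Suc i) + lam i"
      by (rule dnorm_le) (use Tx in simp)
    moreover have "0 \<le> dnorm (\<lambda>z. w z * x i (B z) - 0 * x i z)"
      by (rule dnorm_nonneg) (intro continuous_intros wc xc xBc)
    ultimately show "norm (dnorm (\<lambda>z. w z * x i (B z) - 0 * x i z)) \<le> 1 / real (Suc i) + lam i" by simp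
  qed
  moreover have "\<not> (\<exists>r g. strict_mono r \<and> g \<in> disc_algebra \<and> (\<lambda>n. dnorm (\<lambda>z. x (r n) z - g z)) \<longlonglongrightarrow> 0)"
  proof
    assume "\<exists>r g. strict_mono r \<and> g \<in> disc_algebra \<and> (\<lambda>n. dnorm (\<lambda>z. x (r n) z - g z)) \<longlonglongrightarrow> 0"
    then obtain r G where r: "strict_mono r" and G: "G \<in> disc_algebra"
      and conv: "(\<lambda>n. dnorm (\<lambda>z. x (r n) z - G z)) \<longlonglongrightarrow> 0" by blast
    have Gc: "continuous_on (cball 0 1) G" using G by (simp add: disc_algebra_def)
    have GBc: "continuous_on (cball 0 1) (\<lambda>z. G (B z))"
      by (rule continuous_on_compose2[OF Gc B_cont]) (use B_cball in auto)
    have x_lim: "(\<lambda>n. x (r n) z) \<longlonglongrightarrow> G z" if "z \<in> cball 0 1" for z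
    proof (rule LIM_zero_cancel, rule Lim_null_comparison[OF _ conv], intro always_eventually allI)
      show "cmod (x (r n) z - G z) \<le> dnorm (\<lambda>z. x (r n) z - G z)" for n
        by (intro norm_le_dnorm[of "\<lambda>z. x (r n) z - G z"] continuous_intros xc Gc that)
    qed
    have "G (B z) = 0" if z: "z \<in> ball 0 1" for z
    proof -
      have zc: "z \<in> cball 0 1" using z by simp
      have "(\<lambda>n. w z * x (r n) (B z)) \<longlonglongrightarrow> w z * G (B z)"
        by (intro tendsto_intros x_lim B_cball zc)
      moreover have "(\<lambda>n. w z * x (r n) (B z)) \<longlonglongrightarrow> 0"
      proof (rule Lim_null_comparison)
        show "\<forall>\<^sub>F n in sequentially. cmod (w z * x (r n) (B z)) \<le> 1 / real (Suc (r n)) + lam (r n)"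
          using Tx[OF zc] by (intro always_eventually allI)
        show "(\<lambda>n. 1 / real (Suc (r n)) + lam (r n)) \<longlonglongrightarrow> 0"
          using LIMSEQ_subseq_LIMSEQ[OF b_lim r] by (simp add: o_def)
      qed
      ultimately have "w z * G (B z) = 0" by (rule LIMSEQ_unique)
      then show ?thesis using nz[OF z] by simp
    qed
    then have GB0: "G (B z) = 0" if "z \<in> cball 0 1" for z
      by (rule continuous_constant_on_closure[of "ball 0 1" "\<lambda>z. G (B z)" 0 z, rotated 1]) (use GBc that in auto)
    have "G z = 0" if z: "z \<in> sphere 0 1" for z
    proof -
      obtain t where "z = cis t" using ex_cis_eq[OF z] by blast
      then have "z = B (cis (g t))" by (simp add: B_cis)
      then show ?thesis using GB0[of "cis (g t)"] by simp
    qed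
    then have G0: "G z = 0" if "z \<in> cball 0 1" for z
      using dnorm_attained_on_sphere[OF G] norm_le_dnorm[OF Gc that] by force
    have "dnorm (\<lambda>z. x (r n) z - G z) = 1" for n
      using dnorm_cong[of "\<lambda>z. x (r n) z - G z" "x (r n)"] G0 x(2) by simp
    then show False using conv by (simp add: LIMSEQ_const_iff)
  qed
  ultimately show ?thesis unfolding usf_spectrum_def using x(1,2) by blast
qed

section \<open>The spectrum for circle coverings\<close>

theorem ex_weight_usf_spectrum:
  fixes lam :: "nat \<Rightarrow> real"
  assumes pos: "\<And>i. 0 < lam i" and dec: "\<And>i. lam (Suc i) < lam i" and lim: "lam \<longlonglongrightarrow> 0"
  shows "\<exists>w\<in>disc_algebra. usf_spectrum (\<lambda>f z. w z * f (B z)) =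
    insert 0 (\<Union>i. (\<lambda>t. complex_of_real (lam i) * t) ` sphere 0 1)"
proof -
  obtain w where w: "w \<in> disc_algebra" and le: "\<And>z. z \<in> cball 0 1 \<Longrightarrow> cmod (w z) \<le> lam 0"
    and w_orbit: "\<And>i z. z \<in> orbit i \<Longrightarrow> w z = of_real (lam i)"
    and zero: "\<And>z. z \<in> preimage 0 - (\<Union>i. orbit i) \<Longrightarrow> w z = 0"
    and nz: "\<And>z. z \<in> cball 0 1 - preimage 0 \<Longrightarrow> w z \<noteq> 0"
    using ex_weight[OF dec lim] by blast
  have circle: "\<mu> \<in> usf_spectrum (\<lambda>f z. w z * f (B z))" if "cmod \<mu> = lam i" for \<mu> i
    by (rule usf_spectrum_orbit[OF w w_orbit zero that pos])
  have "0 \<in> usf_spectrum (\<lambda>f z. w z * f (B z))"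
  proof (rule zero_in_usf_spectrum[OF w _ _ pos lim])
    show "of_real (lam i) \<in> usf_spectrum (\<lambda>f z. w z * f (B z))" for i
      using pos[of i] by (intro circle[of _ i]) simp
    show "w z \<noteq> 0" if "z \<in> ball 0 1" for z using nz[of z] that by (auto simp: preimage_def)
  qed
  moreover have "of_real (lam i) * t \<in> usf_spectrum (\<lambda>f z. w z * f (B z))" if "t \<in> sphere 0 1" for i t
    using that pos[of i] by (intro circle[of _ i]) (simp add: norm_mult)
  moreover have "\<mu> \<in> (\<Union>i. (\<lambda>t. complex_of_real (lam i) * t) ` sphere 0 1)"
    if \<mu>: "\<mu> \<in> usf_spectrum (\<lambda>f z. w z * f (B z))" "\<mu> \<noteq> 0" for \<mu>
  proof -
    obtain i where i: "cmod \<mu> = lam i"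
      using usf_spectrum_modulus[of w lam \<mu>, OF w le w_orbit zero nz pos \<mu>] by blast
    have "\<mu> = of_real (lam i) * (\<mu> / of_real (lam i))" "\<mu> / of_real (lam i) \<in> sphere 0 1"
      using pos[of i] i by (auto simp: norm_divide)
    then show ?thesis by blast
  qed
  ultimately have "usf_spectrum (\<lambda>f z. w z * f (B z)) =
      insert 0 (\<Union>i. (\<lambda>t. complex_of_real (lam i) * t) ` sphere 0 1)" by blast
  then show ?thesis using w by blast
qed

end

section \<open>Finite Blaschke products\<close>

lemma prod_cis: "(\<Prod>j<n::nat. cis (f j)) = cis (\<Sum>j<n. f j)"
  by (induction n) (simp_all add: cis_mult)

lemma one_minus_ne_0:
  fixes t :: complex
  assumes "cmod t < 1"
  shows "1 - t \<noteq> 0"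
  using assms by (metis norm_one order_less_irrefl right_minus_eq)

text \<open>With v = 1 - a * cis (- x), a Blaschke factor at \<open>cis x\<close> is cis x * v / cnj
  v, of argument x + 2 Arg v. For \<bar>a\<bar> < 1 the real part of \<open>v\<close> is positive,
  so the principal logarithm gives a smooth choice.\<close>

definition blaschke_lift :: "real \<Rightarrow> (nat \<Rightarrow> complex) \<Rightarrow> nat \<Rightarrow> real \<Rightarrow> real" where
  "blaschke_lift \<theta> a d x = \<theta> + (\<Sum>j<d. x + 2 * Im (Ln (1 - a j * cis (- x))))"

text \<open>Each summand is the Poisson kernel (1 - \<bar>a\<bar>^2) / \<bar>cis x - a\<bar>^2,
  positive for \<bar>a\<bar> < 1.\<close>

definition blaschke_lift_deriv :: "(nat \<Rightarrow> complex) \<Rightarrow> nat \<Rightarrow> real \<Rightarrow> real" where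
  "blaschke_lift_deriv a d x = (\<Sum>j<d. 1 + 2 * Re (a j * cis (- x) / (1 - a j * cis (- x))))"

lemma blaschke_factor_cis:
  assumes "cmod a < 1"
  shows "(cis x - a) / (1 - cnj a * cis x) = cis (x + 2 * Im (Ln (1 - a * cis (- x))))"
proof -
  define v where "v = 1 - a * cis (- x)"
  have v0: "v \<noteq> 0" unfolding v_def using assms by (intro one_minus_ne_0) (simp add: norm_mult)
  have "v / cnj v = exp (Ln v) / exp (cnj (Ln v))"
    using v0 by (simp add: exp_cnj[symmetric])
  also have "\<dots> = exp (Ln v - cnj (Ln v))" by (simp add: exp_diff)
  also have "Ln v - cnj (Ln v) = \<i> * of_real (2 * Im (Ln v))" by (simp add: complex_eq_iff)
  finally have "v / cnj v = cis (2 * Im (Ln v))" by (simp add: cis_conv_exp)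
  moreover have "cis x - a = cis x * v" by (simp add: v_def algebra_simps cis_mult)
  moreover have "1 - cnj a * cis x = cnj v" by (simp add: v_def cis_cnj)
  ultimately show ?thesis
    by (simp only: v_def[symmetric] cis_mult[symmetric] times_divide_eq_right[symmetric])
qed

lemma blaschke_cis:
  assumes "\<forall>j<d. cmod (a j) < 1"
  shows "blaschke \<theta> a d (cis x) = cis (blaschke_lift \<theta> a d x)"
proof -
  have "(\<Prod>j<d. (cis x - a j) / (1 - cnj (a j) * cis x)) =
      (\<Prod>j<d. cis (x + 2 * Im (Ln (1 - a j * cis (- x)))))"
    using assms by (intro prod.cong refl blaschke_factor_cis) auto
  then show ?thesis
    by (simp add: blaschke_def prod_cis cis_conv_exp[of \<theta>, symmetric] cis_mult blaschke_lift_def)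
qed

lemma blaschke_lift_period: "blaschke_lift \<theta> a d (x + 2 * pi) = blaschke_lift \<theta> a d x + 2 * pi * real d"
proof -
  have "cis (- (x + 2 * pi)) = cis (- x)" by (simp add: complex_eq_iff sin_diff cos_diff)
  then have "blaschke_lift \<theta> a d (x + 2 * pi) =
      \<theta> + (\<Sum>j<d. (x + 2 * Im (Ln (1 - a j * cis (- x)))) + 2 * pi)"
    unfolding blaschke_lift_def by (simp add: algebra_simps)
  then show ?thesis unfolding blaschke_lift_def sum.distrib[of _ "\<lambda>_. 2 * pi"] by simp
qed

lemma Im_Ln_has_real_derivative:
  assumes "cmod a < 1"
  shows "((\<lambda>x. Im (Ln (1 - a * cis (- x)))) has_real_derivative
           Re (a * cis (- x) / (1 - a * cis (- x)))) (at x)"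
proof -
  define v where "v = 1 - a * exp (- (\<i> * of_real x))"
  have c: "cis (- y) = exp (- (\<i> * of_real y))" for y by (simp add: cis_conv_exp)
  have "Re (a * cis (- x)) \<le> cmod (a * cis (- x))" by (rule complex_Re_le_cmod)
  also have "\<dots> < 1" using assms by (simp add: norm_mult)
  finally have "0 < Re v" by (simp add: v_def c)
  then have "v \<notin> \<real>\<^sub>\<le>\<^sub>0" by (auto simp: complex_nonpos_Reals_iff)
  then have "((\<lambda>z. Ln (1 - a * exp (- (\<i> * z)))) has_field_derivative
      (\<i> * (a * exp (- (\<i> * of_real x)))) / v) (at (of_real x))"
    unfolding v_def by (auto intro!: derivative_eq_intros simp: divide_simps)
  then have "((\<lambda>y. Ln (1 - a * exp (- (\<i> * of_real y)))) has_vector_derivative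
      (\<i> * (a * exp (- (\<i> * of_real x)))) / v) (at x)"
    by (rule has_vector_derivative_real_field)
  then have "((\<lambda>y. Im (Ln (1 - a * exp (- (\<i> * of_real y))))) has_vector_derivative
      Im ((\<i> * (a * exp (- (\<i> * of_real x)))) / v)) (at x)"
    by (rule bounded_linear.has_vector_derivative[OF bounded_linear_Im])
  moreover have "Im ((\<i> * (a * exp (- (\<i> * of_real x)))) / v) = Re (a * exp (- (\<i> * of_real x)) / v)"
    by (simp only: times_divide_eq_right[symmetric] Im_i_times)
  ultimately show ?thesis
    by (simp only: c v_def has_real_derivative_iff_has_vector_derivative)
qed

lemma blaschke_lift_has_real_derivative:
  assumes "\<forall>j<d. cmod (a j) < 1"
  shows "(blaschke_lift \<theta> a d has_real_derivative blaschke_lift_deriv a d x) (at x)"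
proof -
  have "((\<lambda>x. \<theta> + (\<Sum>j<d. x + 2 * Im (Ln (1 - a j * cis (- x))))) has_real_derivative
      0 + (\<Sum>j<d. 1 + 2 * Re (a j * cis (- x) / (1 - a j * cis (- x))))) (at x)"
    by (intro DERIV_add DERIV_const DERIV_sum DERIV_ident DERIV_cmult Im_Ln_has_real_derivative)
      (use assms in auto)
  then show ?thesis by (simp add: blaschke_lift_def[abs_def] blaschke_lift_deriv_def)
qed

lemma poisson_kernel_pos:
  assumes "cmod t < 1"
  shows "0 < 1 + 2 * Re (t / (1 - t))"
proof -
  have n: "0 < (1 - Re t)^2 + (Im t)^2"
    using one_minus_ne_0[OF assms] by (auto simp: complex_eq_iff sum_power2_gt_zero_iff)
  have "(cmod t)^2 < 1" using assms by (simp add: abs_square_less_1)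
  then have "(Re t)^2 + (Im t)^2 < 1" by (simp add: cmod_power2)
  moreover have "1 + 2 * Re (t / (1 - t)) = (1 - ((Re t)^2 + (Im t)^2)) / ((1 - Re t)^2 + (Im t)^2)"
    using n by (simp add: Re_divide field_simps power2_eq_square)
  ultimately show ?thesis using n by simp
qed

lemma blaschke_lift_deriv_pos:
  assumes "\<forall>j<d. cmod (a j) < 1" "0 < d"
  shows "0 < blaschke_lift_deriv a d x"
  unfolding blaschke_lift_deriv_def
  by (intro sum_pos poisson_kernel_pos) (use assms in \<open>auto simp: norm_mult\<close>)

text \<open>Holomorphy near the closed disc provides the full complex derivative at boundary
  points.\<close>

lemma blaschke_holomorphic:
  assumes "\<forall>j<d. cmod (a j) < 1"
  obtains S where "open S" "cball 0 1 \<subseteq> S" "blaschke \<theta> a d holomorphic_on S"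
proof
  define S where "S = (\<Inter>j\<in>{..<d}. {z. 1 - cnj (a j) * z \<noteq> 0})"
  show "open S" unfolding S_def by (intro open_INT ballI open_Collect_neq continuous_intros) simp
  show "cball 0 1 \<subseteq> S"
  proof
    fix z :: complex assume z: "z \<in> cball 0 1"
    have "1 - cnj (a j) * z \<noteq> 0" if "j < d" for j
    proof (rule one_minus_ne_0)
      have "cmod (cnj (a j) * z) \<le> cmod (a j) * 1"
        unfolding norm_mult complex_mod_cnj using z by (intro mult_left_mono) auto
      then show "cmod (cnj (a j) * z) < 1" using assms that by force
    qed
    then show "z \<in> S" by (auto simp: S_def)
  qed
  show "blaschke \<theta> a d holomorphic_on S"
    unfolding blaschke_def[abs_def] by (intro holomorphic_intros) (auto simp: S_def)
qed

lemma blaschke_ball: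
  assumes "\<forall>j<d. cmod (a j) < 1" "0 < d" "cmod z < 1"
  shows "cmod (blaschke \<theta> a d z) < 1"
proof -
  have f: "cmod ((z - a j) / (1 - cnj (a j) * z)) < 1" if "j < d" for j
    using Moebius_function_norm_lt_1[of "a j" z 0] assms that by (simp add: Moebius_function_simple)
  obtain n where n: "d = Suc n" using assms(2) gr0_implies_Suc by blast
  have "cmod (blaschke \<theta> a d z) = (\<Prod>j<d. cmod ((z - a j) / (1 - cnj (a j) * z)))"
    unfolding blaschke_def norm_mult prod_norm[symmetric] by simp
  also have "\<dots> = (\<Prod>j<n. cmod ((z - a j) / (1 - cnj (a j) * z))) * cmod ((z - a n) / (1 - cnj (a n) * z))"
    unfolding n by simp
  also have "\<dots> \<le> 1 * cmod ((z - a n) / (1 - cnj (a n) * z))"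
  proof (intro mult_right_mono prod_le_1)
    show "0 \<le> cmod ((z - a j) / (1 - cnj (a j) * z)) \<and> cmod ((z - a j) / (1 - cnj (a j) * z)) \<le> 1"
      if "j \<in> {..<n}" for j using f[of j] that n by simp
  qed simp
  also have "\<dots> < 1" using f[of n] n by simp
  finally show ?thesis .
qed

text \<open>The relation between the product and its lift is differentiated in the real variable and
  solved for the complex derivative, which exists by holomorphy.\<close>

lemma blaschke_deriv_cis:
  assumes "\<forall>j<d. cmod (a j) < 1"
  shows "(blaschke \<theta> a d has_field_derivative
    of_real (blaschke_lift_deriv a d x) * cis (blaschke_lift \<theta> a d x) / cis x) (at (cis x))"
proof -
  obtain S where S: "open S" "cball 0 1 \<subseteq> S" "blaschke \<theta> a d holomorphic_on S"
    using blaschke_holomorphic[OF assms] by blast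
  have "cis x \<in> S" using S(2) by (simp add: subset_eq)
  then obtain D where D: "(blaschke \<theta> a d has_field_derivative D) (at (cis x))"
    using holomorphic_on_imp_differentiable_at[OF S(3,1)] by (auto simp: field_differentiable_def)
  have vd: "(cis has_vector_derivative \<i> * cis y) (at y)" for y
  proof -
    have "((\<lambda>z. exp (\<i> * z)) has_field_derivative \<i> * exp (\<i> * of_real y)) (at (of_real y))"
      by (auto intro!: derivative_eq_intros)
    from has_vector_derivative_real_field[OF this] show ?thesis
      by (simp add: cis_conv_exp[abs_def])
  qed
  have "((blaschke \<theta> a d \<circ> cis) has_vector_derivative \<i> * cis x * D) (at x)"
    by (rule field_vector_diff_chain_at[OF vd D])
  moreover have "((cis \<circ> blaschke_lift \<theta> a d) has_vector_derivative
      blaschke_lift_deriv a d x *\<^sub>R (\<i> * cis (blaschke_lift \<theta> a d x))) (at x)"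
    using blaschke_lift_has_real_derivative[OF assms]
    by (intro vector_diff_chain_at vd) (simp add: has_real_derivative_iff_has_vector_derivative)
  moreover have "blaschke \<theta> a d \<circ> cis = cis \<circ> blaschke_lift \<theta> a d"
    by (auto simp: blaschke_cis[OF assms])
  ultimately have "\<i> * cis x * D = blaschke_lift_deriv a d x *\<^sub>R (\<i> * cis (blaschke_lift \<theta> a d x))"
    using vector_derivative_unique_at by metis
  then have "\<i> * (cis x * D) = \<i> * (of_real (blaschke_lift_deriv a d x) * cis (blaschke_lift \<theta> a d x))"
    by (simp add: scaleR_conv_of_real mult_ac)
  then have "D = of_real (blaschke_lift_deriv a d x) * cis (blaschke_lift \<theta> a d x) / cis x"
    by (simp add: field_simps)
  then show ?thesis using D by simp
qed

section \<open>Application to elliptic and doubly parabolic products\<close>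

lemma wolff_point_tendsto:
  assumes "wolff_point B z0" "cmod z < 1"
  shows "(\<lambda>n. (B ^^ n) z) \<longlonglongrightarrow> z0"
proof -
  have "uniform_limit {z} (\<lambda>n. B ^^ n) (\<lambda>_. z0) sequentially"
  proof -
    have "compact {z}" "{z} \<subseteq> ball 0 1" using assms(2) by auto
    then show ?thesis using assms(1) unfolding wolff_point_def by blast
  qed
  then show ?thesis by (rule tendsto_uniform_limitI) simp
qed

theorem theorem9:
  fixes \<theta> :: real and a :: "nat \<Rightarrow> complex" and d :: nat and lam :: "nat \<Rightarrow> real"
  assumes "d \<ge> 2"
    and "\<forall>j<d. cmod (a j) < 1"
    and "elliptic (blaschke \<theta> a d) \<or> doubly_parabolic (blaschke \<theta> a d)"
    and "\<forall>i. lam i > 0"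
    and "\<forall>i. lam (Suc i) < lam i"
    and "lam \<longlonglongrightarrow> 0"
  shows "\<exists>w \<in> disc_algebra.
    usf_spectrum (\<lambda>f z. w z * f (blaschke \<theta> a d z)) =
      insert 0 (\<Union>i. (\<lambda>t. complex_of_real (lam i) * t) ` sphere 0 1)"
proof -
  \<comment> \<open>In the elliptic case the implication is vacuous, as \<open>z0\<close> lies in
    the open disc; in the doubly parabolic case it is part of the definition.\<close>
  obtain z0 where z0: "wolff_point (blaschke \<theta> a d) z0" "cmod z0 = 1 \<Longrightarrow> blaschke \<theta> a d z0 = z0"
    using assms(3) unfolding elliptic_def doubly_parabolic_def by fastforce
  obtain S where S: "open S" "cball 0 1 \<subseteq> S" "blaschke \<theta> a d holomorphic_on S"
    using blaschke_holomorphic[OF assms(2)] by blast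
  interpret circle_covering "blaschke \<theta> a d" "blaschke_lift \<theta> a d" "blaschke_lift_deriv a d" d z0
  proof
    show "blaschke \<theta> a d holomorphic_on ball 0 1"
      by (rule holomorphic_on_subset[OF S(3)]) (use S(2) in auto)
    show "continuous_on (cball 0 1) (blaschke \<theta> a d)"
      by (rule continuous_on_subset[OF holomorphic_on_imp_continuous_on[OF S(3)] S(2)])
    show "cmod (blaschke \<theta> a d z) < 1" if "cmod z < 1" for z
      using blaschke_ball[OF assms(2) _ that] assms(1) by simp
    show "0 < blaschke_lift_deriv a d x" for x
      using blaschke_lift_deriv_pos[OF assms(2)] assms(1) by simp
    show "(\<lambda>n. (blaschke \<theta> a d ^^ n) z) \<longlonglongrightarrow> z0" if "cmod z < 1" for z
      using wolff_point_tendsto[OF z0(1) that] .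
  qed (use assms z0(2) blaschke_cis[OF assms(2)] blaschke_lift_has_real_derivative[OF assms(2)]
      blaschke_deriv_cis[OF assms(2)] blaschke_lift_period in auto)
  show ?thesis by (rule ex_weight_usf_spectrum) (use assms(4-6) in auto)
qed

end
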